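(* For every $\delta\in(0,1]$ and every integer $q$ with $2\le q<\infty$ there exists $\epsilon_c'(\delta)<\epsilon_c(\delta)$ (allowed to depend on $q$) such that for every $\epsilon\in[0,1]$ with $\epsilon>\epsilon_c'(\delta)$, the $q$-color process $Z_n$ with parameters $(\delta,\epsilon)$ is ergodic.
   Context: Arrow model. Let $V=\{(x,t)\in\mathbb{Z}^2 : x+t \text{ even}\}$, and let $\delta,\epsilon\in[0,1]$. Let $(X(v))_{v\in V}$ be i.i.d. with values in $\{\nwarrow,\ \nearrow,\ \nwarrow\nearrow,\ \odot\}$ and $$P(X(v)=\nwarrow)=P(X(v)=\nearrow)=\tfrac12(1-\delta),\quad P(X(v)=\nwarrow\nearrow)=\delta(1-\epsilon),\quad P(X(v)=\odot)=\delta\epsilon .$$ For $v=(x,t)$ write $v_l=(x-1,t+1)$ (the vertex above left) and $v_r=(x+1,t+1)$ (the vertex above right). The value $\nwarrow$ means there is a single arrow out of $v$, pointing to $v_l$; $\nearrow$ a single arrow pointing to $v_r$; $\nwarrow\nearrow$ both arrows; $\odot$ no arrows. A path of $X$-arrows is a sequence of vertices each of which (except the last, if any) has an arrow to the next. Let $\Theta_\delta(\epsilon)$ be the probability that there is an infinite path of $X$-arrows starting from the origin, and let $\epsilon_c(\delta)=\inf\{\epsilon\in[0,1]:\Theta_\delta(\epsilon)=0\}$ be the percolation threshold. Color process. Let $2\le q<\infty$ and let $(Y(v))_{v\in V}$ be i.i.d. uniform on the set of colors $\{1,\dots,q\}$, independent of the $X(v)$'s. Row $n$ ($n\ge 0$)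 is the set of vertices $(x,-n)\in V$, so time $n$ runs downwards, opposite to the arrows. The colors $Z(v)$ for $v$ in row $0$ are given by some initial distribution, independent of the $X(v)$'s and $Y(v)$'s. For $v$ in row $n\ge1$, $$Z(v)=\begin{cases} Z(v_l) & \text{if } X(v)=\nwarrow,\\ Z(v_r) & \text{if } X(v)=\nearrow,\\ Z(v_l) & \text{if } X(v)=\nwarrow\nearrow \text{ and } Z(v_l)=Z(v_r),\\ Y(v) & \text{if } X(v)=\odot, \text{ or } X(v)=\nwarrow\nearrow \text{ and } Z(v_l)\ne Z(v_r).\end{cases}$$ $Z_n$ denotes the sequence of colors of the vertices of row $n$. Identifying row $n$ with $\mathbb{Z}$ via $(x,-n)\mapsto (x+n)/2$, $Z_n$ is a time-homogeneous discrete-time Markov process on $\{1,\dots,q\}^{\mathbb{Z}}$ (product topology). The process is called ergodic if it has a unique invariant distribution and, for every initial distribution, the law of $Z_n$ converges weakly to it as $n\to\infty$. *)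

theory Defs
  imports "HOL-Probability.Probability"
begin

section \<open>The arrow model\<close>

type_synonym vertex = "int \<times> int"

definition vertices :: "vertex set" where
  "vertices = {(x, t). even (x + t)}"

datatype arrows = Left_Arrow | Right_Arrow | Both_Arrows | No_Arrow

instance arrows :: countable
  by countable_datatype

definition left_up :: "vertex \<Rightarrow> vertex" where
  "left_up v = (fst v - 1, snd v + 1)"

definition right_up :: "vertex \<Rightarrow> vertex" where
  "right_up v = (fst v + 1, snd v + 1)"

definition arrow :: "(vertex \<Rightarrow> arrows) \<Rightarrow> vertex \<Rightarrow> vertex \<Rightarrow> bool" where
  "arrow X v w \<longleftrightarrow>
     (w = left_up v \<and> X v \<in> {Left_Arrow, Both_Arrows}) \<or>
     (w = right_up v \<and> X v \<in> {Right_Arrow, Both_Arrows})"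

text \<open>Meaningful for \<open>\<delta>\<close> and \<open>\<epsilon>\<close> in \<open>[0, 1]\<close> only, where the weights are nonnegative
  and sum to one.\<close>

definition arrows_pmf :: "real \<Rightarrow> real \<Rightarrow> arrows pmf" where
  "arrows_pmf \<delta> \<epsilon> = pmf_of_list
     [(Left_Arrow, (1 - \<delta>) / 2), (Right_Arrow, (1 - \<delta>) / 2),
      (Both_Arrows, \<delta> * (1 - \<epsilon>)), (No_Arrow, \<delta> * \<epsilon>)]"

lemma pmf_arrows_pmf:
  assumes "\<delta> \<in> {0..1}" "\<epsilon> \<in> {0..1}"
  shows "pmf (arrows_pmf \<delta> \<epsilon>) Left_Arrow = (1 - \<delta>) / 2"
    and "pmf (arrows_pmf \<delta> \<epsilon>) Right_Arrow = (1 - \<delta>) / 2"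
    and "pmf (arrows_pmf \<delta> \<epsilon>) Both_Arrows = \<delta> * (1 - \<epsilon>)"
    and "pmf (arrows_pmf \<delta> \<epsilon>) No_Arrow = \<delta> * \<epsilon>"
proof -
  have "pmf_of_list_wf
     [(Left_Arrow, (1 - \<delta>) / 2), (Right_Arrow, (1 - \<delta>) / 2),
      (Both_Arrows, \<delta> * (1 - \<epsilon>)), (No_Arrow, \<delta> * \<epsilon>)]"
    using assms by (auto simp: pmf_of_list_wf_def field_simps mult_left_le)
  note * = pmf_pmf_of_list[OF this]
  show "pmf (arrows_pmf \<delta> \<epsilon>) Left_Arrow = (1 - \<delta>) / 2"
    "pmf (arrows_pmf \<delta> \<epsilon>) Right_Arrow = (1 - \<delta>) / 2"
    "pmf (arrows_pmf \<delta> \<epsilon>) Both_Arrows = \<delta> * (1 - \<epsilon>)"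
    "pmf (arrows_pmf \<delta> \<epsilon>) No_Arrow = \<delta> * \<epsilon>"
    by (simp_all add: arrows_pmf_def *)
qed

definition arrow_measure :: "real \<Rightarrow> real \<Rightarrow> (vertex \<Rightarrow> arrows) measure" where
  "arrow_measure \<delta> \<epsilon> = (\<Pi>\<^sub>M v\<in>vertices. measure_pmf (arrows_pmf \<delta> \<epsilon>))"

definition infinite_path_from :: "(vertex \<Rightarrow> arrows) \<Rightarrow> vertex \<Rightarrow> bool" where
  "infinite_path_from X v \<longleftrightarrow> (\<exists>p :: nat \<Rightarrow> vertex. p 0 = v \<and> (\<forall>n. arrow X (p n) (p (Suc n))))"

definition percolation_prob :: "real \<Rightarrow> real \<Rightarrow> real" where
  "percolation_prob \<delta> \<epsilon> =
     measure (arrow_measure \<delta> \<epsilon>) {X \<in> space (arrow_measure \<delta> \<epsilon>). infinite_path_from X (0, 0)}"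

text \<open>For \<open>\<delta> = 0\<close> no vertex is ever without an arrow, so the infimum is over the empty set
  and the threshold carries no meaning.\<close>

definition percolation_threshold :: "real \<Rightarrow> real" where
  "percolation_threshold \<delta> = Inf {\<epsilon> \<in> {0..1}. percolation_prob \<delta> \<epsilon> = 0}"


section \<open>The color process\<close>

definition color_measure :: "nat \<Rightarrow> (vertex \<Rightarrow> nat) measure" where
  "color_measure q = (\<Pi>\<^sub>M v\<in>vertices. uniform_count_measure {1..q})"

definition config_space :: "nat \<Rightarrow> (int \<Rightarrow> nat) measure" where
  "config_space q = (\<Pi>\<^sub>M k\<in>UNIV. count_space {1..q})"

definition config_topology :: "nat \<Rightarrow> (int \<Rightarrow> nat) topology" where
  "config_topology q = product_topology (\<lambda>k. discrete_topology {1..q}) UNIV"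

definition initial_distribution :: "nat \<Rightarrow> (int \<Rightarrow> nat) measure \<Rightarrow> bool" where
  "initial_distribution q \<mu> \<longleftrightarrow> prob_space \<mu> \<and> sets \<mu> = sets (config_space q)"

text \<open>\<open>vertex_color z X Y n x\<close> is the color of the vertex \<open>(x, -n)\<close> when row 0 is colored by \<open>z\<close>.
  A row \<open>n\<close> is identified with the integers by sending \<open>(x, -n)\<close> to \<open>(x + n) / 2\<close>;
  only the values at \<open>x\<close> of the same parity as \<open>n\<close> belong to vertices.\<close>

primrec vertex_color ::
  "(int \<Rightarrow> nat) \<Rightarrow> (vertex \<Rightarrow> arrows) \<Rightarrow> (vertex \<Rightarrow> nat) \<Rightarrow> nat \<Rightarrow> int \<Rightarrow> nat"
where
  "vertex_color z X Y 0 x = z (x div 2)"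
| "vertex_color z X Y (Suc n) x =
     (let v = (x, - int (Suc n));
          l = vertex_color z X Y n (x - 1);
          r = vertex_color z X Y n (x + 1)
      in case X v of
           Left_Arrow \<Rightarrow> l
         | Right_Arrow \<Rightarrow> r
         | Both_Arrows \<Rightarrow> (if l = r then l else Y v)
         | No_Arrow \<Rightarrow> Y v)"

definition row_config ::
  "(int \<Rightarrow> nat) \<Rightarrow> (vertex \<Rightarrow> arrows) \<Rightarrow> (vertex \<Rightarrow> nat) \<Rightarrow> nat \<Rightarrow> int \<Rightarrow> nat"
where
  "row_config z X Y n = (\<lambda>k. vertex_color z X Y n (2 * k - int n))"

definition row_law ::
  "nat \<Rightarrow> real \<Rightarrow> real \<Rightarrow> (int \<Rightarrow> nat) measure \<Rightarrow> nat \<Rightarrow> (int \<Rightarrow> nat) measure"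
where
  "row_law q \<delta> \<epsilon> \<mu> n =
     distr (\<mu> \<Otimes>\<^sub>M (arrow_measure \<delta> \<epsilon> \<Otimes>\<^sub>M color_measure q)) (config_space q)
       (\<lambda>(z, X, Y). row_config z X Y n)"

definition invariant_distribution ::
  "nat \<Rightarrow> real \<Rightarrow> real \<Rightarrow> (int \<Rightarrow> nat) measure \<Rightarrow> bool"
where
  "invariant_distribution q \<delta> \<epsilon> \<pi> \<longleftrightarrow> initial_distribution q \<pi> \<and> row_law q \<delta> \<epsilon> \<pi> 1 = \<pi>"

text \<open>The measures are expected to live on the Borel sets of \<open>T\<close>. This holds for \<open>config_topology\<close>
  and \<open>config_space\<close>: a countable product of finite discrete spaces is second countable, so its
  Borel sets form the product sigma-algebra.\<close>

definition weakly_converges ::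
  "'a topology \<Rightarrow> (nat \<Rightarrow> 'a measure) \<Rightarrow> 'a measure \<Rightarrow> bool"
where
  "weakly_converges T M N \<longleftrightarrow>
     (\<forall>f :: 'a \<Rightarrow> real. continuous_map T euclideanreal f \<and> bounded (f ` topspace T) \<longrightarrow>
        (\<lambda>n. integral\<^sup>L (M n) f) \<longlonglongrightarrow> integral\<^sup>L N f)"

definition color_process_ergodic :: "nat \<Rightarrow> real \<Rightarrow> real \<Rightarrow> bool" where
  "color_process_ergodic q \<delta> \<epsilon> \<longleftrightarrow>
     (\<exists>\<pi>. invariant_distribution q \<delta> \<epsilon> \<pi> \<and>
          (\<forall>\<nu>. invariant_distribution q \<delta> \<epsilon> \<nu> \<longrightarrow> \<nu> = \<pi>) \<and>
          (\<forall>\<mu>. initial_distribution q \<mu> \<longrightarrow>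
             weakly_converges (config_topology q) (row_law q \<delta> \<epsilon> \<mu>) \<pi>))"


section \<open>Measurability\<close>

text \<open>Since \<open>measure\<close> and \<open>distr\<close> are total, the definitions of the percolation probability and
  of the law of a row are only meaningful because the event and the map involved are measurable.\<close>

primrec path_of_length :: "(vertex \<Rightarrow> arrows) \<Rightarrow> nat \<Rightarrow> vertex \<Rightarrow> bool" where
  "path_of_length X 0 v \<longleftrightarrow> True"
| "path_of_length X (Suc n) v \<longleftrightarrow> (\<exists>w. arrow X v w \<and> path_of_length X n w)"

lemma path_of_length_Suc_D: "path_of_length X (Suc n) v \<Longrightarrow> path_of_length X n v"
  by (induction n arbitrary: v) (simp, metis path_of_length.simps(2))

lemma path_of_length_antimono:
  assumes "path_of_length X n v" "m \<le> n"
  shows "path_of_length X m v"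
  using assms(2,1) by (induction rule: dec_induct) (use path_of_length_Suc_D in blast)+

lemma path_of_length_extend:
  assumes "\<forall>n. path_of_length X n v"
  shows "\<exists>w. arrow X v w \<and> (\<forall>n. path_of_length X n w)"
proof (rule ccontr)
  assume neg: "\<not> ?thesis"
  have "\<exists>N. \<not> (arrow X v w \<and> path_of_length X N w)" for w
    using neg by blast
  then obtain a b where
    a: "\<not> (arrow X v (left_up v) \<and> path_of_length X a (left_up v))" and
    b: "\<not> (arrow X v (right_up v) \<and> path_of_length X b (right_up v))"
    by meson
  obtain w where w: "arrow X v w" "path_of_length X (max a b) w"
    using assms[rule_format, of "Suc (max a b)"] by auto
  have "path_of_length X a w" "path_of_length X b w"
    using path_of_length_antimono[OF w(2)] by auto
  moreover have "w = left_up v \<or> w = right_up v"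
    using w(1) by (auto simp: arrow_def)
  ultimately show False
    using a b w(1) by auto
qed

lemma infinite_path_from_iff: "infinite_path_from X v \<longleftrightarrow> (\<forall>n. path_of_length X n v)"
proof
  assume "infinite_path_from X v"
  then obtain p where p: "p 0 = v" "\<And>n. arrow X (p n) (p (Suc n))"
    by (auto simp: infinite_path_from_def)
  have "path_of_length X n (p m)" for n m
    by (induction n arbitrary: m) (use p in \<open>auto simp del: split_paired_Ex\<close>)
  then show "\<forall>n. path_of_length X n v"
    using p(1) by metis
next
  assume *: "\<forall>n. path_of_length X n v"
  have "\<exists>p. \<forall>k. ((\<forall>n. path_of_length X n (p k)) \<and> (k = 0 \<longrightarrow> p k = v)) \<and> arrow X (p k) (p (Suc k))"
  proof (rule dependent_nat_choice)
    show "\<exists>w. (\<forall>n. path_of_length X n w) \<and> ((0::nat) = 0 \<longrightarrow> w = v)"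
      using * by blast
    show "\<exists>w'. ((\<forall>n. path_of_length X n w') \<and> (Suc k = 0 \<longrightarrow> w' = v)) \<and> arrow X w w'"
      if "(\<forall>n. path_of_length X n w) \<and> (k = 0 \<longrightarrow> w = v)" for w k
      using path_of_length_extend[of X w] that by blast
  qed
  then show "infinite_path_from X v"
    by (auto simp: infinite_path_from_def)
qed

lemma left_up_in_vertices [simp]: "left_up v \<in> vertices \<longleftrightarrow> v \<in> vertices"
  by (auto simp: left_up_def vertices_def case_prod_unfold)

lemma right_up_in_vertices [simp]: "right_up v \<in> vertices \<longleftrightarrow> v \<in> vertices"
  by (auto simp: right_up_def vertices_def case_prod_unfold)

lemma sets_arrow_color_measure [measurable_cong]:
  "sets (arrow_measure \<delta> \<epsilon>) = sets (\<Pi>\<^sub>M v\<in>vertices. count_space UNIV)"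
  "sets (color_measure q) = sets (\<Pi>\<^sub>M v\<in>vertices. count_space {1..q})"
  unfolding arrow_measure_def color_measure_def
  by (rule sets_PiM_cong; simp add: sets_uniform_count_measure)+

lemma measurable_arrow_component:
  assumes "v \<in> vertices"
  shows "(\<lambda>X. X v) \<in> measurable (arrow_measure \<delta> \<epsilon>) (count_space UNIV)"
  using assms unfolding measurable_cong_sets[OF sets_arrow_color_measure(1) refl]
  by (rule measurable_component_singleton)

lemma measurable_color_component:
  assumes "v \<in> vertices"
  shows "(\<lambda>Y. Y v) \<in> measurable (color_measure q) (count_space {1..q})"
  using assms unfolding measurable_cong_sets[OF sets_arrow_color_measure(2) refl]
  by (rule measurable_component_singleton)

lemma pred_path_of_length:
  assumes "v \<in> vertices"
  shows "Measurable.pred (arrow_measure \<delta> \<epsilon>) (\<lambda>X. path_of_length X n v)"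
  using assms
proof (induction n arbitrary: v)
  case (Suc n)
  note [measurable] = measurable_arrow_component[OF Suc.prems, of \<delta> \<epsilon>]
  have [measurable]:
    "Measurable.pred (arrow_measure \<delta> \<epsilon>) (\<lambda>X. path_of_length X n (left_up v))"
    "Measurable.pred (arrow_measure \<delta> \<epsilon>) (\<lambda>X. path_of_length X n (right_up v))"
    using Suc by simp_all
  have "path_of_length X (Suc n) v \<longleftrightarrow>
     (X v \<in> {Left_Arrow, Both_Arrows} \<and> path_of_length X n (left_up v)) \<or>
     (X v \<in> {Right_Arrow, Both_Arrows} \<and> path_of_length X n (right_up v))" for X
    by (auto simp: arrow_def simp del: split_paired_Ex)
  then show ?case
    by (simp del: path_of_length.simps)
qed simp

lemma pred_infinite_path_from:
  assumes "v \<in> vertices"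
  shows "Measurable.pred (arrow_measure \<delta> \<epsilon>) (\<lambda>X. infinite_path_from X v)"
  unfolding infinite_path_from_iff
  using pred_path_of_length[OF assms] by measurable

lemma measurable_vertex_color:
  assumes "sets \<mu> = sets (config_space q)" "(x, - int n) \<in> vertices"
  shows "(\<lambda>(z, X, Y). vertex_color z X Y n x)
     \<in> measurable (\<mu> \<Otimes>\<^sub>M (arrow_measure \<delta> \<epsilon> \<Otimes>\<^sub>M color_measure q)) (count_space {1..q})"
  using assms(2)
proof (induction n arbitrary: x)
  case 0
  have "(\<lambda>z. z (x div 2)) \<in> measurable \<mu> (count_space {1..q})"
    unfolding measurable_cong_sets[OF assms(1) refl] config_space_def by simp
  from measurable_compose[OF measurable_fst this] show ?case
    by (simp add: case_prod_unfold)
next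
  case (Suc n)
  let ?M = "\<mu> \<Otimes>\<^sub>M (arrow_measure \<delta> \<epsilon> \<Otimes>\<^sub>M color_measure q)"
  let ?v = "(x, - int (Suc n))"
  define l where "l = (\<lambda>(z, X, Y). vertex_color z X Y n (x - 1))"
  define r where "r = (\<lambda>(z, X, Y). vertex_color z X Y n (x + 1))"
  have l: "l \<in> measurable ?M (count_space {1..q})" and r: "r \<in> measurable ?M (count_space {1..q})"
    unfolding l_def r_def using Suc.prems by (intro Suc.IH; auto simp: vertices_def)+
  have X: "(\<lambda>\<omega>. fst (snd \<omega>) ?v) \<in> measurable ?M (count_space UNIV)"
    using measurable_compose[OF measurable_compose[OF measurable_snd measurable_fst]
        measurable_arrow_component[OF Suc.prems]] .
  have Y: "(\<lambda>\<omega>. snd (snd \<omega>) ?v) \<in> measurable ?M (count_space {1..q})"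
    using measurable_compose[OF measurable_compose[OF measurable_snd measurable_snd]
        measurable_color_component[OF Suc.prems]] .
  have l': "l \<in> measurable ?M (count_space UNIV)" and r': "r \<in> measurable ?M (count_space UNIV)"
    using measurable_compose[OF l, of "\<lambda>c. c"] measurable_compose[OF r, of "\<lambda>c. c"] by simp_all
  have eq: "Measurable.pred ?M (\<lambda>\<omega>. l \<omega> = r \<omega>)"
    by (rule measurable_compose_countable[where f = "\<lambda>c \<omega>. c = r \<omega>", OF _ l'])
      (rule measurable_compose[OF r'], simp)
  have "(\<lambda>\<omega>. (\<lambda>a \<omega>. case a of Left_Arrow \<Rightarrow> l \<omega> | Right_Arrow \<Rightarrow> r \<omega>
      | Both_Arrows \<Rightarrow> (if l \<omega> = r \<omega> then l \<omega> else snd (snd \<omega>) ?v)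
      | No_Arrow \<Rightarrow> snd (snd \<omega>) ?v) (fst (snd \<omega>) ?v) \<omega>) \<in> measurable ?M (count_space {1..q})"
  proof (rule measurable_compose_countable[OF _ X])
    fix a :: arrows
    show "(\<lambda>\<omega>. case a of Left_Arrow \<Rightarrow> l \<omega> | Right_Arrow \<Rightarrow> r \<omega>
      | Both_Arrows \<Rightarrow> (if l \<omega> = r \<omega> then l \<omega> else snd (snd \<omega>) ?v)
      | No_Arrow \<Rightarrow> snd (snd \<omega>) ?v) \<in> measurable ?M (count_space {1..q})"
      using l r Y eq by (cases a) (auto intro!: measurable_If simp: pred_def)
  qed
  then show ?case
    by (simp only: l_def r_def case_prod_unfold Let_def vertex_color.simps)
qed

lemma measurable_row_config:
  assumes "sets \<mu> = sets (config_space q)"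
  shows "(\<lambda>(z, X, Y). row_config z X Y n)
     \<in> measurable (\<mu> \<Otimes>\<^sub>M (arrow_measure \<delta> \<epsilon> \<Otimes>\<^sub>M color_measure q)) (config_space q)"
  unfolding config_space_def row_config_def case_prod_unfold
proof -
  let ?M = "\<mu> \<Otimes>\<^sub>M (arrow_measure \<delta> \<epsilon> \<Otimes>\<^sub>M color_measure q)"
  have *: "(\<lambda>\<omega>. vertex_color (fst \<omega>) (fst (snd \<omega>)) (snd (snd \<omega>)) n (2 * k - int n))
      \<in> measurable ?M (count_space {1..q})" for k
  proof -
    have "(2 * k - int n, - int n) \<in> vertices"
      by (auto simp: vertices_def)
    from measurable_vertex_color[OF assms this, of \<delta> \<epsilon>] show ?thesis
      by (simp add: case_prod_unfold)
  qed
  show "(\<lambda>\<omega> k. vertex_color (fst \<omega>) (fst (snd \<omega>)) (snd (snd \<omega>)) n (2 * k - int n))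
      \<in> measurable ?M (\<Pi>\<^sub>M k\<in>UNIV. count_space {1..q})"
    using * measurable_space[OF *] by (intro measurable_PiM_single') (simp_all add: PiE_UNIV_domain)
qed

lemma initial_distribution_row_law:
  assumes "initial_distribution q \<mu>" "q \<ge> 1"
  shows "initial_distribution q (row_law q \<delta> \<epsilon> \<mu> n)"
proof -
  interpret \<mu>: prob_space \<mu>
    using assms by (simp add: initial_distribution_def)
  interpret A: prob_space "arrow_measure \<delta> \<epsilon>"
    unfolding arrow_measure_def by (intro prob_space_PiM prob_space_measure_pmf)
  interpret C: prob_space "color_measure q"
    unfolding color_measure_def
    using assms by (intro prob_space_PiM prob_space_uniform_count_measure) auto
  interpret AC: pair_prob_space "arrow_measure \<delta> \<epsilon>" "color_measure q" ..
  interpret P: pair_prob_space \<mu> "arrow_measure \<delta> \<epsilon> \<Otimes>\<^sub>M color_measure q" ..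
  show ?thesis
    using assms measurable_row_config[of \<mu> q n \<delta> \<epsilon>]
    by (auto simp: initial_distribution_def row_law_def intro!: P.prob_space_distr)
qed

end

theory Submission
  imports Defs
begin

text \<open>Let \<open>v\<close> be a branching vertex, one of whose children \<open>b\<close> is a source, so that \<open>Z b = Y b\<close>. If
  \<open>Y v = Y b\<close>, then \<open>Z v = Y v\<close> whatever the other child is: either the two children agree in the color
  \<open>Y v\<close>, or they disagree and \<open>Y v\<close> is used. Colors are therefore determined once the paths of the
  \<^emph>\<open>diminished\<close> arrows die out, in which such vertices become sources. By an Aizenman-Grimmett type
  differential inequality, diminishing compensates for a slightly smaller \<open>\<epsilon>\<close>, so the diminished
  paths still die out somewhat below \<open>\<epsilon>\<^sub>c\<close>. This needs \<open>\<epsilon>\<^sub>c > 0\<close>, which follows from a comparison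
  with oriented site percolation and a contour argument. Given extinction, ergodicity follows by
  coupling from the past.\<close>

section \<open>Finite product expectations\<close>

text \<open>The obstacle is dependence: the equalities \<open>Y v = Y b\<close> along the edges of
  the lattice close up into cycles, so they cannot all serve as independent marks. Each vertex is
  therefore compared with only one child, chosen by an auxiliary fair coin. The comparisons then
  form a forest, and the marks are i.i.d. of density \<open>1 / q\<close>, independent of the
  arrows. A mark consults the original arrow of the child, so that diminishing stays local. The
  death rate \<epsilon> and the mark density are moved together along a segment that ends at density
  \<open>1 / q\<close>. The influence of an arrow is compared with the influences of nearby marks by
  local surgery, and the surgery closes a vertex. Forcing a source costs the factor
  \<open>\<delta> * \<epsilon>\<close>, which degenerates as \<epsilon> tends to 0: this is where a
  positive threshold enters. The threshold is also at most 1/2, which keeps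
  \<open>1 - \<epsilon>\<close> away from 0. Hence the slope of the segment can be chosen
  independently of the path length, and the comparison survives the limit.\<close>

definition ex :: "'s set \<Rightarrow> 'i set \<Rightarrow> ('s \<Rightarrow> real) \<Rightarrow> (('i \<Rightarrow> 's) \<Rightarrow> real) \<Rightarrow> real" where
  "ex S I w \<phi> = (\<Sum>f\<in>PiE I (\<lambda>_. S). (\<Prod>i\<in>I. w (f i)) * \<phi> f)"

lemma ex_empty [simp]: "ex S {} w \<phi> = \<phi> (\<lambda>_. undefined)"
  by (simp add: ex_def)

lemma ex_insert:
  assumes "finite S" "finite I" "v \<notin> I"
  shows "ex S (insert v I) w \<phi> = (\<Sum>a\<in>S. w a * ex S I w (\<lambda>f. \<phi> (f(v := a))))"
proof -
  have inj: "inj_on (\<lambda>(y, g). g(v := y)) (S \<times> (PiE I (\<lambda>_. S)))"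
    using inj_combinator[OF assms(3), of "\<lambda>_. S"] by simp
  have "ex S (insert v I) w \<phi> = (\<Sum>(a, g)\<in>S \<times> PiE I (\<lambda>_. S).
      (\<Prod>i\<in>insert v I. w ((g(v := a)) i)) * \<phi> (g(v := a)))"
    unfolding ex_def PiE_insert_eq
    by (subst sum.reindex[OF inj]) (simp add: case_prod_unfold)
  also have "\<dots> = (\<Sum>(a, g)\<in>S \<times> PiE I (\<lambda>_. S). w a * ((\<Prod>i\<in>I. w (g i)) * \<phi> (g(v := a))))"
  proof (intro sum.cong refl, clarify)
    fix a g
    have "(\<Prod>i\<in>insert v I. w ((g(v := a)) i)) = w a * (\<Prod>i\<in>I. w ((g(v := a)) i))"
      using assms by simp
    also have "(\<Prod>i\<in>I. w ((g(v := a)) i)) = (\<Prod>i\<in>I. w (g i))"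
      using assms by (intro prod.cong) auto
    finally show "(\<Prod>i\<in>insert v I. w ((g(v := a)) i)) * \<phi> (g(v := a))
        = w a * ((\<Prod>i\<in>I. w (g i)) * \<phi> (g(v := a)))"
      by simp
  qed
  also have "\<dots> = (\<Sum>a\<in>S. w a * ex S I w (\<lambda>f. \<phi> (f(v := a))))"
    by (simp add: sum.cartesian_product[symmetric] ex_def sum_distrib_left)
  finally show ?thesis .
qed

lemma ex_cong:
  assumes "\<And>f. f \<in> PiE I (\<lambda>_. S) \<Longrightarrow> \<phi> f = \<psi> f"
  shows "ex S I w \<phi> = ex S I w \<psi>"
  unfolding ex_def by (intro sum.cong) (simp_all add: assms)

lemma ex_add: "ex S I w (\<lambda>f. \<phi> f + \<psi> f) = ex S I w \<phi> + ex S I w \<psi>"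
  by (simp add: ex_def algebra_simps sum.distrib)

lemma ex_diff: "ex S I w (\<lambda>f. \<phi> f - \<psi> f) = ex S I w \<phi> - ex S I w \<psi>"
  by (simp add: ex_def algebra_simps sum_subtractf)

lemma ex_mult: "ex S I w (\<lambda>f. c * \<phi> f) = c * ex S I w \<phi>"
  by (simp add: ex_def algebra_simps sum_distrib_left)

lemma ex_sum: "ex S I w (\<lambda>f. \<Sum>j\<in>J. \<phi> j f) = (\<Sum>j\<in>J. ex S I w (\<phi> j))"
  unfolding ex_def sum_distrib_left by (rule sum.swap)

lemma ex_mono:
  assumes "\<And>a. a \<in> S \<Longrightarrow> 0 \<le> w a"
    and "\<And>f. f \<in> PiE I (\<lambda>_. S) \<Longrightarrow> \<phi> f \<le> \<psi> f"
  shows "ex S I w \<phi> \<le> ex S I w \<psi>"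
  unfolding ex_def
  by (intro sum_mono mult_left_mono prod_nonneg) (use assms in \<open>auto simp: PiE_iff\<close>)

lemma ex_const:
  assumes "finite S" "finite I" "sum w S = 1"
  shows "ex S I w (\<lambda>_. c) = c"
  using assms(2)
  by (induction I rule: finite_induct)
    (simp_all add: ex_insert assms sum_distrib_right[symmetric])

lemma ex_nonneg:
  assumes "\<And>a. a \<in> S \<Longrightarrow> 0 \<le> w a" "\<And>f. f \<in> PiE I (\<lambda>_. S) \<Longrightarrow> 0 \<le> \<phi> f"
  shows "0 \<le> ex S I w \<phi>"
  unfolding ex_def
  by (intro sum_nonneg mult_nonneg_nonneg prod_nonneg) (use assms in \<open>auto simp: PiE_iff\<close>)

text \<open>The old value at \<open>v\<close> is overwritten and the weights sum to 1, so
  \<open>v\<close> may be drawn afresh. Conditioning on the state of one vertex is expressed in this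
  form throughout.\<close>

lemma ex_resample:
  assumes "finite S" "finite I" "sum w S = 1" "v \<in> I"
  shows "ex S I w \<phi> = (\<Sum>a\<in>S. w a * ex S I w (\<lambda>f. \<phi> (f(v := a))))"
proof -
  define J where "J = I - {v}"
  have I: "I = insert v J" "v \<notin> J" "finite J"
    using assms by (auto simp: J_def)
  have "ex S I w (\<lambda>f. \<phi> (f(v := a))) = ex S J w (\<lambda>f. \<phi> (f(v := a)))" for a
    unfolding I by (simp add: ex_insert[OF assms(1) I(3,2)] sum_distrib_right[symmetric] assms(3))
  then show ?thesis
    unfolding I by (simp add: ex_insert[OF assms(1) I(3,2)])
qed

text \<open>Coordinates outside \<open>A\<close> are resampled one by one.\<close>

lemma ex_indep:
  assumes S: "finite S" "finite I" "sum w S = 1" and A: "finite A" "A \<subseteq> I"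
    and \<phi>: "\<And>f g. (\<And>i. i \<in> A \<Longrightarrow> f i = g i) \<Longrightarrow> \<phi> f = \<phi> g"
    and \<psi>: "\<And>f v a. v \<in> A \<Longrightarrow> \<psi> (f(v := a)) = \<psi> f"
  shows "ex S I w (\<lambda>f. \<phi> f * \<psi> f) = ex S I w \<phi> * ex S I w \<psi>"
  using A \<phi> \<psi>
proof (induction A arbitrary: \<phi> rule: finite_induct)
  case empty
  have "\<phi> f = \<phi> undefined" for f
    by (rule empty(2)) (simp only: empty_iff)
  then have *: "ex S I w \<phi> = ex S I w (\<lambda>_. \<phi> undefined)"
    "ex S I w (\<lambda>f. \<phi> f * \<psi> f) = ex S I w (\<lambda>f. \<phi> undefined * \<psi> f)"
    by (auto intro!: ex_cong arg_cong2[where f = "(*)"])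
  show ?case
    unfolding * ex_const[OF S] by (rule ex_mult)
next
  case (insert v A)
  have IH: "ex S I w (\<lambda>f. \<phi> (f(v := a)) * \<psi> f) = ex S I w (\<lambda>f. \<phi> (f(v := a))) * ex S I w \<psi>" for a
  proof (rule insert.IH)
    show "\<phi> (f(v := a)) = \<phi> (g(v := a))" if "\<And>i. i \<in> A \<Longrightarrow> f i = g i" for f g
      by (rule insert.prems(2)) (use that in auto)
  qed (use insert.prems(1,3) in auto)
  have v: "v \<in> I"
    using insert.prems(1) by simp
  have upd: "\<psi> (f(v := a)) = \<psi> f" for f a
    by (rule insert.prems(3)) simp
  have "ex S I w (\<lambda>f. \<phi> f * \<psi> f) = (\<Sum>a\<in>S. w a * ex S I w (\<lambda>f. \<phi> (f(v := a)) * \<psi> f))"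
    by (subst ex_resample[OF S v]) (simp only: upd)
  also have "\<dots> = ex S I w \<phi> * ex S I w \<psi>"
    unfolding IH by (subst ex_resample[OF S v, of \<phi>]) (simp add: sum_distrib_right mult.assoc)
  finally show ?case .
qed

text \<open>Needed for the closed cells along a contour, whose boxes are disjoint.\<close>

lemma ex_indep_prod:
  assumes S: "finite S" "finite I" "sum w S = 1" and D: "finite D"
    and B: "\<And>c. c \<in> D \<Longrightarrow> B c \<subseteq> I" "disjoint_family_on B D"
    and \<phi>: "\<And>c f g. c \<in> D \<Longrightarrow> (\<And>i. i \<in> B c \<Longrightarrow> f i = g i) \<Longrightarrow> \<phi> c f = \<phi> c g"
  shows "ex S I w (\<lambda>f. \<Prod>c\<in>D. \<phi> c f) = (\<Prod>c\<in>D. ex S I w (\<phi> c))"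
  using D B \<phi>
proof (induction D rule: finite_induct)
  case empty
  then show ?case by (simp add: ex_const[OF S])
next
  case (insert c D)
  have "ex S I w (\<lambda>f. \<phi> c f * (\<Prod>c\<in>D. \<phi> c f)) = ex S I w (\<phi> c) * ex S I w (\<lambda>f. \<Prod>c\<in>D. \<phi> c f)"
  proof (rule ex_indep[OF S, of "B c"])
    show "B c \<subseteq> I" using insert.prems by auto
    then show "finite (B c)" using S finite_subset by blast
    show "(\<Prod>c\<in>D. \<phi> c (f(v := a))) = (\<Prod>c\<in>D. \<phi> c f)" if "v \<in> B c" for f v a
    proof (rule prod.cong[OF refl])
      fix d assume "d \<in> D"
      then have "B c \<inter> B d = {}"
        using insert.prems(2) insert.hyps by (auto simp: disjoint_family_on_def)
      then show "\<phi> d (f(v := a)) = \<phi> d f"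
        by (intro insert.prems(3)) (use that \<open>d \<in> D\<close> in auto)
    qed
    show "\<phi> c f = \<phi> c g" if "\<And>i. i \<in> B c \<Longrightarrow> f i = g i" for f g
      by (rule insert.prems(3)) (use that in auto)
  qed
  also have "ex S I w (\<lambda>f. \<Prod>c\<in>D. \<phi> c f) = (\<Prod>c\<in>D. ex S I w (\<phi> c))"
  proof (rule insert.IH)
    show "\<phi> d f = \<phi> d g" if "d \<in> D" "\<And>i. i \<in> B d \<Longrightarrow> f i = g i" for d f g
      by (rule insert.prems(3)) (use that in auto)
  qed (use insert.prems(1,2) in \<open>auto simp: disjoint_family_on_def\<close>)
  finally show ?case
    using insert.hyps by simp
qed

text \<open>This is Russo's formula before the signs are sorted out: the expectation is a finite sum
  of products of weights, and the product rule puts the derivative on one coordinate at a time.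
  Since the state at \<open>v\<close> is overwritten, the remaining expectation can be kept over all
  of \<open>I\<close>.\<close>

lemma ex_has_derivative:
  assumes S: "finite S" "finite I" "\<And>t. sum (w t) S = 1"
    and w: "\<And>a. a \<in> S \<Longrightarrow> ((\<lambda>t. w t a) has_real_derivative w' a) (at t)"
  shows "((\<lambda>t. ex S I (w t) \<phi>) has_real_derivative
     (\<Sum>v\<in>I. \<Sum>a\<in>S. w' a * ex S I (w t) (\<lambda>f. \<phi> (f(v := a))))) (at t)"
  using S(2)
proof (induction I arbitrary: \<phi> rule: finite_induct)
  case empty
  then show ?case by simp
next
  case (insert v I)
  let ?F = "\<lambda>\<phi> u. (\<Sum>b\<in>S. w' b * ex S I (w t) (\<lambda>f. \<phi> (f(u := b))))"
  have "((\<lambda>t. \<Sum>a\<in>S. w t a * ex S I (w t) (\<lambda>f. \<phi> (f(v := a)))) has_real_derivative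
     (\<Sum>a\<in>S. w t a * (\<Sum>u\<in>I. ?F (\<lambda>f. \<phi> (f(v := a))) u)
         + w' a * ex S I (w t) (\<lambda>f. \<phi> (f(v := a))))) (at t)"
    by (rule DERIV_sum, rule DERIV_mult', rule w, assumption, rule insert.IH)
  moreover have "ex S (insert v I) (w t) (\<lambda>f. \<phi> (f(v := a))) = ex S I (w t) (\<lambda>f. \<phi> (f(v := a)))" for a
    using insert.hyps S by (simp add: ex_insert sum_distrib_right[symmetric])
  moreover have "(\<Sum>b\<in>S. w' b * ex S (insert v I) (w t) (\<lambda>f. \<phi> (f(u := b))))
     = (\<Sum>a\<in>S. w t a * ?F (\<lambda>f. \<phi> (f(v := a))) u)" if "u \<in> I" for u
  proof -
    have "(\<Sum>b\<in>S. w' b * ex S (insert v I) (w t) (\<lambda>f. \<phi> (f(u := b))))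
      = (\<Sum>b\<in>S. \<Sum>a\<in>S. w' b * (w t a * ex S I (w t) (\<lambda>f. \<phi> (f(v := a, u := b)))))"
      using insert.hyps S by (simp add: ex_insert sum_distrib_left)
    also have "\<dots> = (\<Sum>a\<in>S. \<Sum>b\<in>S. w' b * (w t a * ex S I (w t) (\<lambda>f. \<phi> (f(v := a, u := b)))))"
      by (rule sum.swap)
    also have "\<dots> = (\<Sum>a\<in>S. w t a * ?F (\<lambda>f. \<phi> (f(v := a))) u)"
    proof -
      have "u \<noteq> v" using that insert.hyps by auto
      then have tw: "f(v := a, u := b) = f(u := b, v := a)" for f :: "'b \<Rightarrow> 'a" and a b
        by (rule fun_upd_twist[OF not_sym])
      show ?thesis
        unfolding tw sum_distrib_left by (simp only: mult.left_commute)
    qed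
    finally show ?thesis .
  qed
  moreover have "(\<Sum>a\<in>S. w t a * (\<Sum>u\<in>I. ?F (\<lambda>f. \<phi> (f(v := a))) u))
     = (\<Sum>u\<in>I. \<Sum>a\<in>S. w t a * ?F (\<lambda>f. \<phi> (f(v := a))) u)"
    unfolding sum_distrib_left by (rule sum.swap)
  ultimately have *: "((\<lambda>t. \<Sum>a\<in>S. w t a * ex S I (w t) (\<lambda>f. \<phi> (f(v := a)))) has_real_derivative
     (\<Sum>u\<in>insert v I. \<Sum>b\<in>S. w' b * ex S (insert v I) (w t) (\<lambda>f. \<phi> (f(u := b))))) (at t)"
    using insert.hyps by (simp only: sum.distrib sum.insert) (simp add: add.commute)
  show ?case
    by (subst ex_insert[OF S(1) insert.hyps]) (rule *)
qed

lemma ex_reindex: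
  assumes "bij_betw h I J"
  shows "ex S J w \<phi> = ex S I w (\<lambda>f. \<phi> (\<lambda>j. if j \<in> J then f (the_inv_into I h j) else undefined))"
proof -
  let ?k = "\<lambda>f j. if j \<in> J then f (the_inv_into I h j) else undefined"
  have inj: "inj_on h I" and im: "h ` I = J"
    using assms by (auto simp: bij_betw_def)
  let ?l = "\<lambda>g i. if i \<in> I then g (h i) else undefined"
  have inv: "the_inv_into I h (h i) = i" "h i \<in> J" if "i \<in> I" for i
    using that im by (auto simp: the_inv_into_f_f[OF inj])
  have inv': "h (the_inv_into I h j) = j" "the_inv_into I h j \<in> I" if "j \<in> J" for j
    using that f_the_inv_into_f[OF inj] the_inv_into_into[OF inj] im by auto
  have k: "bij_betw ?k (PiE I (\<lambda>_. S)) (PiE J (\<lambda>_. S))"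
  proof (rule bij_betw_byWitness[where f' = ?l])
    show "\<forall>a\<in>PiE I (\<lambda>_. S). ?l (?k a) = a"
    proof (intro ballI ext)
      fix a i assume "a \<in> PiE I (\<lambda>_. S)"
      then show "?l (?k a) i = a i"
        using inv PiE_arb[of a I "\<lambda>_. S" i] by (cases "i \<in> I") simp_all
    qed
    show "\<forall>a\<in>PiE J (\<lambda>_. S). ?k (?l a) = a"
    proof (intro ballI ext)
      fix a j assume "a \<in> PiE J (\<lambda>_. S)"
      then show "?k (?l a) j = a j"
        using inv' PiE_arb[of a J "\<lambda>_. S" j] by (cases "j \<in> J") simp_all
    qed
    show "?k ` PiE I (\<lambda>_. S) \<subseteq> PiE J (\<lambda>_. S)"
      by (rule image_subsetI, rule PiE_I) (use inv' PiE_mem[of _ I "\<lambda>_. S"] in simp_all)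
    show "?l ` PiE J (\<lambda>_. S) \<subseteq> PiE I (\<lambda>_. S)"
      by (rule image_subsetI, rule PiE_I) (use inv PiE_mem[of _ J "\<lambda>_. S"] in simp_all)
  qed
  have p: "(\<Prod>j\<in>J. w (?k f j)) = (\<Prod>i\<in>I. w (f i))" for f
  proof -
    have "(\<Prod>j\<in>J. w (?k f j)) = (\<Prod>i\<in>I. w (?k f (h i)))"
      by (rule prod.reindex_bij_betw[OF assms, symmetric])
    also have "\<dots> = (\<Prod>i\<in>I. w (f i))"
      by (rule prod.cong) (simp_all add: inv)
    finally show ?thesis .
  qed
  have "ex S J w \<phi> = (\<Sum>f\<in>PiE I (\<lambda>_. S). (\<Prod>j\<in>J. w (?k f j)) * \<phi> (?k f))"
    unfolding ex_def by (rule sum.reindex_bij_betw[OF k, symmetric])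
  then show ?thesis
    unfolding p by (simp only: ex_def)
qed

section \<open>Diminished arrows\<close>

lemma UNIV_arrows: "(UNIV :: arrows set) = {Left_Arrow, Right_Arrow, Both_Arrows, No_Arrow}"
  using arrows.exhaust by blast

instance arrows :: finite
  by standard (simp add: UNIV_arrows)

lemma UNIV_mark: "(UNIV :: bool option set) = {None, Some True, Some False}"
  by (auto simp: UNIV_option_conv UNIV_bool)

definition arrow_weight :: "real \<Rightarrow> real \<Rightarrow> arrows \<Rightarrow> real" where
  "arrow_weight \<delta> \<epsilon> a = (case a of Left_Arrow \<Rightarrow> (1 - \<delta>) / 2 | Right_Arrow \<Rightarrow> (1 - \<delta>) / 2
     | Both_Arrows \<Rightarrow> \<delta> * (1 - \<epsilon>) | No_Arrow \<Rightarrow> \<delta> * \<epsilon>)"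

text \<open>For \<open>s = 1 / q\<close> this is the law of a fair choice of a child followed by a
  comparison of colors: \<open>None\<close> if the colors differ, \<open>Some b\<close> if child
  \<open>b\<close> was chosen and agrees.\<close>

definition mark_weight :: "real \<Rightarrow> bool option \<Rightarrow> real" where
  "mark_weight s k = (case k of None \<Rightarrow> 1 - s | Some _ \<Rightarrow> s / 2)"

definition marked_weight :: "real \<Rightarrow> real \<Rightarrow> real \<Rightarrow> arrows \<times> bool option \<Rightarrow> real" where
  "marked_weight \<delta> \<epsilon> s = (\<lambda>(a, k). arrow_weight \<delta> \<epsilon> a * mark_weight s k)"

lemma sum_arrow_weight: "sum (arrow_weight \<delta> \<epsilon>) UNIV = 1"
  by (simp add: UNIV_arrows arrow_weight_def algebra_simps)

lemma sum_mark_weight: "sum (mark_weight s) UNIV = 1"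
  by (simp add: UNIV_mark mark_weight_def algebra_simps)

lemma sum_marked_weight: "sum (marked_weight \<delta> \<epsilon> s) UNIV = 1"
proof -
  have "sum (marked_weight \<delta> \<epsilon> s) (UNIV \<times> UNIV)
      = sum (arrow_weight \<delta> \<epsilon>) UNIV * sum (mark_weight s) UNIV"
    unfolding marked_weight_def sum_product sum.cartesian_product by simp
  then show ?thesis
    by (simp add: sum_arrow_weight sum_mark_weight)
qed

lemma arrow_weight_nonneg: "0 \<le> \<delta> \<Longrightarrow> \<delta> \<le> 1 \<Longrightarrow> 0 \<le> \<epsilon> \<Longrightarrow> \<epsilon> \<le> 1 \<Longrightarrow> 0 \<le> arrow_weight \<delta> \<epsilon> a"
  by (cases a) (simp_all add: arrow_weight_def)

lemma mark_weight_nonneg: "0 \<le> s \<Longrightarrow> s \<le> 1 \<Longrightarrow> 0 \<le> mark_weight s k"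
  by (cases k) (simp_all add: mark_weight_def)

lemma marked_weight_nonneg:
  "0 \<le> \<delta> \<Longrightarrow> \<delta> \<le> 1 \<Longrightarrow> 0 \<le> \<epsilon> \<Longrightarrow> \<epsilon> \<le> 1 \<Longrightarrow> 0 \<le> s \<Longrightarrow> s \<le> 1 \<Longrightarrow> 0 \<le> marked_weight \<delta> \<epsilon> s a"
  by (simp add: marked_weight_def case_prod_unfold arrow_weight_nonneg mark_weight_nonneg)

type_synonym marked = "vertex \<Rightarrow> arrows \<times> bool option"

definition child :: "bool \<Rightarrow> vertex \<Rightarrow> vertex" where
  "child b v = (if b then left_up v else right_up v)"

text \<open>Inverse of \<open>child b\<close>: the only vertex from which a mark
  \<open>Some b\<close> looks at \<open>v\<close>.\<close>

definition below :: "bool \<Rightarrow> vertex \<Rightarrow> vertex" where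
  "below b v = (if b then (fst v + 1, snd v - 1) else (fst v - 1, snd v - 1))"

text \<open>The mark \<open>Some b\<close> of a vertex \<open>v\<close> says that \<open>Y\<close> takes the same value at \<open>v\<close> and at its child \<open>b\<close>.\<close>

definition diminish :: "marked \<Rightarrow> vertex \<Rightarrow> arrows" where
  "diminish f v = (if fst (f v) = Both_Arrows \<and> (\<exists>b. snd (f v) = Some b \<and> fst (f (child b v)) = No_Arrow)
     then No_Arrow else fst (f v))"

definition set_arrow :: "vertex \<Rightarrow> arrows \<Rightarrow> marked \<Rightarrow> marked" where
  "set_arrow v a f = f(v := (a, snd (f v)))"

definition set_mark :: "vertex \<Rightarrow> bool option \<Rightarrow> marked \<Rightarrow> marked" where
  "set_mark v k f = f(v := (fst (f v), k))"

lemma fst_set_arrow: "fst (set_arrow v a f u) = (if u = v then a else fst (f u))"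
  and snd_set_arrow: "snd (set_arrow v a f u) = snd (f u)"
  and fst_set_mark: "fst (set_mark v k f u) = fst (f u)"
  and snd_set_mark: "snd (set_mark v k f u) = (if u = v then k else snd (f u))"
  by (simp_all add: set_arrow_def set_mark_def)

lemmas set_simps = fst_set_arrow snd_set_arrow fst_set_mark snd_set_mark

lemma set_arrow_twice: "set_arrow v a (set_arrow v b f) = set_arrow v a f"
  by (simp add: set_arrow_def)

lemma child_eq_iff: "child b w = v \<longleftrightarrow> w = below b v"
  by (cases v; cases w) (auto simp: child_def below_def left_up_def right_up_def)

lemma child_inj: "child b v = child c v \<longleftrightarrow> b = c"
  by (cases v) (auto simp: child_def left_up_def right_up_def)

lemma snd_child [simp]: "snd (child b v) = snd v + 1"
  by (simp add: child_def left_up_def right_up_def)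

lemma arrow_child: "arrow X v w \<Longrightarrow> \<exists>b. w = child b v"
  by (auto simp: arrow_def child_def)

lemma not_arrow_No: "X v = No_Arrow \<Longrightarrow> \<not> arrow X v w"
  by (simp add: arrow_def)

lemma arrow_cong: "X v = X' v \<Longrightarrow> arrow X v w = arrow X' v w"
  by (simp add: arrow_def)

text \<open>The recursion \<open>path_of_length\<close> hides the vertices it passes. Pivotality
  arguments need the path itself, which meets every level exactly once.\<close>

definition is_path :: "(vertex \<Rightarrow> arrows) \<Rightarrow> nat \<Rightarrow> vertex \<Rightarrow> (nat \<Rightarrow> vertex) \<Rightarrow> bool" where
  "is_path X n v p \<longleftrightarrow> p 0 = v \<and> (\<forall>i<n. arrow X (p i) (p (Suc i)))"

lemma path_of_length_iff: "path_of_length X n v \<longleftrightarrow> (\<exists>p. is_path X n v p)"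
proof (induction n arbitrary: v)
  case 0
  show ?case by (auto simp: is_path_def)
next
  case (Suc n)
  have "(\<exists>w. arrow X v w \<and> (\<exists>p. is_path X n w p)) \<longleftrightarrow> (\<exists>p. is_path X (Suc n) v p)"
  proof (intro iffI; elim exE conjE)
    fix w p assume "arrow X v w" "is_path X n w p"
    then have "is_path X (Suc n) v (case_nat v p)"
      by (auto simp: is_path_def less_Suc_eq_0_disj)
    then show "\<exists>p. is_path X (Suc n) v p" by blast
  next
    fix p assume "is_path X (Suc n) v p"
    then have "arrow X v (p 1)" "is_path X n (p 1) (\<lambda>i. p (Suc i))"
      by (auto simp: is_path_def)
    then show "\<exists>w. arrow X v w \<and> (\<exists>p. is_path X n w p)" by blast
  qed
  then show ?case
    using Suc.IH by (simp del: split_paired_Ex)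
qed

lemma is_path_level:
  assumes "is_path X n v p" "i \<le> n"
  shows "snd (p i) = snd v + int i"
  using assms(2)
proof (induction i)
  case 0
  then show ?case using assms by (simp add: is_path_def)
next
  case (Suc i)
  then have "arrow X (p i) (p (Suc i))"
    using assms by (simp add: is_path_def)
  then show ?case
    using Suc arrow_child[of X "p i" "p (Suc i)"] by fastforce
qed

text \<open>Level \<open>n\<close> is included although a path of length \<open>n\<close> uses no
  arrow there: \<open>diminish\<close> at level \<open>n - 1\<close> inspects the children.\<close>

definition light_cone :: "nat \<Rightarrow> vertex set" where
  "light_cone n = {(x, t). 0 \<le> t \<and> t \<le> int n \<and> \<bar>x\<bar> \<le> t \<and> even (x + t)}"

lemma finite_light_cone [simp]: "finite (light_cone n)"
proof -
  have "light_cone n \<subseteq> {- int n..int n} \<times> {0..int n}"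
    by (auto simp: light_cone_def)
  then show ?thesis by (rule finite_subset) simp
qed

lemma light_cone_subset_vertices: "light_cone n \<subseteq> vertices"
  by (auto simp: light_cone_def vertices_def)

lemma child_in_light_cone: "v \<in> light_cone n \<Longrightarrow> snd v < int n \<Longrightarrow> child b v \<in> light_cone n"
  by (auto simp: light_cone_def child_def left_up_def right_up_def)

lemma is_path_light_cone:
  assumes "is_path X n (0, 0) p" "i \<le> n"
  shows "p i \<in> light_cone n"
  using assms(2)
proof (induction i)
  case 0
  then show ?case using assms by (simp add: is_path_def light_cone_def)
next
  case (Suc i)
  then have "arrow X (p i) (p (Suc i))"
    using assms by (simp add: is_path_def)
  then obtain b where "p (Suc i) = child b (p i)"
    using arrow_child by blast
  then show ?case
    using Suc is_path_level[OF assms(1), of i] child_in_light_cone[of "p i" n b] by simp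
qed

section \<open>Monotonicity and pivotality\<close>

definition reaches :: "nat \<Rightarrow> marked \<Rightarrow> bool" where
  "reaches n f \<longleftrightarrow> path_of_length (diminish f) n (0, 0)"

definition mark_pivotal :: "nat \<Rightarrow> vertex \<Rightarrow> bool \<Rightarrow> marked \<Rightarrow> bool" where
  "mark_pivotal n w b f \<longleftrightarrow> reaches n (set_mark w None f) \<and> \<not> reaches n (set_mark w (Some b) f)"

lemma path_of_length_mono:
  assumes "path_of_length X n v" "\<And>u w. arrow X u w \<Longrightarrow> arrow X' u w"
  shows "path_of_length X' n v"
  using assms unfolding path_of_length_iff is_path_def by blast

text \<open>Turning a source into a branching vertex can only add arrows: \<open>v\<close> itself
  may emit, and marks pointing at \<open>v\<close> become inactive.\<close>

lemma reaches_set_arrow_mono: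
  assumes "reaches n (set_arrow v No_Arrow f)"
  shows "reaches n (set_arrow v Both_Arrows f)"
  unfolding reaches_def
proof (rule path_of_length_mono[OF assms[unfolded reaches_def]])
  fix u w assume a: "arrow (diminish (set_arrow v No_Arrow f)) u w"
  then have "u \<noteq> v"
    by (auto simp: arrow_def diminish_def set_simps)
  then show "arrow (diminish (set_arrow v Both_Arrows f)) u w"
    using a by (auto simp: arrow_def diminish_def set_simps split: if_splits)
qed

lemma reaches_set_mark_mono:
  assumes "reaches n (set_mark v (Some b) f)"
  shows "reaches n (set_mark v None f)"
  unfolding reaches_def
proof (rule path_of_length_mono[OF assms[unfolded reaches_def]])
  fix u w assume "arrow (diminish (set_mark v (Some b) f)) u w"
  then show "arrow (diminish (set_mark v None f)) u w"
    by (auto simp: arrow_def diminish_def set_simps split: if_splits)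
qed

text \<open>If a path avoids \<open>v\<close>, then closing \<open>v\<close> can only stop it by activating a mark just below \<open>v\<close>.
  Otherwise the paths all run through \<open>v\<close>, and closing a child of \<open>v\<close> not used by one of
  them makes the mark of \<open>v\<close> pivotal.\<close>

lemma mark_pivotal_near_arrow_pivotal:
  assumes both: "fst (f v) = Both_Arrows" and E: "reaches n f"
    and nE: "\<not> reaches n (set_arrow v No_Arrow f)"
  shows "(\<exists>b. below b v \<in> light_cone n \<and> mark_pivotal n (below b v) b (set_arrow v No_Arrow f)) \<or>
         (\<exists>b. child b v \<in> light_cone n \<and> mark_pivotal n v b (set_arrow (child b v) No_Arrow f))"
\<comment> \<open>The endpoint \<open>p n\<close> is allowed to be \<open>v\<close>, because no
  arrow out of it is used.\<close>
proof (cases "\<exists>p. is_path (diminish f) n (0, 0) p \<and> (\<forall>i<n. p i \<noteq> v)")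
  case True
  then obtain p where p: "is_path (diminish f) n (0, 0) p" and pv: "\<And>i. i < n \<Longrightarrow> p i \<noteq> v"
    by blast
  let ?f = "set_arrow v No_Arrow f"
  have "\<not> is_path (diminish ?f) n (0, 0) p"
    using nE unfolding reaches_def path_of_length_iff by blast
  then obtain i where i: "i < n" "\<not> arrow (diminish ?f) (p i) (p (Suc i))" "arrow (diminish f) (p i) (p (Suc i))"
    using p by (auto simp: is_path_def)
  define y where "y = p i"
  have ne: "diminish ?f y \<noteq> diminish f y" and yv: "y \<noteq> v"
    using i arrow_cong pv unfolding y_def by blast+
  \<comment> \<open>Closing \<open>v\<close> alters the diminished arrows of another vertex only by
    providing a source for a mark that points at \<open>v\<close>.\<close>
  then obtain b where b: "snd (f y) = Some b" "fst (f y) = Both_Arrows" "child b y = v" "diminish f y = Both_Arrows"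
    by (auto simp: diminish_def set_simps split: if_splits)
  then have y: "y = below b v"
    by (simp add: child_eq_iff)
  have "set_mark y (Some b) ?f = ?f"
    using b yv by (auto simp: set_mark_def set_arrow_def fun_eq_iff prod_eq_iff)
  then have "\<not> reaches n (set_mark y (Some b) ?f)"
    using nE by simp
  moreover have "is_path (diminish (set_mark y None ?f)) n (0, 0) p"
    unfolding is_path_def
  proof (intro conjI allI impI)
    show "p 0 = (0, 0)" using p by (simp add: is_path_def)
    fix j assume j: "j < n"
    have a: "arrow (diminish f) (p j) (p (Suc j))"
      using p j by (simp add: is_path_def)
    have "diminish (set_mark y None ?f) (p j) = diminish f (p j)"
    proof (cases "p j = y")
      case True
      then show ?thesis using b yv by (simp add: diminish_def[of "set_mark y None ?f"] set_simps)
    next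
      case False
      \<comment> \<open>The path has one vertex per level, so \<open>y\<close> is its only vertex
        just below \<open>v\<close>.\<close>
      have "child b' (p j) \<noteq> v" for b'
      proof
        assume "child b' (p j) = v"
        then have "snd (p j) = snd (p i)"
          using b(3) unfolding y_def by (metis snd_child add_right_cancel)
        then have "i = j"
          using is_path_level[OF p, of i] is_path_level[OF p, of j] i j by simp
        then show False using False by (simp add: y_def)
      qed
      then show ?thesis using False pv[OF j] by (simp add: diminish_def set_simps)
    qed
    then show "arrow (diminish (set_mark y None ?f)) (p j) (p (Suc j))"
      using a arrow_cong by blast
  qed
  then have "reaches n (set_mark y None ?f)"
    unfolding reaches_def path_of_length_iff by blast
  moreover have "y \<in> light_cone n"
    using is_path_light_cone[OF p, of i] i by (simp add: y_def)
  ultimately show ?thesis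
    unfolding mark_pivotal_def y by blast
next
  case False
  obtain p where p: "is_path (diminish f) n (0, 0) p"
    using E unfolding reaches_def path_of_length_iff by blast
  then obtain i where i: "i < n" "p i = v"
    using False by blast
  have ai: "arrow (diminish f) v (p (Suc i))"
    using p i by (auto simp: is_path_def)
  then obtain c where c: "p (Suc i) = child c v"
    using arrow_child by blast
  \<comment> \<open>The sibling of the vertex that follows \<open>v\<close> on \<open>p\<close>. It
    shares the level of \<open>p (Suc i)\<close>, so it is off the path; with the mark at
    \<open>v\<close> removed, closing it leaves the arrows along \<open>p\<close> intact.\<close>
  define z where "z = child (\<not> c) v"
  let ?g = "set_arrow z No_Arrow f"
  have vz: "v \<noteq> z"
    unfolding z_def by (metis snd_child add_cancel_right_right one_neq_zero)
  have "is_path (diminish (set_mark v None ?g)) n (0, 0) p"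
    unfolding is_path_def
  proof (intro conjI allI impI)
    show "p 0 = (0, 0)" using p by (simp add: is_path_def)
    fix j assume j: "j < n"
    have a: "arrow (diminish f) (p j) (p (Suc j))"
      using p j by (simp add: is_path_def)
    have lev: "snd (p j) = snd (p i) \<Longrightarrow> i = j"
      using is_path_level[OF p, of i] is_path_level[OF p, of j] i j by simp
    have "diminish (set_mark v None ?g) (p j) = diminish f (p j)"
    proof (cases "j = i")
      case True
      have "diminish f v \<noteq> No_Arrow"
        using ai not_arrow_No by blast
      then have "diminish f v = Both_Arrows"
        using both by (auto simp: diminish_def split: if_splits)
      then show ?thesis
        using True i both vz by (simp add: diminish_def[of "set_mark v None ?g"] set_simps)
    next
      case False
      then have "p j \<noteq> v"
        using lev i by auto
      moreover have "p j \<noteq> z"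
      proof
        assume pz: "p j = z"
        then have "snd (p j) = snd (p (Suc i))"
          by (simp add: z_def c)
        then have "j = Suc i"
          using is_path_level[OF p, of "Suc i"] is_path_level[OF p, of j] i j by simp
        then show False
          using pz c child_inj unfolding z_def by metis
      qed
      moreover have "child b (p j) \<noteq> z" for b
      proof
        assume "child b (p j) = z"
        then have "snd (p j) = snd (p i)"
          unfolding z_def i(2) by (metis snd_child add_right_cancel)
        then show False using lev False by simp
      qed
      ultimately show ?thesis by (simp add: diminish_def set_simps)
    qed
    then show "arrow (diminish (set_mark v None ?g)) (p j) (p (Suc j))"
      using a arrow_cong by blast
  qed
  then have "reaches n (set_mark v None ?g)"
    unfolding reaches_def path_of_length_iff by blast
  \<comment> \<open>With the mark of \<open>v\<close> pointing at the closed \<open>z\<close>, both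
    \<open>v\<close> and \<open>z\<close> are sources. A surviving path avoids both, hence survives
    in \<open>f\<close> as well, although every path in \<open>f\<close> visits
    \<open>v\<close>.\<close>
  moreover have "\<not> reaches n (set_mark v (Some (\<not> c)) ?g)"
  proof
    let ?h = "set_mark v (Some (\<not> c)) ?g"
    assume "reaches n ?h"
    then obtain r where r: "is_path (diminish ?h) n (0, 0) r"
      unfolding reaches_def path_of_length_iff by blast
    have "diminish ?h v = No_Arrow"
      using both vz by (simp add: diminish_def set_simps z_def)
    moreover have "diminish ?h z = No_Arrow"
      using vz by (simp add: diminish_def set_simps)
    ultimately have rv: "r j \<noteq> v" "r j \<noteq> z" "diminish ?h (r j) \<noteq> No_Arrow" if "j < n" for j
      using r that not_arrow_No unfolding is_path_def by blast+
    have "diminish f (r j) = diminish ?h (r j)" if "j < n" for j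
      using rv[OF that] by (auto simp: diminish_def set_simps split: if_splits)
    then have "is_path (diminish f) n (0, 0) r"
      using r arrow_cong unfolding is_path_def by metis
    then show False
      using False rv by blast
  qed
  moreover have "z \<in> light_cone n"
    using is_path_light_cone[OF p, of i] i is_path_level[OF p, of i] unfolding z_def
    by (intro child_in_light_cone) auto
  ultimately show ?thesis
    unfolding mark_pivotal_def z_def by blast
qed

section \<open>Lowering the threshold\<close>

lemma ex_zero [simp]: "ex S I w (\<lambda>_. 0) = 0"
  by (simp add: ex_def)

section \<open>Russo's formula in the death rate and the mark density\<close>

abbreviation mex :: "nat \<Rightarrow> real \<Rightarrow> real \<Rightarrow> real \<Rightarrow> (marked \<Rightarrow> real) \<Rightarrow> real" where
  "mex n \<delta> \<epsilon> s \<equiv> ex UNIV (light_cone n) (marked_weight \<delta> \<epsilon> s)"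

lemma sum_marked_weight_split:
  "(\<Sum>a\<in>UNIV. (case a of (x, k) \<Rightarrow> g x * h k) * F a) = (\<Sum>x\<in>UNIV. g x * (\<Sum>k\<in>UNIV. h k * F (x, k)))"
  for F :: "arrows \<times> bool option \<Rightarrow> real"
proof -
  have "(\<Sum>a\<in>UNIV. (case a of (x, k) \<Rightarrow> g x * h k) * F a)
      = (\<Sum>(x, k)\<in>UNIV \<times> UNIV. g x * (h k * F (x, k)))"
    by (simp add: case_prod_unfold mult.assoc)
  then show ?thesis
    unfolding sum.cartesian_product[symmetric] sum_distrib_left .
qed

lemma sum_marked_weight_mult:
  "(\<Sum>y\<in>UNIV. marked_weight \<delta> \<epsilon> s y * F y)
    = (\<Sum>x\<in>UNIV. arrow_weight \<delta> \<epsilon> x * (\<Sum>k\<in>UNIV. mark_weight s k * F (x, k)))"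
  unfolding marked_weight_def by (rule sum_marked_weight_split)

text \<open>Redrawing the whole state at \<open>v\<close> and averaging over its mark has the same
  effect as overwriting the arrow and keeping the mark.\<close>

lemma mex_arrow_average:
  assumes "v \<in> light_cone n"
  shows "(\<Sum>k\<in>UNIV. mark_weight s k * mex n \<delta> \<epsilon> s (\<lambda>f. \<phi> (f(v := (x, k)))))
    = mex n \<delta> \<epsilon> s (\<lambda>f. \<phi> (set_arrow v x f))"
proof -
  have "mex n \<delta> \<epsilon> s (\<lambda>f. \<phi> (set_arrow v x f)) = (\<Sum>y\<in>UNIV. arrow_weight \<delta> \<epsilon> y *
      (\<Sum>k\<in>UNIV. mark_weight s k * mex n \<delta> \<epsilon> s (\<lambda>f. \<phi> (f(v := (x, k))))))"
    by (subst ex_resample[OF finite finite_light_cone sum_marked_weight assms])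
      (simp add: sum_marked_weight_mult set_arrow_def)
  then show ?thesis
    by (simp add: sum_distrib_right[symmetric] sum_arrow_weight)
qed

lemma mex_mark_average:
  assumes "v \<in> light_cone n"
  shows "(\<Sum>x\<in>UNIV. arrow_weight \<delta> \<epsilon> x * mex n \<delta> \<epsilon> s (\<lambda>f. \<phi> (f(v := (x, k)))))
    = mex n \<delta> \<epsilon> s (\<lambda>f. \<phi> (set_mark v k f))"
proof -
  have "mex n \<delta> \<epsilon> s (\<lambda>f. \<phi> (set_mark v k f)) = (\<Sum>x\<in>UNIV. arrow_weight \<delta> \<epsilon> x *
      (\<Sum>j\<in>UNIV. mark_weight s j * mex n \<delta> \<epsilon> s (\<lambda>f. \<phi> (f(v := (x, k))))))"
    by (subst ex_resample[OF finite finite_light_cone sum_marked_weight assms])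
      (simp add: sum_marked_weight_mult set_mark_def)
  then show ?thesis
    by (simp add: sum_distrib_right[symmetric] sum_mark_weight)
qed

lemma mex_resample_arrow:
  assumes "v \<in> light_cone n"
  shows "mex n \<delta> \<epsilon> s \<phi> = (\<Sum>x\<in>UNIV. arrow_weight \<delta> \<epsilon> x * mex n \<delta> \<epsilon> s (\<lambda>f. \<phi> (set_arrow v x f)))"
  by (subst ex_resample[OF finite finite_light_cone sum_marked_weight assms])
    (simp only: sum_marked_weight_mult mex_arrow_average[OF assms])

definition reach_prob :: "nat \<Rightarrow> real \<Rightarrow> real \<Rightarrow> real \<Rightarrow> real" where
  "reach_prob n \<delta> \<epsilon> s = mex n \<delta> \<epsilon> s (\<lambda>f. of_bool (reaches n f))"

text \<open>Only these two states are compared because raising \<epsilon> moves mass from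
  \<open>Both_Arrows\<close> to \<open>No_Arrow\<close> and leaves the single arrows alone.\<close>

definition arrow_influence :: "nat \<Rightarrow> real \<Rightarrow> real \<Rightarrow> real \<Rightarrow> vertex \<Rightarrow> real" where
  "arrow_influence n \<delta> \<epsilon> s v = mex n \<delta> \<epsilon> s (\<lambda>f. of_bool (reaches n (set_arrow v Both_Arrows f)))
     - mex n \<delta> \<epsilon> s (\<lambda>f. of_bool (reaches n (set_arrow v No_Arrow f)))"

definition mark_influence :: "nat \<Rightarrow> real \<Rightarrow> real \<Rightarrow> real \<Rightarrow> vertex \<Rightarrow> bool \<Rightarrow> real" where
  "mark_influence n \<delta> \<epsilon> s v b = mex n \<delta> \<epsilon> s (\<lambda>f. of_bool (mark_pivotal n v b f))"

text \<open>By monotonicity the probability of being pivotal is a difference of two probabilities,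
  which is the form in which it occurs in the derivative.\<close>

lemma mark_influence_alt:
  "mark_influence n \<delta> \<epsilon> s v b = mex n \<delta> \<epsilon> s (\<lambda>f. of_bool (reaches n (set_mark v None f)))
     - mex n \<delta> \<epsilon> s (\<lambda>f. of_bool (reaches n (set_mark v (Some b) f)))"
  unfolding mark_influence_def ex_diff[symmetric]
  by (rule ex_cong) (use reaches_set_mark_mono in \<open>auto simp: mark_pivotal_def of_bool_def\<close>)

text \<open>A line in the plane of \<epsilon> and \<open>s\<close> is followed with speed
  \<open>(\<alpha>, \<beta>)\<close>. The death rate transfers mass \<delta> per unit between two
  arrow states, the mark density splits its mass evenly over the two marks, whence the factor 1/2.
  The speed \<open>(1, 0)\<close> yields monotonicity in the death rate,
  \<open>(- \<kappa>, 1)\<close> the exchange of deaths for marks.\<close>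

lemma reach_prob_derivative:
  "((\<lambda>t. reach_prob n \<delta> (\<epsilon> + \<alpha> * t) (s + \<beta> * t)) has_real_derivative
     (\<Sum>v\<in>light_cone n. - \<alpha> * \<delta> * arrow_influence n \<delta> (\<epsilon> + \<alpha> * t) (s + \<beta> * t) v
        - \<beta> / 2 * (\<Sum>b\<in>UNIV. mark_influence n \<delta> (\<epsilon> + \<alpha> * t) (s + \<beta> * t) v b))) (at t)"
proof -
  let ?e = "\<epsilon> + \<alpha> * t" and ?s = "s + \<beta> * t"
  define a' where "a' = (\<lambda>x. case x of Left_Arrow \<Rightarrow> 0 | Right_Arrow \<Rightarrow> 0
      | Both_Arrows \<Rightarrow> - \<alpha> * \<delta> | No_Arrow \<Rightarrow> \<alpha> * \<delta>)"
  define k' where "k' = (\<lambda>k :: bool option. case k of None \<Rightarrow> - \<beta> | Some _ \<Rightarrow> \<beta> / 2)"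
  define w' where "w' = (\<lambda>(x, k). a' x * mark_weight ?s k + arrow_weight \<delta> ?e x * k' k)"
  have a: "((\<lambda>t. arrow_weight \<delta> (\<epsilon> + \<alpha> * t) x) has_real_derivative a' x) (at t)" for x
    by (cases x) (auto simp: arrow_weight_def a'_def intro!: derivative_eq_intros)
  have k: "((\<lambda>t. mark_weight (s + \<beta> * t) k) has_real_derivative k' k) (at t)" for k
    by (cases k) (auto simp: mark_weight_def k'_def intro!: derivative_eq_intros)
  have w: "((\<lambda>t. marked_weight \<delta> (\<epsilon> + \<alpha> * t) (s + \<beta> * t) y) has_real_derivative w' y) (at t)" for y
    unfolding marked_weight_def w'_def case_prod_unfold
    by (rule DERIV_cong[OF DERIV_mult[OF a k]]) simp
  have v: "(\<Sum>y\<in>UNIV. w' y * mex n \<delta> ?e ?s (\<lambda>f. of_bool (reaches n (f(v := y)))))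
      = - \<alpha> * \<delta> * arrow_influence n \<delta> ?e ?s v - \<beta> / 2 * (\<Sum>b\<in>UNIV. mark_influence n \<delta> ?e ?s v b)"
    if "v \<in> light_cone n" for v
  proof -
    let ?F = "\<lambda>y. mex n \<delta> ?e ?s (\<lambda>f. of_bool (reaches n (f(v := y))))"
    have "(\<Sum>y\<in>UNIV. w' y * ?F y) = (\<Sum>y\<in>UNIV. (case y of (x, k) \<Rightarrow> a' x * mark_weight ?s k) * ?F y)
        + (\<Sum>y\<in>UNIV. (case y of (x, k) \<Rightarrow> arrow_weight \<delta> ?e x * k' k) * ?F y)"
      by (simp add: w'_def case_prod_unfold algebra_simps sum.distrib)
    also have "(\<Sum>y\<in>UNIV. (case y of (x, k) \<Rightarrow> a' x * mark_weight ?s k) * ?F y)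
        = (\<Sum>x\<in>UNIV. a' x * mex n \<delta> ?e ?s (\<lambda>f. of_bool (reaches n (set_arrow v x f))))"
      by (simp only: sum_marked_weight_split mex_arrow_average[OF that, of ?s \<delta> ?e "\<lambda>f. of_bool (reaches n f)"])
    also have "\<dots> = - \<alpha> * \<delta> * arrow_influence n \<delta> ?e ?s v"
      by (simp add: UNIV_arrows a'_def arrow_influence_def algebra_simps)
    also have "(\<Sum>y\<in>UNIV. (case y of (x, k) \<Rightarrow> arrow_weight \<delta> ?e x * k' k) * ?F y)
        = (\<Sum>k\<in>UNIV. k' k * (\<Sum>x\<in>UNIV. arrow_weight \<delta> ?e x * ?F (x, k)))"
      unfolding sum_marked_weight_split sum_distrib_left by (subst sum.swap) (simp add: mult.left_commute)
    also have "\<dots> = (\<Sum>k\<in>UNIV. k' k * mex n \<delta> ?e ?s (\<lambda>f. of_bool (reaches n (set_mark v k f))))"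
      by (simp only: mex_mark_average[OF that, of \<delta> ?e ?s "\<lambda>f. of_bool (reaches n f)"])
    also have "\<dots> = - \<beta> / 2 * (\<Sum>b\<in>UNIV. mark_influence n \<delta> ?e ?s v b)"
      by (simp add: UNIV_mark k'_def mark_influence_alt UNIV_bool field_simps)
    finally show ?thesis by linarith
  qed
  have "((\<lambda>t. reach_prob n \<delta> (\<epsilon> + \<alpha> * t) (s + \<beta> * t)) has_real_derivative
    (\<Sum>v\<in>light_cone n. \<Sum>y\<in>UNIV. w' y * mex n \<delta> ?e ?s (\<lambda>f. of_bool (reaches n (f(v := y)))))) (at t)"
    unfolding reach_prob_def by (rule ex_has_derivative) (simp_all add: sum_marked_weight w)
  also have "(\<Sum>v\<in>light_cone n. \<Sum>y\<in>UNIV. w' y * mex n \<delta> ?e ?s (\<lambda>f. of_bool (reaches n (f(v := y)))))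
      = (\<Sum>v\<in>light_cone n. - \<alpha> * \<delta> * arrow_influence n \<delta> ?e ?s v
        - \<beta> / 2 * (\<Sum>b\<in>UNIV. mark_influence n \<delta> ?e ?s v b))"
    by (rule sum.cong[OF refl v])
  finally show ?thesis .
qed

section \<open>Influences of arrows against influences of marks\<close>

lemma mark_influence_nonneg:
  assumes "0 \<le> \<delta>" "\<delta> \<le> 1" "0 \<le> \<epsilon>" "\<epsilon> \<le> 1" "0 \<le> s" "s \<le> 1"
  shows "0 \<le> mark_influence n \<delta> \<epsilon> s v b"
  unfolding mark_influence_def by (intro ex_nonneg marked_weight_nonneg assms) auto

lemma arrow_influence_nonneg:
  assumes "0 \<le> \<delta>" "\<delta> \<le> 1" "0 \<le> \<epsilon>" "\<epsilon> \<le> 1" "0 \<le> s" "s \<le> 1"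
  shows "0 \<le> arrow_influence n \<delta> \<epsilon> s v"
  unfolding arrow_influence_def ex_diff[symmetric]
  by (intro ex_nonneg marked_weight_nonneg assms) (use reaches_set_arrow_mono in \<open>auto simp: of_bool_def\<close>)

text \<open>Finite energy: \<open>u\<close> is a source with probability
  \<open>\<delta> * \<epsilon>\<close>, independently of all else, so forcing it to be one costs at
  most this factor.\<close>

lemma mex_set_No_Arrow_le:
  assumes "0 < \<delta>" "\<delta> \<le> 1" "0 < \<epsilon>" "\<epsilon> \<le> 1" "0 \<le> s" "s \<le> 1" "u \<in> light_cone n"
    and \<phi>: "\<And>f. 0 \<le> \<phi> f"
  shows "\<delta> * \<epsilon> * mex n \<delta> \<epsilon> s (\<lambda>f. \<phi> (set_arrow u No_Arrow f)) \<le> mex n \<delta> \<epsilon> s \<phi>"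
proof -
  have "0 \<le> arrow_weight \<delta> \<epsilon> x * mex n \<delta> \<epsilon> s (\<lambda>f. \<phi> (set_arrow u x f))" for x
    using assms by (intro mult_nonneg_nonneg ex_nonneg marked_weight_nonneg arrow_weight_nonneg) auto
  from member_le_sum[of No_Arrow UNIV "\<lambda>x. arrow_weight \<delta> \<epsilon> x * mex n \<delta> \<epsilon> s (\<lambda>f. \<phi> (set_arrow u x f))", OF _ this]
  show ?thesis
    by (simp add: mex_resample_arrow[OF assms(7), symmetric]) (simp add: arrow_weight_def)
qed

text \<open>The two prefactors pay for the surgery: \<open>\<delta> * (1 - \<epsilon>)\<close> for
  having a branching vertex at \<open>v\<close>, and \<open>\<delta> * \<epsilon>\<close> for
  closing either \<open>v\<close> or one of its children. The vertices below \<open>v\<close> may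
  leave the cone and are then not charged.\<close>

lemma arrow_influence_le:
  assumes "0 < \<delta>" "\<delta> \<le> 1" "0 < \<epsilon>" "\<epsilon> \<le> 1" "0 \<le> s" "s \<le> 1" "v \<in> light_cone n"
  shows "\<delta> * \<epsilon> * (\<delta> * (1 - \<epsilon>) * arrow_influence n \<delta> \<epsilon> s v) \<le>
    (\<Sum>b\<in>UNIV. of_bool (below b v \<in> light_cone n) * mark_influence n \<delta> \<epsilon> s (below b v) b)
      + (\<Sum>b\<in>UNIV. mark_influence n \<delta> \<epsilon> s v b)"
proof -
  let ?\<psi> = "\<lambda>f. of_bool (fst (f v) = Both_Arrows) *
     (of_bool (reaches n f) - of_bool (reaches n (set_arrow v No_Arrow f))) :: real"
  let ?B = "\<lambda>b f. of_bool (below b v \<in> light_cone n) * of_bool (mark_pivotal n (below b v) b (set_arrow v No_Arrow f)) :: real"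
  let ?C = "\<lambda>b f. of_bool (child b v \<in> light_cone n) * of_bool (mark_pivotal n v b (set_arrow (child b v) No_Arrow f)) :: real"
  have nn: "0 \<le> marked_weight \<delta> \<epsilon> s y" for y
    using assms by (intro marked_weight_nonneg) auto
  have "mex n \<delta> \<epsilon> s ?\<psi> = \<delta> * (1 - \<epsilon>) * arrow_influence n \<delta> \<epsilon> s v"
    by (subst mex_resample_arrow[OF assms(7)], simp only: UNIV_arrows, simp add: set_simps set_arrow_twice)
      (simp add: arrow_weight_def arrow_influence_def ex_diff)
  moreover have "mex n \<delta> \<epsilon> s ?\<psi> \<le> mex n \<delta> \<epsilon> s (\<lambda>f. (\<Sum>b\<in>UNIV. ?B b f) + (\<Sum>b\<in>UNIV. ?C b f))"
  proof (rule ex_mono[OF nn])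
    fix f
    show "?\<psi> f \<le> (\<Sum>b\<in>UNIV. ?B b f) + (\<Sum>b\<in>UNIV. ?C b f)"
    proof (cases "fst (f v) = Both_Arrows \<and> reaches n f \<and> \<not> reaches n (set_arrow v No_Arrow f)")
      case True
      then consider
          b where "below b v \<in> light_cone n" "mark_pivotal n (below b v) b (set_arrow v No_Arrow f)"
        | b where "child b v \<in> light_cone n" "mark_pivotal n v b (set_arrow (child b v) No_Arrow f)"
        using mark_pivotal_near_arrow_pivotal[of f v n] by blast
      then have "1 \<le> (\<Sum>b\<in>UNIV. ?B b f) + (\<Sum>b\<in>UNIV. ?C b f)"
      proof cases
        case 1
        then have "1 \<le> (\<Sum>b\<in>UNIV. ?B b f)"
          by (intro order_trans[OF _ member_le_sum[of b]]) auto
        moreover have "0 \<le> (\<Sum>b\<in>UNIV. ?C b f)" by (rule sum_nonneg) auto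
        ultimately show ?thesis by linarith
      next
        case 2
        then have "1 \<le> (\<Sum>b\<in>UNIV. ?C b f)"
          by (intro order_trans[OF _ member_le_sum[of b]]) auto
        moreover have "0 \<le> (\<Sum>b\<in>UNIV. ?B b f)" by (rule sum_nonneg) auto
        ultimately show ?thesis by linarith
      qed
      then show ?thesis using True by simp
    next
      case False
      then have "?\<psi> f \<le> 0" by auto
      also have "0 \<le> (\<Sum>b\<in>UNIV. ?B b f) + (\<Sum>b\<in>UNIV. ?C b f)"
        by (intro add_nonneg_nonneg sum_nonneg) auto
      finally show ?thesis .
    qed
  qed
  ultimately have BC: "\<delta> * (1 - \<epsilon>) * arrow_influence n \<delta> \<epsilon> s v
      \<le> (\<Sum>b\<in>UNIV. mex n \<delta> \<epsilon> s (?B b)) + (\<Sum>b\<in>UNIV. mex n \<delta> \<epsilon> s (?C b))"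
    unfolding ex_add ex_sum by simp
  have B: "\<delta> * \<epsilon> * mex n \<delta> \<epsilon> s (?B b) \<le> of_bool (below b v \<in> light_cone n) * mark_influence n \<delta> \<epsilon> s (below b v) b" for b
  proof (cases "below b v \<in> light_cone n")
    case True
    have "\<delta> * \<epsilon> * mex n \<delta> \<epsilon> s (\<lambda>f. of_bool (mark_pivotal n (below b v) b (set_arrow v No_Arrow f)))
        \<le> mark_influence n \<delta> \<epsilon> s (below b v) b"
      unfolding mark_influence_def by (rule mex_set_No_Arrow_le[OF assms]) simp
    then show ?thesis
      using True by simp
  qed simp
  have C: "\<delta> * \<epsilon> * mex n \<delta> \<epsilon> s (?C b) \<le> mark_influence n \<delta> \<epsilon> s v b" for b
  proof (cases "child b v \<in> light_cone n")
    case True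
    have "\<delta> * \<epsilon> * mex n \<delta> \<epsilon> s (\<lambda>f. of_bool (mark_pivotal n v b (set_arrow (child b v) No_Arrow f)))
        \<le> mark_influence n \<delta> \<epsilon> s v b"
      unfolding mark_influence_def by (rule mex_set_No_Arrow_le[OF assms(1-6) True]) simp
    then show ?thesis
      using True by simp
  next
    case False
    then show ?thesis
      using mark_influence_nonneg[of \<delta> \<epsilon> s n v b] assms by simp
  qed
  have "\<delta> * \<epsilon> * (\<delta> * (1 - \<epsilon>) * arrow_influence n \<delta> \<epsilon> s v)
      \<le> \<delta> * \<epsilon> * ((\<Sum>b\<in>UNIV. mex n \<delta> \<epsilon> s (?B b)) + (\<Sum>b\<in>UNIV. mex n \<delta> \<epsilon> s (?C b)))"
    using assms by (intro mult_left_mono BC) auto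
  also have "\<dots> = (\<Sum>b\<in>UNIV. \<delta> * \<epsilon> * mex n \<delta> \<epsilon> s (?B b)) + (\<Sum>b\<in>UNIV. \<delta> * \<epsilon> * mex n \<delta> \<epsilon> s (?C b))"
    by (simp only: distrib_left sum_distrib_left)
  also have "\<dots> \<le> (\<Sum>b\<in>UNIV. of_bool (below b v \<in> light_cone n) * mark_influence n \<delta> \<epsilon> s (below b v) b)
      + (\<Sum>b\<in>UNIV. mark_influence n \<delta> \<epsilon> s v b)"
    by (intro add_mono sum_mono B C)
  finally show ?thesis .
qed

text \<open>For fixed \<open>b\<close> each vertex is below only one other, so it is charged at most
  once.\<close>

lemma sum_below_le:
  assumes "\<And>v. 0 \<le> F v"
  shows "(\<Sum>v\<in>light_cone n. of_bool (below b v \<in> light_cone n) * F (below b v)) \<le> (\<Sum>v\<in>light_cone n. F v :: real)"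
proof -
  have inj: "inj_on (below b) A" for A
    by (rule inj_onI) (metis child_eq_iff)
  have "(\<Sum>v\<in>light_cone n. of_bool (below b v \<in> light_cone n) * F (below b v))
      = (\<Sum>v\<in>light_cone n. if below b v \<in> light_cone n then F (below b v) else 0)"
    by (rule sum.cong[OF refl]) simp
  also have "\<dots> = (\<Sum>v\<in>{v\<in>light_cone n. below b v \<in> light_cone n}. F (below b v))"
    by (rule sum.inter_filter[OF finite_light_cone, symmetric])
  also have "\<dots> = (\<Sum>v\<in>below b ` {v\<in>light_cone n. below b v \<in> light_cone n}. F v)"
    by (subst sum.reindex[OF inj]) (simp add: comp_def)
  also have "\<dots> \<le> (\<Sum>v\<in>light_cone n. F v)"
    by (rule sum_mono2[OF finite_light_cone]) (blast intro: assms)+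
  finally show ?thesis .
qed

text \<open>The factor 2 arises because the mark \<open>b\<close> of a vertex is charged both by
  that vertex and by its child \<open>b\<close>.\<close>

lemma sum_arrow_influence_le:
  assumes "0 < \<delta>" "\<delta> \<le> 1" "0 < \<epsilon>" "\<epsilon> \<le> 1" "0 \<le> s" "s \<le> 1"
  shows "\<delta> * \<epsilon> * (1 - \<epsilon>) * (\<delta> * (\<Sum>v\<in>light_cone n. arrow_influence n \<delta> \<epsilon> s v)) \<le>
    2 * (\<Sum>v\<in>light_cone n. \<Sum>b\<in>UNIV. mark_influence n \<delta> \<epsilon> s v b)"
proof -
  let ?M = "mark_influence n \<delta> \<epsilon> s"
  have nn: "0 \<le> ?M v b" for v b
    using assms by (intro mark_influence_nonneg) auto
  have "\<delta> * \<epsilon> * (1 - \<epsilon>) * (\<delta> * (\<Sum>v\<in>light_cone n. arrow_influence n \<delta> \<epsilon> s v))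
      = (\<Sum>v\<in>light_cone n. \<delta> * \<epsilon> * (\<delta> * (1 - \<epsilon>) * arrow_influence n \<delta> \<epsilon> s v))"
    by (simp add: sum_distrib_left mult_ac)
  also have "\<dots> \<le> (\<Sum>v\<in>light_cone n. (\<Sum>b\<in>UNIV. of_bool (below b v \<in> light_cone n) * ?M (below b v) b) + (\<Sum>b\<in>UNIV. ?M v b))"
    by (intro sum_mono arrow_influence_le assms)
  also have "\<dots> = (\<Sum>b\<in>UNIV. \<Sum>v\<in>light_cone n. of_bool (below b v \<in> light_cone n) * ?M (below b v) b)
      + (\<Sum>v\<in>light_cone n. \<Sum>b\<in>UNIV. ?M v b)"
    unfolding sum.distrib by (subst sum.swap) simp
  also have "(\<Sum>b\<in>UNIV. \<Sum>v\<in>light_cone n. of_bool (below b v \<in> light_cone n) * ?M (below b v) b)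
      \<le> (\<Sum>b\<in>UNIV. \<Sum>v\<in>light_cone n. ?M v b)"
    by (intro sum_mono sum_below_le nn)
  also have "\<dots> = (\<Sum>v\<in>light_cone n. \<Sum>b\<in>UNIV. ?M v b)"
    by (rule sum.swap)
  finally show ?thesis by simp
qed

section \<open>Integration of the differential inequality\<close>

lemma reach_prob_antimono:
  assumes "0 \<le> \<delta>" "\<delta> \<le> 1" "0 \<le> \<epsilon>" "\<epsilon> \<le> \<epsilon>'" "\<epsilon>' \<le> 1" "0 \<le> s" "s \<le> 1"
  shows "reach_prob n \<delta> \<epsilon>' s \<le> reach_prob n \<delta> \<epsilon> s"
proof -
  have "reach_prob n \<delta> (0 + 1 * \<epsilon>') (s + 0 * \<epsilon>') \<le> reach_prob n \<delta> (0 + 1 * \<epsilon>) (s + 0 * \<epsilon>)"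
  proof (rule DERIV_nonpos_imp_nonincreasing[OF assms(4)])
    fix t assume t: "\<epsilon> \<le> t" "t \<le> \<epsilon>'"
    let ?D = "\<Sum>v\<in>light_cone n. - 1 * \<delta> * arrow_influence n \<delta> (0 + 1 * t) (s + 0 * t) v
        - 0 / 2 * (\<Sum>b\<in>UNIV. mark_influence n \<delta> (0 + 1 * t) (s + 0 * t) v b)"
    have "?D \<le> 0"
      using assms t by (intro sum_nonpos) (auto intro!: mult_nonneg_nonneg arrow_influence_nonneg)
    then show "\<exists>y. ((\<lambda>t. reach_prob n \<delta> (0 + 1 * t) (s + 0 * t)) has_real_derivative y) (at t) \<and> y \<le> 0"
      using reach_prob_derivative[of n \<delta> 0 1 s 0 t] by blast
  qed
  then show ?thesis by simp
qed

text \<open>Along the segment from \<open>(\<epsilon>, 0)\<close> to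
  \<open>(\<epsilon> - \<kappa> * s, s)\<close> the derivative is \<kappa> times \<delta> times the
  total arrow influence, minus half the total mark influence. The 4 in the condition on \<kappa> is
  this half combined with the double charging of marks. The condition takes each factor of
  \<open>\<epsilon> * (1 - \<epsilon>)\<close> at the end of the segment where it is smallest, so it
  covers all points between.\<close>

lemma reach_prob_tradeoff:
  assumes "0 < \<delta>" "\<delta> \<le> 1" "0 \<le> \<kappa>" "0 \<le> s" "s \<le> 1" "0 < \<epsilon> - \<kappa> * s" "\<epsilon> \<le> 1"
    and \<kappa>: "4 * \<kappa> \<le> \<delta> * (\<epsilon> - \<kappa> * s) * (1 - \<epsilon>)"
  shows "reach_prob n \<delta> (\<epsilon> - \<kappa> * s) s \<le> reach_prob n \<delta> \<epsilon> 0"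
proof -
  have "reach_prob n \<delta> (\<epsilon> + (- \<kappa>) * s) (0 + 1 * s) \<le> reach_prob n \<delta> (\<epsilon> + (- \<kappa>) * 0) (0 + 1 * 0)"
  proof (rule DERIV_nonpos_imp_nonincreasing[OF assms(4)])
    fix t assume t: "0 \<le> t" "t \<le> s"
    let ?e = "\<epsilon> + (- \<kappa>) * t" and ?s = "0 + 1 * t"
    let ?P = "\<Sum>v\<in>light_cone n. arrow_influence n \<delta> ?e ?s v"
    let ?M = "\<Sum>v\<in>light_cone n. \<Sum>b\<in>UNIV. mark_influence n \<delta> ?e ?s v b"
    have kt: "\<kappa> * t \<le> \<kappa> * s" "0 \<le> \<kappa> * t"
      using assms t by (simp_all add: mult_left_mono)
    then have e: "\<epsilon> - \<kappa> * s \<le> ?e" "?e \<le> \<epsilon>" "0 < ?e" "?e \<le> 1"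
      using assms by auto
    have P: "0 \<le> ?P"
      using assms e t by (intro sum_nonneg arrow_influence_nonneg) auto
    have "4 * \<kappa> \<le> \<delta> * ?e * (1 - ?e)"
    proof (rule order_trans[OF \<kappa>])
      show "\<delta> * (\<epsilon> - \<kappa> * s) * (1 - \<epsilon>) \<le> \<delta> * ?e * (1 - ?e)"
        using assms e by (intro mult_mono) auto
    qed
    then have "4 * \<kappa> * (\<delta> * ?P) \<le> \<delta> * ?e * (1 - ?e) * (\<delta> * ?P)"
      using P assms by (intro mult_right_mono) auto
    also have "\<dots> \<le> 2 * ?M"
      using assms e t by (intro sum_arrow_influence_le) auto
    finally have "4 * (\<kappa> * \<delta> * ?P) \<le> 2 * ?M"
      by (simp only: mult.assoc)
    then have "\<kappa> * \<delta> * ?P - 1 / 2 * ?M \<le> 0"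
      by linarith
    also have "\<kappa> * \<delta> * ?P - 1 / 2 * ?M = (\<Sum>v\<in>light_cone n. - (- \<kappa>) * \<delta> * arrow_influence n \<delta> ?e ?s v
        - 1 / 2 * (\<Sum>b\<in>UNIV. mark_influence n \<delta> ?e ?s v b))"
      by (simp add: sum_subtractf sum_distrib_left)
    finally show "\<exists>y. ((\<lambda>t. reach_prob n \<delta> (\<epsilon> + (- \<kappa>) * t) (0 + 1 * t)) has_real_derivative y) (at t) \<and> y \<le> 0"
      using reach_prob_derivative[of n \<delta> \<epsilon> "- \<kappa>" 0 1 t] by blast
  qed
  then show ?thesis by simp
qed

section \<open>Contours of finite clusters in the quadrant\<close>

type_synonym cell = "int \<times> int"

datatype dir = East | North | West | South

definition step :: "dir \<Rightarrow> int \<times> int" where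
  "step d = (case d of East \<Rightarrow> (1, 0) | North \<Rightarrow> (0, 1) | West \<Rightarrow> (-1, 0) | South \<Rightarrow> (0, -1))"

definition turn_left :: "dir \<Rightarrow> dir" where
  "turn_left d = (case d of East \<Rightarrow> North | North \<Rightarrow> West | West \<Rightarrow> South | South \<Rightarrow> East)"

definition turn_right :: "dir \<Rightarrow> dir" where
  "turn_right d = (case d of East \<Rightarrow> South | North \<Rightarrow> East | West \<Rightarrow> North | South \<Rightarrow> West)"

text \<open>The cell \<open>(i, j)\<close> is the unit square with lower left corner \<open>(i, j)\<close>; an edge is given by its
  starting point and its direction.\<close>

definition left_cell :: "(int \<times> int) \<times> dir \<Rightarrow> cell" where
  "left_cell = (\<lambda>((x, y), d). case d of East \<Rightarrow> (x, y) | North \<Rightarrow> (x - 1, y)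
     | West \<Rightarrow> (x - 1, y - 1) | South \<Rightarrow> (x, y - 1))"

definition right_cell :: "(int \<times> int) \<times> dir \<Rightarrow> cell" where
  "right_cell = (\<lambda>((x, y), d). case d of East \<Rightarrow> (x, y - 1) | North \<Rightarrow> (x, y)
     | West \<Rightarrow> (x - 1, y) | South \<Rightarrow> (x - 1, y - 1))"

definition boundary :: "cell set \<Rightarrow> ((int \<times> int) \<times> dir) set" where
  "boundary C = {e. left_cell e \<in> C \<and> right_cell e \<notin> C}"

text \<open>The boundary is followed with \<open>C\<close> on the left. If only the right one of the
  two cells ahead is in \<open>C\<close>, two cells of \<open>C\<close> touch diagonally; the walk
  then turns left, staying with the cell it is following.\<close>

definition advance :: "cell set \<Rightarrow> (int \<times> int) \<times> dir \<Rightarrow> (int \<times> int) \<times> dir" where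
  "advance C = (\<lambda>(p, d). let p' = p + step d in
     if left_cell (p', d) \<notin> C then (p', turn_left d)
     else if right_cell (p', d) \<notin> C then (p', d)
     else (p', turn_right d))"

lemma advance_boundary: "e \<in> boundary C \<Longrightarrow> advance C e \<in> boundary C"
  by (cases e; cases "snd e")
    (auto simp: boundary_def advance_def left_cell_def right_cell_def step_def turn_left_def turn_right_def
      Let_def)

text \<open>The cells around the common endpoint determine where the walk came from. At a diagonal
  contact two boundary edges enter the same corner, but both turn left and so leave in opposite
  directions.\<close>

lemma inj_on_advance: "inj_on (advance C) (boundary C)"
proof (rule inj_onI)
  fix e e' assume "e \<in> boundary C" "e' \<in> boundary C" "advance C e = advance C e'"
  then show "e = e'"
    by (cases e; cases e'; cases "snd e"; cases "snd e'")
      (auto simp: boundary_def advance_def left_cell_def right_cell_def step_def turn_left_def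
        turn_right_def Let_def add.commute split: if_splits)
qed

lemma UNIV_dir: "(UNIV :: dir set) = {East, North, West, South}"
  using dir.exhaust by blast

instance dir :: finite
  by standard (simp add: UNIV_dir)

lemma card_UNIV_dir: "card (UNIV :: dir set) = 4"
  by (simp add: UNIV_dir)

lemma finite_boundary: "finite C \<Longrightarrow> finite (boundary C)"
proof (rule inj_on_finite[of "\<lambda>e. (left_cell e, snd e)"])
  show "inj_on (\<lambda>e. (left_cell e, snd e)) (boundary C)"
    by (rule inj_onI) (auto simp: left_cell_def split: dir.splits)
  show "(\<lambda>e. (left_cell e, snd e)) ` boundary C \<subseteq> C \<times> UNIV"
    by (auto simp: boundary_def)
qed simp

text \<open>Injectivity makes the orbit purely periodic, since any repetition can be pulled back to
  the start; before the least return time all points are distinct.\<close>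

lemma orbit_returns:
  assumes "finite B" "inj_on f B" "f ` B \<subseteq> B" "e \<in> B"
  shows "\<exists>l>0. (f ^^ l) e = e \<and> inj_on (\<lambda>i. (f ^^ i) e) {..<l}"
proof -
  have B: "(f ^^ i) x \<in> B" if "x \<in> B" for i x
    using that assms(3) by (induction i) auto
  have inj: "x = y" if "x \<in> B" "y \<in> B" "(f ^^ i) x = (f ^^ i) y" for x y i
    using that
  proof (induction i)
    case (Suc i)
    then have "(f ^^ i) x = (f ^^ i) y"
      using inj_onD[OF assms(2) _ B[OF Suc.prems(1)] B[OF Suc.prems(2)], of i i] by simp
    then show ?case
      using Suc by blast
  qed simp
  have ret: "(f ^^ (j - i)) e = e" if "i < j" "(f ^^ i) e = (f ^^ j) e" for i j
  proof -
    have "(f ^^ (i + (j - i))) e = (f ^^ i) e"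
      using that by simp
    then have "(f ^^ i) ((f ^^ (j - i)) e) = (f ^^ i) e"
      unfolding funpow_add by simp
    then show ?thesis
      by (rule inj[OF B[OF assms(4)] assms(4)])
  qed
  have "\<not> inj (\<lambda>i. (f ^^ i) e)"
  proof
    assume "inj (\<lambda>i. (f ^^ i) e)"
    moreover have "range (\<lambda>i. (f ^^ i) e) \<subseteq> B"
      using B[OF assms(4)] by blast
    ultimately show False
      using range_inj_infinite finite_subset[OF _ assms(1)] by blast
  qed
  then obtain i j where "i < j" "(f ^^ i) e = (f ^^ j) e"
    unfolding inj_on_def by (metis linorder_neqE_nat)
  then have ex: "\<exists>l. 0 < l \<and> (f ^^ l) e = e"
    using ret[of i j] zero_less_diff[of j i] by blast
  define l where "l = (LEAST l. 0 < l \<and> (f ^^ l) e = e)"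
  have l: "0 < l" "(f ^^ l) e = e"
    using LeastI_ex[OF ex] by (simp_all add: l_def)
  have ne: "(f ^^ i) e \<noteq> (f ^^ j) e" if "i < j" "j < l" for i j
  proof
    assume "(f ^^ i) e = (f ^^ j) e"
    then have "0 < j - i \<and> (f ^^ (j - i)) e = e"
      using ret that by simp
    then have "l \<le> j - i"
      unfolding l_def by (rule Least_le)
    then show False
      using that by simp
  qed
  have "inj_on (\<lambda>i. (f ^^ i) e) {..<l}"
  proof (rule linorder_inj_onI)
    show "(f ^^ i) e \<noteq> (f ^^ j) e" if "i < j" "i \<in> {..<l}" "j \<in> {..<l}" for i j
      using ne that by simp
  qed auto
  then show ?thesis
    using l by blast
qed

definition walk_pos :: "dir list \<Rightarrow> nat \<Rightarrow> int \<times> int" where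
  "walk_pos ds i = (\<Sum>k<i. step (ds ! k))"

text \<open>The right cell of a step north is the east neighbor of the cell on the left, that of a
  step west its north neighbor. These are the directions in which the oriented cluster grows, so
  such cells must be closed. Steps east and south carry no information. Contours are recorded as
  lists of directions from a fixed corner, so there are \<open>4 ^ l\<close> of length
  \<open>l\<close>.\<close>

definition contour_cells :: "dir list \<Rightarrow> cell set" where
  "contour_cells ds = (\<lambda>i. right_cell (walk_pos ds i, ds ! i)) `
     {i. i < length ds \<and> ds ! i \<in> {North, West}}"

text \<open>A closed walk has as many steps north as south and as many steps west as east, and a cell is to
  the right of at most one step north and one step west: this gives the factor 4.\<close>

lemma finite_cluster_contour:
  assumes "finite C" "(0, 0) \<in> C" "C \<subseteq> {(i, j). 0 \<le> i \<and> 0 \<le> j}"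
  shows "\<exists>ds. ds \<noteq> [] \<and> length ds \<le> 4 * card (contour_cells ds) \<and>
    (\<forall>c\<in>contour_cells ds. c \<notin> C \<and> (c - (1, 0) \<in> C \<or> c - (0, 1) \<in> C))"
proof -
  define e where "e i = (advance C ^^ i) ((0, 0), East)" for i
  \<comment> \<open>The bottom edge of the cell at the origin: the cell under it lies outside the
    quadrant, hence outside \<open>C\<close>. Starting every contour here saves counting starting
    points.\<close>
  have b0: "((0, 0), East) \<in> boundary C"
    using assms by (auto simp: boundary_def left_cell_def right_cell_def)
  have b: "e i \<in> boundary C" for i
    unfolding e_def by (induction i) (use b0 advance_boundary in auto)
  obtain l where l: "l > 0" "e l = e 0" "inj_on e {..<l}"
    using orbit_returns[OF finite_boundary[OF assms(1)] inj_on_advance _ b0] advance_boundary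
    by (auto simp: e_def[abs_def] image_subset_iff)
  have eS: "fst (e (Suc i)) = fst (e i) + step (snd (e i))" for i
    unfolding e_def by (simp add: advance_def case_prod_unfold Let_def)
  have pos: "fst (e i) = (\<Sum>k<i. step (snd (e k)))" for i
  proof (induction i)
    case 0
    show ?case by (simp add: e_def zero_prod_def)
  next
    case (Suc i)
    then show ?case by (simp add: eS)
  qed
  define ds where "ds = map (\<lambda>i. snd (e i)) [0..<l]"
  have ds: "length ds = l" "\<And>i. i < l \<Longrightarrow> ds ! i = snd (e i)"
    by (simp_all add: ds_def)
  have wp: "walk_pos ds i = fst (e i)" if "i < l" for i
    unfolding walk_pos_def pos using that ds by (intro sum.cong) auto
  define N where "N d = {i. i < l \<and> snd (e i) = d}" for d
  have finN: "finite (N d)" for d by (simp add: N_def)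
  have tot: "(\<Sum>k<l. g (snd (e k))) = int (card (N East)) * g East + int (card (N North)) * g North
      + int (card (N West)) * g West + int (card (N South)) * g South" for g :: "dir \<Rightarrow> int"
  proof -
    have "(\<Sum>k<l. g (snd (e k))) = (\<Sum>d\<in>UNIV. \<Sum>k\<in>{k\<in>{..<l}. snd (e k) = d}. g (snd (e k)))"
      by (rule sum.group[symmetric]) auto
    also have "\<dots> = (\<Sum>d\<in>UNIV. int (card (N d)) * g d)"
      by (rule sum.cong) (auto simp: N_def)
    finally show ?thesis by (simp add: UNIV_dir)
  qed
  have z: "(\<Sum>k<l. step (snd (e k))) = 0"
    using pos[of l] l(2) by (simp add: e_def zero_prod_def)
  have "fst (\<Sum>k<l. step (snd (e k))) = (\<Sum>k<l. fst (step (snd (e k))))"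
    "snd (\<Sum>k<l. step (snd (e k))) = (\<Sum>k<l. snd (step (snd (e k))))"
    by (simp_all add: fst_sum snd_sum)
  then have "card (N East) = card (N West)" "card (N North) = card (N South)"
    unfolding z using tot[of "\<lambda>d. fst (step d)"] tot[of "\<lambda>d. snd (step d)"] by (simp_all add: step_def)
  moreover have "int l = int (card (N East)) + int (card (N North)) + int (card (N West)) + int (card (N South))"
    using tot[of "\<lambda>_. 1"] by simp
  ultimately have "int l = int (2 * (card (N North) + card (N West)))"
    by simp
  then have len: "l = 2 * (card (N North) + card (N West))"
    by (simp only: of_nat_eq_iff)
  have cells: "contour_cells ds = (\<lambda>i. right_cell (e i)) ` (N North \<union> N West)"
    unfolding contour_cells_def
  proof (rule image_cong)
    show "{i. i < length ds \<and> ds ! i \<in> {North, West}} = N North \<union> N West"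
      using ds by (auto simp: N_def)
    show "right_cell (walk_pos ds i, ds ! i) = right_cell (e i)" if "i \<in> N North \<union> N West" for i
      using that wp[of i] ds(2)[of i] by (cases "e i") (auto simp: N_def)
  qed
  have card: "card (N d) \<le> card (contour_cells ds)" if "d = North \<or> d = West" for d
  proof (rule card_inj_on_le)
    show "inj_on (\<lambda>i. right_cell (e i)) (N d)"
    proof (rule inj_onI)
      fix i j assume ij: "i \<in> N d" "j \<in> N d" "right_cell (e i) = right_cell (e j)"
      then have "e i = e j"
        using that by (cases "e i"; cases "e j") (auto simp: N_def right_cell_def)
      then show "i = j"
        using ij inj_onD[OF l(3)] by (auto simp: N_def)
    qed
    show "(\<lambda>i. right_cell (e i)) ` N d \<subseteq> contour_cells ds"
      using that unfolding cells by auto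
    show "finite (contour_cells ds)"
      unfolding cells using finN by simp
  qed
  have "c \<notin> C \<and> (c - (1, 0) \<in> C \<or> c - (0, 1) \<in> C)" if c: "c \<in> contour_cells ds" for c
  proof -
    obtain i where i: "c = right_cell (e i)" "i \<in> N North \<union> N West"
      using c unfolding cells by blast
    then show ?thesis
      using b[of i] by (cases "e i") (auto simp: N_def boundary_def left_cell_def right_cell_def)
  qed
  moreover have "length ds \<le> 4 * card (contour_cells ds)" "ds \<noteq> []"
    using card[of North] card[of West] len l ds by auto
  ultimately show ?thesis by blast
qed

section \<open>Oriented site percolation in the quadrant\<close>

primrec crosses :: "(cell \<Rightarrow> bool) \<Rightarrow> nat \<Rightarrow> cell \<Rightarrow> bool" where
  "crosses G 0 c = G c"
| "crosses G (Suc n) c = (G c \<and> (crosses G n (c + (1, 0)) \<or> crosses G n (c + (0, 1))))"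

lemma crosses_antimono: "crosses G (m + n) c \<Longrightarrow> crosses G n c"
  by (induction n arbitrary: c) (cases m, auto)

inductive_set cluster :: "(cell \<Rightarrow> bool) \<Rightarrow> cell set" for G where
  origin: "G (0, 0) \<Longrightarrow> (0, 0) \<in> cluster G"
| east: "c \<in> cluster G \<Longrightarrow> G (c + (1, 0)) \<Longrightarrow> c + (1, 0) \<in> cluster G"
| north: "c \<in> cluster G \<Longrightarrow> G (c + (0, 1)) \<Longrightarrow> c + (0, 1) \<in> cluster G"

text \<open>The claim for all \<open>n\<close> makes the induction work: a crossing that starts at
  \<open>c\<close> is prolonged backwards to the origin. For \<open>n = 0\<close> a distant cluster
  cell already gives a long crossing.\<close>

lemma cluster_crosses:
  assumes "c \<in> cluster G"
  shows "G c \<and> 0 \<le> fst c \<and> 0 \<le> snd c \<and> (\<forall>n. crosses G n c \<longrightarrow> crosses G (nat (fst c + snd c) + n) (0, 0))"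
  using assms
proof induction
  case (east c)
  have "crosses G (nat (fst (c + (1, 0)) + snd (c + (1, 0))) + n) (0, 0)" if "crosses G n (c + (1, 0))" for n
  proof -
    have "crosses G (Suc n) c"
      using that east by simp
    then have "crosses G (nat (fst c + snd c) + Suc n) (0, 0)"
      using east by blast
    moreover have "nat (fst (c + (1, 0)) + snd (c + (1, 0))) + n = nat (fst c + snd c) + Suc n"
      using east by auto
    ultimately show ?thesis by simp
  qed
  then show ?case using east by auto
next
  case (north c)
  have "crosses G (nat (fst (c + (0, 1)) + snd (c + (0, 1))) + n) (0, 0)" if "crosses G n (c + (0, 1))" for n
  proof -
    have "crosses G (Suc n) c"
      using that north by simp
    then have "crosses G (nat (fst c + snd c) + Suc n) (0, 0)"
      using north by blast
    moreover have "nat (fst (c + (0, 1)) + snd (c + (0, 1))) + n = nat (fst c + snd c) + Suc n"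
      using north by auto
    ultimately show ?thesis by simp
  qed
  then show ?case using north by auto
qed simp

definition coarse_triangle :: "nat \<Rightarrow> cell set" where
  "coarse_triangle N = {(i, j). 0 \<le> i \<and> 0 \<le> j \<and> i + j \<le> int N}"

lemma finite_coarse_triangle [simp]: "finite (coarse_triangle N)"
proof -
  have "coarse_triangle N \<subseteq> {0..int N} \<times> {0..int N}"
    by (auto simp: coarse_triangle_def)
  then show ?thesis by (rule finite_subset) simp
qed

text \<open>Without a crossing the cluster stays strictly under the hypotenuse, so it is finite and
  its contour cells, one step further out, still lie in the triangle. They are closed because
  otherwise the cluster would contain them.\<close>

lemma blocking_contour:
  assumes "G (0, 0)" "\<not> crosses G N (0, 0)"
  shows "\<exists>ds. ds \<noteq> [] \<and> length ds \<le> 4 * card (contour_cells ds) \<and>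
    contour_cells ds \<subseteq> coarse_triangle N \<and> (\<forall>c\<in>contour_cells ds. \<not> G c)"
proof -
  have C: "0 \<le> fst c \<and> 0 \<le> snd c \<and> fst c + snd c < int N" if "c \<in> cluster G" for c
  proof (rule ccontr)
    assume "\<not> ?thesis"
    then have N: "N \<le> nat (fst c + snd c)"
      using cluster_crosses[OF that] by auto
    have "crosses G (nat (fst c + snd c) + 0) (0, 0)"
      using cluster_crosses[OF that] crosses.simps(1) by blast
    then have "crosses G ((nat (fst c + snd c) - N) + N) (0, 0)"
      using N by simp
    then show False
      using assms(2) crosses_antimono by blast
  qed
  then have "cluster G \<subseteq> coarse_triangle N"
    unfolding coarse_triangle_def by fastforce
  then have "finite (cluster G)"
    by (rule finite_subset) simp
  moreover have "cluster G \<subseteq> {(i, j). 0 \<le> i \<and> 0 \<le> j}"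
    using C by fastforce
  ultimately obtain ds where ds: "ds \<noteq> []" "length ds \<le> 4 * card (contour_cells ds)"
    "\<And>c. c \<in> contour_cells ds \<Longrightarrow> c \<notin> cluster G \<and> (c - (1, 0) \<in> cluster G \<or> c - (0, 1) \<in> cluster G)"
    using finite_cluster_contour[of "cluster G"] cluster.origin[of G, OF assms(1)] by blast
  have "\<not> G c \<and> c \<in> coarse_triangle N" if c: "c \<in> contour_cells ds" for c
    using ds(3)[OF c]
  proof (elim conjE disjE)
    assume "c \<notin> cluster G" "c - (1, 0) \<in> cluster G"
    then show ?thesis
      using cluster.east[of "c - (1, 0)" G] C[of "c - (1, 0)"] by (cases c) (auto simp: coarse_triangle_def)
  next
    assume "c \<notin> cluster G" "c - (0, 1) \<in> cluster G"
    then show ?thesis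
      using cluster.north[of "c - (0, 1)" G] C[of "c - (0, 1)"] by (cases c) (auto simp: coarse_triangle_def)
  qed
  then show ?thesis
    using ds by blast
qed

text \<open>A contour of length \<open>l\<close> has at least \<open>l / 4\<close> distinct closed
  cells in disjoint blocks, so it occurs with probability at most \<open>(1 / 16) ^ l\<close>. With
  at most \<open>4 ^ l\<close> contours of this length the sum is at most that of
  \<open>(1 / 4) ^ l\<close> over \<open>l \<ge> 1\<close>, which is 1/3. The contour argument
  presupposes an open origin, and the room left up to 1/2 pays for a closed one.\<close>

lemma peierls:
  assumes S: "finite S" "finite I" "sum w S = 1" and w: "\<And>a. a \<in> S \<Longrightarrow> 0 \<le> w a"
    and B: "\<And>c. c \<in> coarse_triangle N \<Longrightarrow> B c \<subseteq> I" "disjoint_family_on B (coarse_triangle N)"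
    and G: "\<And>c f g. c \<in> coarse_triangle N \<Longrightarrow> (\<And>i. i \<in> B c \<Longrightarrow> f i = g i) \<Longrightarrow> G f c = G g c"
    and bad: "\<And>c. c \<in> coarse_triangle N \<Longrightarrow> ex S I w (\<lambda>f. of_bool (\<not> G f c)) \<le> (1 / 16) ^ 4"
  shows "ex S I w (\<lambda>f. of_bool (\<not> crosses (G f) N (0, 0))) \<le> 1 / 2"
proof -
  define L where "L = 4 * card (coarse_triangle N)"
  define W where "W = {ds. ds \<noteq> [] \<and> length ds \<le> 4 * card (contour_cells ds) \<and> contour_cells ds \<subseteq> coarse_triangle N}"
  have len: "length ds \<in> {1..L}" if "ds \<in> W" for ds
  proof -
    have "card (contour_cells ds) \<le> card (coarse_triangle N)"
      using that by (intro card_mono) (auto simp: W_def)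
    then show ?thesis
      using that by (auto simp: W_def L_def Suc_le_eq)
  qed
  have fin: "finite {ds :: dir list. length ds = l}" and num: "card {ds :: dir list. length ds = l} = 4 ^ l" for l
    using finite_lists_length_eq[of "UNIV :: dir set" l] card_lists_length_eq[of "UNIV :: dir set" l]
    by (simp_all add: card_UNIV_dir)
  have WL: "W \<subseteq> (\<Union>l\<in>{1..L}. {ds. length ds = l})"
    using len by auto
  then have finW: "finite W"
    by (rule finite_subset) (use fin in auto)
  have "ex S I w (\<lambda>f. of_bool (\<not> crosses (G f) N (0, 0))) \<le>
      ex S I w (\<lambda>f. of_bool (\<not> G f (0, 0)) + (\<Sum>ds\<in>W. \<Prod>c\<in>contour_cells ds. of_bool (\<not> G f c)))"
  proof (rule ex_mono[OF w])
    fix f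
    have nn: "0 \<le> (\<Sum>ds\<in>W. \<Prod>c\<in>contour_cells ds. of_bool (\<not> G f c) :: real)"
      by (intro sum_nonneg prod_nonneg) auto
    show "of_bool (\<not> crosses (G f) N (0, 0)) \<le>
        of_bool (\<not> G f (0, 0)) + (\<Sum>ds\<in>W. \<Prod>c\<in>contour_cells ds. of_bool (\<not> G f c) :: real)"
    proof (cases "G f (0, 0) \<and> \<not> crosses (G f) N (0, 0)")
      case True
      then obtain ds where ds: "ds \<in> W" "\<And>c. c \<in> contour_cells ds \<Longrightarrow> \<not> G f c"
        using blocking_contour[of "G f" N] unfolding W_def by blast
      then have "1 = (\<Prod>c\<in>contour_cells ds. of_bool (\<not> G f c) :: real)"
        by (intro prod.neutral[symmetric]) auto
      also have "\<dots> \<le> (\<Sum>ds\<in>W. \<Prod>c\<in>contour_cells ds. of_bool (\<not> G f c))"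
        by (rule member_le_sum[OF ds(1) _ finW]) (auto intro!: prod_nonneg)
      finally show ?thesis using True by simp
    next
      case False
      then show ?thesis using nn by auto
    qed
  qed auto
  also have "\<dots> = ex S I w (\<lambda>f. of_bool (\<not> G f (0, 0)))
      + (\<Sum>ds\<in>W. ex S I w (\<lambda>f. \<Prod>c\<in>contour_cells ds. of_bool (\<not> G f c)))"
    by (simp only: ex_add ex_sum)
  also have "\<dots> \<le> (1 / 16) ^ 4 + (\<Sum>ds\<in>W. (1 / 16) ^ length ds)"
  proof (intro add_mono sum_mono bad)
    show "(0, 0) \<in> coarse_triangle N" by (simp add: coarse_triangle_def)
    fix ds assume ds: "ds \<in> W"
    then have sub: "contour_cells ds \<subseteq> coarse_triangle N" by (simp add: W_def)
    have "ex S I w (\<lambda>f. \<Prod>c\<in>contour_cells ds. of_bool (\<not> G f c))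
        = (\<Prod>c\<in>contour_cells ds. ex S I w (\<lambda>f. of_bool (\<not> G f c)))"
    proof (rule ex_indep_prod[OF S, where B = B])
      show "finite (contour_cells ds)" using sub by (rule finite_subset) simp
      show "disjoint_family_on B (contour_cells ds)"
        using B(2) sub by (rule disjoint_family_on_mono[rotated])
      show "B c \<subseteq> I" if "c \<in> contour_cells ds" for c using that sub B(1) by blast
      show "of_bool (\<not> G f c) = (of_bool (\<not> G g c) :: real)"
        if "c \<in> contour_cells ds" "\<And>i. i \<in> B c \<Longrightarrow> f i = g i" for c f g
        using G[of c f g] that sub by auto
    qed
    also have "\<dots> \<le> (\<Prod>c\<in>contour_cells ds. (1 / 16) ^ 4)"
      by (intro prod_mono conjI ex_nonneg w bad) (use sub in auto)
    also have "\<dots> = (1 / 16) ^ (4 * card (contour_cells ds))"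
      by (simp add: power_mult)
    also have "\<dots> \<le> (1 / 16) ^ length ds"
      using ds by (intro power_decreasing) (auto simp: W_def)
    finally show "ex S I w (\<lambda>f. \<Prod>c\<in>contour_cells ds. of_bool (\<not> G f c)) \<le> (1 / 16) ^ length ds" .
  qed
  also have "(\<Sum>ds\<in>W. (1 / 16) ^ length ds :: real)
      \<le> (\<Sum>ds\<in>(\<Union>l\<in>{1..L}. {ds :: dir list. length ds = l}). (1 / 16) ^ length ds)"
    by (rule sum_mono2) (use WL fin in auto)
  also have "\<dots> = (\<Sum>l\<in>{1..L}. \<Sum>ds\<in>{ds :: dir list. length ds = l}. (1 / 16) ^ length ds)"
    by (rule sum.UNION_disjoint) (use fin in auto)
  also have "\<dots> = (\<Sum>l\<in>{1..L}. (1 / 4) ^ l)"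
  proof (rule sum.cong[OF refl])
    fix l
    have "(\<Sum>ds\<in>{ds :: dir list. length ds = l}. (1 / 16) ^ length ds :: real) = 4 ^ l * (1 / 16) ^ l"
      by (simp add: num)
    also have "\<dots> = (1 / 4) ^ l"
      by (simp add: power_mult_distrib[symmetric])
    finally show "(\<Sum>ds\<in>{ds :: dir list. length ds = l}. (1 / 16) ^ length ds :: real) = (1 / 4) ^ l" .
  qed
  also have "\<dots> \<le> 1 / 3"
  proof -
    have "(\<Sum>l\<in>{1..m}. (1 / 4 :: real) ^ l) \<le> 1 / 3 * (1 - (1 / 4) ^ m)" for m
      by (induction m) simp_all
    also have "1 / 3 * (1 - (1 / 4 :: real) ^ m) \<le> 1 / 3" for m by simp
    finally show ?thesis .
  qed
  finally have "ex S I w (\<lambda>f. of_bool (\<not> crosses (G f) N (0, 0))) \<le> (1 / 16) ^ 4 + 1 / 3"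
    by simp
  moreover have "(1 / 16 :: real) ^ 4 + 1 / 3 \<le> 1 / 2"
    by (simp add: power_divide)
  ultimately show ?thesis by linarith
qed

section \<open>Survival for small death rates\<close>

context
  fixes lo hi zl zh :: int
begin

text \<open>Walls \<open>lo\<close>, \<open>hi\<close> constrain all vertices but the last, which
  must hit the target \<open>zl\<close>, \<open>zh\<close>. Only the existence of a path is asked
  for; the strategy of following arrows towards the target appears in the estimate of the failure
  probability.\<close>

primrec steers :: "(vertex \<Rightarrow> arrows) \<Rightarrow> nat \<Rightarrow> vertex \<Rightarrow> bool" where
  "steers X 0 v \<longleftrightarrow> zl \<le> fst v \<and> fst v \<le> zh"
| "steers X (Suc k) v \<longleftrightarrow> lo \<le> fst v \<and> fst v \<le> hi \<and> (\<exists>w. arrow X v w \<and> steers X k w)"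

end

lemma child_in_vertices [simp]: "child b v \<in> vertices \<longleftrightarrow> v \<in> vertices"
  by (simp add: child_def)

lemma fst_child: "fst (child b v) = (if b then fst v - 1 else fst v + 1)"
  by (simp add: child_def left_up_def right_up_def)

lemma steers_path:
  assumes "steers lo hi zl zh X k v" "v \<in> vertices"
  shows "\<exists>w\<in>vertices. zl \<le> fst w \<and> fst w \<le> zh \<and> snd w = snd v + int k \<and>
    (\<forall>m. path_of_length X m w \<longrightarrow> path_of_length X (k + m) v)"
  using assms
proof (induction k arbitrary: v)
  case 0
  then show ?case by (intro bexI[of _ v]) auto
next
  case (Suc k)
  then obtain u where u: "arrow X v u" "steers lo hi zl zh X k u"
    by (auto simp del: split_paired_Ex)
  then obtain b where b: "u = child b v"
    using arrow_child by blast
  then obtain w where w: "w \<in> vertices" "zl \<le> fst w" "fst w \<le> zh" "snd w = snd u + int k"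
    "\<And>m. path_of_length X m w \<Longrightarrow> path_of_length X (k + m) u"
    using Suc.IH[OF u(2)] Suc.prems by (auto simp del: split_paired_Ex)
  have "path_of_length X (Suc k + m) v" if "path_of_length X m w" for m
    using w(5)[OF that] u(1) by (auto simp del: split_paired_Ex)
  then show ?case
    using w b by (intro bexI[of _ w]) auto
qed

text \<open>The upper level is excluded, because a walk of \<open>k\<close> steps reads
  \<open>k\<close> levels of arrows. Boxes stacked on top of each other are thereby
  disjoint.\<close>

definition strip :: "int \<Rightarrow> int \<Rightarrow> int \<Rightarrow> int \<Rightarrow> vertex set" where
  "strip lo hi s t = {v \<in> vertices. lo \<le> fst v \<and> fst v \<le> hi \<and> s \<le> snd v \<and> snd v < t}"

lemma finite_strip: "finite (strip lo hi s t)"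
proof -
  have "strip lo hi s t \<subseteq> {lo..hi} \<times> {s..t}"
    by (auto simp: strip_def)
  then show ?thesis by (rule finite_subset) simp
qed

lemma steers_cong:
  assumes "\<And>u. u \<in> strip lo hi s t \<Longrightarrow> X u = X' u" "v \<in> vertices" "s \<le> snd v" "snd v + int k \<le> t"
  shows "steers lo hi zl zh X k v = steers lo hi zl zh X' k v"
  using assms(2-4)
proof (induction k arbitrary: v)
  case (Suc k)
  have IH: "steers lo hi zl zh X k (child b v) = steers lo hi zl zh X' k (child b v)" for b
    using Suc.prems by (intro Suc.IH) auto
  show ?case
  proof (cases "lo \<le> fst v \<and> fst v \<le> hi")
    case True
    then have "X v = X' v"
      using Suc.prems by (intro assms(1)) (auto simp: strip_def)
    then have "arrow X v w = arrow X' v w" for w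
      by (rule arrow_cong)
    then show ?thesis
      using IH arrow_child by (metis steers.simps(2))
  qed auto
qed simp

text \<open>Union bound for \<open>k\<close> remaining steps from displacement \<open>y\<close>
  relative to the target center. The four terms stand for leaving through the right wall at distance
  \<open>W\<^sub>2\<close>, leaving through the left wall at distance \<open>W\<^sub>1\<close>,
  ending further than \<open>w\<close> from the center, and meeting a source. The first three are
  Markov bounds for an exponential potential that gains at most \<open>1 + \<delta>\<close> per
  step. The walls can be hit at any time and use no contraction; the final position uses it
  \<open>k\<close> times.\<close>

definition steer_bound :: "real \<Rightarrow> real \<Rightarrow> nat \<Rightarrow> nat \<Rightarrow> nat \<Rightarrow> nat \<Rightarrow> int \<Rightarrow> real" where
  "steer_bound \<delta> \<kappa> W\<^sub>1 W\<^sub>2 w k y =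
     ((1 + \<delta>) ^ nat y + k * (1 + \<delta>)) / (1 + \<delta>) ^ W\<^sub>2 +
     ((1 + \<delta>) ^ nat (- y) + k * (1 + \<delta>)) / (1 + \<delta>) ^ W\<^sub>1 +
     ((1 - \<delta>\<^sup>2 / 2) ^ k * ((1 + \<delta>) ^ nat y + (1 + \<delta>) ^ nat (- y)) + 2 * k * (1 + \<delta>)) / (1 + \<delta>) ^ w +
     k * \<kappa>"

section \<open>A supersolution for the failure of steering\<close>

lemma rate_bounds:
  fixes \<delta> :: real
  assumes "0 \<le> \<delta>" "\<delta> \<le> 1"
  shows "0 \<le> 1 - \<delta>\<^sup>2 / 2" "1 - \<delta>\<^sup>2 / 2 \<le> 1" "0 \<le> (1 - \<delta>\<^sup>2 / 2) ^ k"
proof -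
  show "0 \<le> 1 - \<delta>\<^sup>2 / 2"
    using power_le_one[of \<delta> 2] assms by simp
  then show "0 \<le> (1 - \<delta>\<^sup>2 / 2) ^ k"
    by (rule zero_le_power)
qed simp

lemma steer_bound_nonneg: "0 \<le> \<delta> \<Longrightarrow> \<delta> \<le> 1 \<Longrightarrow> 0 \<le> \<kappa> \<Longrightarrow> 0 \<le> steer_bound \<delta> \<kappa> W\<^sub>1 W\<^sub>2 w k y"
  unfolding steer_bound_def
  by (intro add_nonneg_nonneg divide_nonneg_nonneg mult_nonneg_nonneg rate_bounds(3)) auto

text \<open>The base \<open>1 + \<delta>\<close> is chosen so that a step towards the target with probability
  \<open>(1 + \<delta>) / 2\<close> contracts the potential by the factor \<open>1 - \<delta>\<^sup>2 / 2\<close>.\<close>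

lemma potential_step:
  fixes \<delta> :: real
  assumes "0 \<le> \<delta>" "\<delta> \<le> 1"
  shows "y > 0 \<Longrightarrow> (1 + \<delta>) / 2 * (1 + \<delta>) ^ nat (y - 1) + (1 - \<delta>) / 2 * (1 + \<delta>) ^ nat (y + 1)
      \<le> (1 - \<delta>\<^sup>2 / 2) * (1 + \<delta>) ^ nat y + (1 + \<delta>)"
    and "y \<le> 0 \<Longrightarrow> (1 + \<delta>) / 2 * (1 + \<delta>) ^ nat (y + 1) + (1 - \<delta>) / 2 * (1 + \<delta>) ^ nat (y - 1)
      \<le> (1 - \<delta>\<^sup>2 / 2) * (1 + \<delta>) ^ nat y + (1 + \<delta>)"
    and "y > 0 \<Longrightarrow> (1 + \<delta>) / 2 * (1 + \<delta>) ^ nat (- (y - 1)) + (1 - \<delta>) / 2 * (1 + \<delta>) ^ nat (- (y + 1))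
      \<le> (1 - \<delta>\<^sup>2 / 2) * (1 + \<delta>) ^ nat (- y) + (1 + \<delta>)"
    and "y \<le> 0 \<Longrightarrow> (1 + \<delta>) / 2 * (1 + \<delta>) ^ nat (- (y + 1)) + (1 - \<delta>) / 2 * (1 + \<delta>) ^ nat (- (y - 1))
      \<le> (1 - \<delta>\<^sup>2 / 2) * (1 + \<delta>) ^ nat (- y) + (1 + \<delta>)"
proof -
  have d2: "\<delta>\<^sup>2 \<le> 1"
    using assms by (simp add: power_le_one)
  have up: "(1 + \<delta>) / 2 * (1 + \<delta>) ^ m + (1 - \<delta>) / 2 * (1 + \<delta>) ^ Suc (Suc m)
      \<le> (1 - \<delta>\<^sup>2 / 2) * (1 + \<delta>) ^ Suc m + (1 + \<delta>)" for m
  proof -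
    have "(1 + \<delta>) / 2 * (1 + \<delta>) ^ m + (1 - \<delta>) / 2 * (1 + \<delta>) ^ Suc (Suc m)
        = (1 - \<delta>\<^sup>2 / 2) * (1 + \<delta>) ^ Suc m"
      by (simp add: power2_eq_square field_simps)
    then show ?thesis using assms by simp
  qed
  \<comment> \<open>The potential is constant on one side of 0. There, and at the kink in 0, it does
    not contract; the additive \<open>1 + \<delta>\<close> absorbs these sites.\<close>
  have flat: "(1 + \<delta>) / 2 * 1 + (1 - \<delta>) / 2 * 1 \<le> (1 - \<delta>\<^sup>2 / 2) * 1 + (1 + \<delta>)"
    using d2 assms by (simp add: field_simps)
  have zero: "(1 + \<delta>) / 2 * 1 + (1 - \<delta>) / 2 * (1 + \<delta>) \<le> (1 - \<delta>\<^sup>2 / 2) * 1 + (1 + \<delta>)"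
    "(1 + \<delta>) / 2 * (1 + \<delta>) + (1 - \<delta>) / 2 * 1 \<le> (1 - \<delta>\<^sup>2 / 2) * 1 + (1 + \<delta>)"
    using d2 assms by (simp_all add: power2_eq_square field_simps)
  show "(1 + \<delta>) / 2 * (1 + \<delta>) ^ nat (y - 1) + (1 - \<delta>) / 2 * (1 + \<delta>) ^ nat (y + 1)
      \<le> (1 - \<delta>\<^sup>2 / 2) * (1 + \<delta>) ^ nat y + (1 + \<delta>)" if "y > 0"
  proof -
    have "nat y = Suc (nat (y - 1))" "nat (y + 1) = Suc (Suc (nat (y - 1)))"
      using that by auto
    then show ?thesis using up[of "nat (y - 1)"] by simp
  qed
  show "(1 + \<delta>) / 2 * (1 + \<delta>) ^ nat (y + 1) + (1 - \<delta>) / 2 * (1 + \<delta>) ^ nat (y - 1)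
      \<le> (1 - \<delta>\<^sup>2 / 2) * (1 + \<delta>) ^ nat y + (1 + \<delta>)" if "y \<le> 0"
    using that zero flat by (cases "y = 0") auto
  show "(1 + \<delta>) / 2 * (1 + \<delta>) ^ nat (- (y - 1)) + (1 - \<delta>) / 2 * (1 + \<delta>) ^ nat (- (y + 1))
      \<le> (1 - \<delta>\<^sup>2 / 2) * (1 + \<delta>) ^ nat (- y) + (1 + \<delta>)" if "y > 0"
    using that flat by simp
  show "(1 + \<delta>) / 2 * (1 + \<delta>) ^ nat (- (y + 1)) + (1 - \<delta>) / 2 * (1 + \<delta>) ^ nat (- (y - 1))
      \<le> (1 - \<delta>\<^sup>2 / 2) * (1 + \<delta>) ^ nat (- y) + (1 + \<delta>)" if "y \<le> 0"
  proof (cases "y = 0")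
    case True
    then show ?thesis using zero by simp
  next
    case False
    then have "nat (- y) = Suc (nat (- (y + 1)))" "nat (- (y - 1)) = Suc (Suc (nat (- (y + 1))))"
      using that by auto
    then show ?thesis using up[of "nat (- (y + 1))"] by simp
  qed
qed

text \<open>The bound is affine in the two potentials, so the one-step estimate applies term by
  term. The step towards the target has probability \<open>(1 + \<delta>) / 2\<close>, and \<kappa>
  is the chance of a source.\<close>

lemma steer_bound_step:
  assumes "0 \<le> \<delta>" "\<delta> \<le> 1" "0 \<le> \<kappa>" "y' = (if y > 0 then y - 1 else y + 1)" "y'' = (if y > 0 then y + 1 else y - 1)"
  shows "(1 + \<delta>) / 2 * steer_bound \<delta> \<kappa> W\<^sub>1 W\<^sub>2 w k y' + (1 - \<delta>) / 2 * steer_bound \<delta> \<kappa> W\<^sub>1 W\<^sub>2 w k y'' + \<kappa>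
    \<le> steer_bound \<delta> \<kappa> W\<^sub>1 W\<^sub>2 w (Suc k) y"
proof -
  define z where "z = 1 + \<delta>"
  define \<rho> where "\<rho> = 1 - \<delta>\<^sup>2 / 2"
  define P where "P y = z ^ nat y" for y
  define Q where "Q y = z ^ nat (- y)" for y
  have z: "1 \<le> z" and \<rho>: "0 \<le> \<rho>" "\<rho> \<le> 1"
    using assms rate_bounds[of \<delta>] by (auto simp: z_def \<rho>_def)
  have PQ: "0 \<le> P y" "0 \<le> Q y"
    using z by (auto simp: P_def Q_def)
  define A where "A = z / 2 * P y' + (1 - \<delta>) / 2 * P y''"
  define B where "B = z / 2 * Q y' + (1 - \<delta>) / 2 * Q y''"
  have A: "A \<le> \<rho> * P y + z" and B: "B \<le> \<rho> * Q y + z"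
    using potential_step[OF assms(1,2), of y] assms(4,5)
    unfolding A_def B_def P_def Q_def z_def \<rho>_def by (auto split: if_splits)
  have A': "A \<le> P y + z" and B': "B \<le> Q y + z"
    using A B mult_right_mono[OF \<rho>(2) PQ(1)] mult_right_mono[OF \<rho>(2) PQ(2)] by auto
  have "\<rho> ^ k * (A + B) \<le> \<rho> ^ k * (\<rho> * P y + z + (\<rho> * Q y + z))"
    using A B \<rho> by (intro mult_left_mono) auto
  also have "\<dots> = \<rho> ^ Suc k * (P y + Q y) + \<rho> ^ k * (2 * z)"
    by (simp add: algebra_simps)
  also have "\<rho> ^ k * (2 * z) \<le> 1 * (2 * z)"
    using \<rho> z by (intro mult_right_mono power_le_one) auto
  finally have AB: "\<rho> ^ k * (A + B) \<le> \<rho> ^ Suc k * (P y + Q y) + 2 * z"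
    by simp
  have sum: "z / 2 + (1 - \<delta>) / 2 = 1"
    by (simp add: z_def field_simps)
  have lin: "z / 2 * ((p + m) / d) + (1 - \<delta>) / 2 * ((p' + m) / d)
      = (z / 2 * p + (1 - \<delta>) / 2 * p' + m) / d" for p p' m d :: real
  proof -
    have "z / 2 * ((p + m) / d) + (1 - \<delta>) / 2 * ((p' + m) / d)
      = (z / 2 * p + (1 - \<delta>) / 2 * p' + (z / 2 + (1 - \<delta>) / 2) * m) / d"
      by (simp add: add_divide_distrib algebra_simps)
    then show ?thesis by (simp only: sum) simp
  qed
  have lin': "z / 2 * m + (1 - \<delta>) / 2 * m = m" for m :: real
    unfolding distrib_right[symmetric] sum by simp
  have "z / 2 * steer_bound \<delta> \<kappa> W\<^sub>1 W\<^sub>2 w k y' + (1 - \<delta>) / 2 * steer_bound \<delta> \<kappa> W\<^sub>1 W\<^sub>2 w k y'' =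
     (z / 2 * ((P y' + k * z) / z ^ W\<^sub>2) + (1 - \<delta>) / 2 * ((P y'' + k * z) / z ^ W\<^sub>2)) +
     (z / 2 * ((Q y' + k * z) / z ^ W\<^sub>1) + (1 - \<delta>) / 2 * ((Q y'' + k * z) / z ^ W\<^sub>1)) +
     (z / 2 * ((\<rho> ^ k * (P y' + Q y') + 2 * k * z) / z ^ w)
       + (1 - \<delta>) / 2 * ((\<rho> ^ k * (P y'' + Q y'') + 2 * k * z) / z ^ w)) +
     (z / 2 * (k * \<kappa>) + (1 - \<delta>) / 2 * (k * \<kappa>))"
    unfolding steer_bound_def z_def[symmetric] \<rho>_def[symmetric] P_def Q_def
    by (simp only: distrib_left) simp
  also have "\<dots> = (A + k * z) / z ^ W\<^sub>2 + (B + k * z) / z ^ W\<^sub>1 +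
      (\<rho> ^ k * (A + B) + 2 * k * z) / z ^ w + k * \<kappa>"
    unfolding lin lin' A_def B_def by (simp add: algebra_simps)
  also have "\<dots> \<le> (P y + z + k * z) / z ^ W\<^sub>2 + (Q y + z + k * z) / z ^ W\<^sub>1 +
      (\<rho> ^ Suc k * (P y + Q y) + 2 * z + 2 * k * z) / z ^ w + k * \<kappa>"
    using A' B' AB z by (intro add_mono divide_right_mono) auto
  also have "\<dots> = steer_bound \<delta> \<kappa> W\<^sub>1 W\<^sub>2 w (Suc k) y - \<kappa>"
    unfolding steer_bound_def z_def[symmetric] \<rho>_def[symmetric] P_def Q_def
    by (simp add: algebra_simps)
  finally show ?thesis
    unfolding z_def by simp
qed

text \<open>Beyond a wall steering fails surely, and the wall terms are normalized so that the bound
  is then at least 1.\<close>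

lemma steer_bound_outside:
  assumes "0 < \<delta>" "\<delta> \<le> 1" "0 \<le> \<kappa>" "y > int W\<^sub>2 \<or> y < - int W\<^sub>1"
  shows "1 \<le> steer_bound \<delta> \<kappa> W\<^sub>1 W\<^sub>2 w k y"
proof -
  let ?z = "1 + \<delta>"
  have nn: "0 \<le> (?z ^ nat y + k * ?z) / ?z ^ W\<^sub>2" "0 \<le> (?z ^ nat (- y) + k * ?z) / ?z ^ W\<^sub>1"
    "0 \<le> ((1 - \<delta>\<^sup>2 / 2) ^ k * (?z ^ nat y + ?z ^ nat (- y)) + 2 * real k * ?z) / ?z ^ w" "0 \<le> k * \<kappa>"
    using assms rate_bounds(3)[of \<delta> k]
    by (auto intro!: add_nonneg_nonneg divide_nonneg_nonneg mult_nonneg_nonneg)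
  have "1 \<le> (?z ^ nat y + k * ?z) / ?z ^ W\<^sub>2 \<or> 1 \<le> (?z ^ nat (- y) + k * ?z) / ?z ^ W\<^sub>1"
  proof (cases "y > int W\<^sub>2")
    case True
    then have "?z ^ W\<^sub>2 \<le> ?z ^ nat y"
      using assms by (intro power_increasing) auto
    then have "?z ^ W\<^sub>2 \<le> ?z ^ nat y + k * ?z"
      using assms by (intro add_increasing2) auto
    then show ?thesis using assms by (simp add: le_divide_eq)
  next
    case False
    then have "?z ^ W\<^sub>1 \<le> ?z ^ nat (- y)"
      using assms by (intro power_increasing) auto
    then have "?z ^ W\<^sub>1 \<le> ?z ^ nat (- y) + k * ?z"
      using assms by (intro add_increasing2) auto
    then show ?thesis using assms by (simp add: le_divide_eq)
  qed
  then show ?thesis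
    using nn unfolding steer_bound_def by linarith
qed

lemma steer_bound_end:
  assumes "0 < \<delta>" "y > int w \<or> y < - int w"
  shows "1 \<le> steer_bound \<delta> \<kappa> W\<^sub>1 W\<^sub>2 w 0 y"
proof -
  let ?z = "1 + \<delta>"
  have "?z ^ w \<le> ?z ^ nat y \<or> ?z ^ w \<le> ?z ^ nat (- y)"
    using assms by (auto intro!: power_increasing)
  then have "?z ^ w \<le> ?z ^ nat y + ?z ^ nat (- y)"
    using assms by (auto intro: add_increasing add_increasing2)
  then have "1 \<le> (?z ^ nat y + ?z ^ nat (- y)) / ?z ^ w"
    using assms by (simp add: le_divide_eq)
  moreover have "0 \<le> ?z ^ nat y / ?z ^ W\<^sub>2" "0 \<le> ?z ^ nat (- y) / ?z ^ W\<^sub>1"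
    using assms by auto
  ultimately show ?thesis
    unfolding steer_bound_def by simp
qed

abbreviation aex :: "vertex set \<Rightarrow> real \<Rightarrow> real \<Rightarrow> ((vertex \<Rightarrow> arrows) \<Rightarrow> real) \<Rightarrow> real" where
  "aex \<Lambda> \<delta> \<epsilon> \<equiv> ex UNIV \<Lambda> (arrow_weight \<delta> \<epsilon>)"

text \<open>At a branching vertex the arrow towards \<open>c\<close> is followed. A particular
  strategy bounds the failure probability from above, and the strategy obeys the recursion of which
  \<open>steer_bound\<close> is a supersolution.\<close>

lemma steers_fail:
  assumes \<delta>: "0 < \<delta>" "\<delta> \<le> 1" "0 \<le> \<epsilon>" "\<epsilon> \<le> 1" and \<Lambda>: "finite \<Lambda>"
    and "v \<in> vertices" "strip (c - int W\<^sub>1) (c + int W\<^sub>2) (snd v) (snd v + int k) \<subseteq> \<Lambda>"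
  shows "aex \<Lambda> \<delta> \<epsilon> (\<lambda>X. of_bool (\<not> steers (c - int W\<^sub>1) (c + int W\<^sub>2) (c - int w) (c + int w) X k v))
    \<le> steer_bound \<delta> (\<delta> * \<epsilon>) W\<^sub>1 W\<^sub>2 w k (fst v - c)"
  using assms(6,7)
proof (induction k arbitrary: v)
  case 0
  show ?case
  proof (cases "fst v - c > int w \<or> fst v - c < - int w")
    case True
    have "aex \<Lambda> \<delta> \<epsilon> (\<lambda>X. of_bool (\<not> steers (c - int W\<^sub>1) (c + int W\<^sub>2) (c - int w) (c + int w) X 0 v))
        \<le> aex \<Lambda> \<delta> \<epsilon> (\<lambda>_. 1)"
      by (rule ex_mono) (use \<delta> arrow_weight_nonneg in auto)
    also have "\<dots> = 1"
      by (rule ex_const) (use \<Lambda> sum_arrow_weight in auto)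
    finally show ?thesis
      using steer_bound_end[OF \<delta>(1) True, of "\<delta> * \<epsilon>" W\<^sub>1 W\<^sub>2] by simp
  next
    case False
    then show ?thesis
      using steer_bound_nonneg[of \<delta> "\<delta> * \<epsilon>" W\<^sub>1 W\<^sub>2 w 0 "fst v - c"] \<delta> by auto
  qed
next
  case (Suc k)
  let ?R = "steers (c - int W\<^sub>1) (c + int W\<^sub>2) (c - int w) (c + int w)"
  let ?u = "steer_bound \<delta> (\<delta> * \<epsilon>) W\<^sub>1 W\<^sub>2 w"
  have nn: "0 \<le> arrow_weight \<delta> \<epsilon> a" for a
    using \<delta> by (intro arrow_weight_nonneg) auto
  have one: "aex \<Lambda> \<delta> \<epsilon> (\<lambda>X. of_bool (P X)) \<le> 1" for P
  proof -
    have "aex \<Lambda> \<delta> \<epsilon> (\<lambda>X. of_bool (P X)) \<le> aex \<Lambda> \<delta> \<epsilon> (\<lambda>_. 1)"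
      by (rule ex_mono) (use nn in auto)
    also have "\<dots> = 1"
      by (rule ex_const) (use \<Lambda> sum_arrow_weight in auto)
    finally show ?thesis .
  qed
  show ?case
  proof (cases "fst v - c > int W\<^sub>2 \<or> fst v - c < - int W\<^sub>1")
    case True
    then show ?thesis
      using one steer_bound_outside[OF \<delta>(1,2) _ True, of "\<delta> * \<epsilon>" w "Suc k"] \<delta>
      by (meson mult_nonneg_nonneg order_trans less_imp_le)
  next
    case False
    then have inside: "c - int W\<^sub>1 \<le> fst v" "fst v \<le> c + int W\<^sub>2"
      by auto
    then have v: "v \<in> \<Lambda>"
      using Suc.prems by (auto simp: strip_def)
    have IH: "aex \<Lambda> \<delta> \<epsilon> (\<lambda>X. of_bool (\<not> ?R X k (child b v))) \<le> ?u k (fst (child b v) - c)" for b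
      using Suc.prems by (intro Suc.IH) (auto simp: strip_def)
    have upd: "aex \<Lambda> \<delta> \<epsilon> (\<lambda>X. of_bool (\<not> ?R (X(v := a)) (Suc k) v)) \<le> ?u k (fst (child b v) - c)"
      if "a = Both_Arrows \<or> a = (if b then Left_Arrow else Right_Arrow)" for a b
    proof (rule order_trans[OF ex_mono[OF nn] IH])
      fix X :: "vertex \<Rightarrow> arrows"
      \<comment> \<open>Later steps read only levels above that of \<open>v\<close>, so redrawing
        the arrow at \<open>v\<close> does not affect them.\<close>
      have "?R (X(v := a)) k (child b v) = ?R X k (child b v)"
        by (rule steers_cong[where s = "snd v + 1" and t = "snd v + 1 + int k"])
          (use Suc.prems in \<open>auto simp: strip_def\<close>)
      moreover have "arrow (X(v := a)) v (child b v)"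
        using that by (auto simp: arrow_def child_def)
      ultimately have "?R X k (child b v) \<Longrightarrow> ?R (X(v := a)) (Suc k) v"
        using inside by (auto simp del: split_paired_Ex)
      then show "of_bool (\<not> ?R (X(v := a)) (Suc k) v) \<le> (of_bool (\<not> ?R X k (child b v)) :: real)"
        by auto
    qed
    define b where "b = (fst v - c > 0)"
    define y' where "y' = fst (child b v) - c"
    define y'' where "y'' = fst (child (\<not> b) v) - c"
    have y: "y' = (if fst v - c > 0 then fst v - c - 1 else fst v - c + 1)"
      "y'' = (if fst v - c > 0 then fst v - c + 1 else fst v - c - 1)"
      by (auto simp: y'_def y''_def b_def fst_child)
    have u0: "0 \<le> ?u k y'"
      using \<delta> by (intro steer_bound_nonneg) auto
    define F where "F a = aex \<Lambda> \<delta> \<epsilon> (\<lambda>X. of_bool (\<not> ?R (X(v := a)) (Suc k) v))" for a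
    have F: "F Both_Arrows \<le> ?u k y'" "F (if b then Left_Arrow else Right_Arrow) \<le> ?u k y'"
      "F (if b then Right_Arrow else Left_Arrow) \<le> ?u k y''" "F No_Arrow \<le> 1"
      using upd[of Both_Arrows b] upd[of "if b then Left_Arrow else Right_Arrow" b]
        upd[of "if b then Right_Arrow else Left_Arrow" "\<not> b"] one
      unfolding F_def y'_def y''_def by auto
    have "aex \<Lambda> \<delta> \<epsilon> (\<lambda>X. of_bool (\<not> ?R X (Suc k) v)) = (\<Sum>a\<in>UNIV. arrow_weight \<delta> \<epsilon> a * F a)"
      unfolding F_def by (rule ex_resample) (use \<Lambda> v sum_arrow_weight in auto)
    also have "\<dots> = (1 - \<delta>) / 2 * F (if b then Left_Arrow else Right_Arrow)
        + (1 - \<delta>) / 2 * F (if b then Right_Arrow else Left_Arrow)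
        + \<delta> * (1 - \<epsilon>) * F Both_Arrows + \<delta> * \<epsilon> * F No_Arrow"
      by (simp add: UNIV_arrows arrow_weight_def)
    also have "\<dots> \<le> (1 - \<delta>) / 2 * ?u k y' + (1 - \<delta>) / 2 * ?u k y'' + \<delta> * (1 - \<epsilon>) * ?u k y' + \<delta> * \<epsilon> * 1"
      using \<delta> F by (intro add_mono mult_left_mono) auto
    \<comment> \<open>Branching without deaths would give the step towards the target the weight
      \<open>(1 - \<delta>) / 2 + \<delta>\<close>. Adding the missing
      \<open>\<delta> * \<epsilon>\<close> times a nonnegative bound makes the two weights sum to
      1.\<close>
    also have "\<dots> \<le> (1 + \<delta>) / 2 * ?u k y' + (1 - \<delta>) / 2 * ?u k y'' + \<delta> * \<epsilon>"
    proof -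
      have "0 \<le> \<delta> * \<epsilon> * ?u k y'"
        using \<delta> u0 by auto
      then show ?thesis by (simp add: field_simps)
    qed
    also have "\<dots> \<le> ?u (Suc k) (fst v - c)"
      using \<delta> y by (intro steer_bound_step) auto
    finally show ?thesis .
  qed
qed

section \<open>Renormalization to boxes\<close>

text \<open>In the cell \<open>(i, j)\<close> of the coarse lattice, \<open>i\<close> counts steps to the left and \<open>j\<close> steps to the
  right. Its box is \<open>8w\<close> wide and \<open>h\<close> high; paths enter it close to the middle of its bottom.\<close>

definition box_center :: "nat \<Rightarrow> cell \<Rightarrow> int" where
  "box_center w c = (snd c - fst c) * (4 * int w)"

definition box_level :: "nat \<Rightarrow> cell \<Rightarrow> int" where
  "box_level h c = (fst c + snd c) * int h"

definition cell_box :: "nat \<Rightarrow> nat \<Rightarrow> cell \<Rightarrow> vertex set" where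
  "cell_box w h c = strip (box_center w c - 4 * int w) (box_center w c + 4 * int w - 1)
     (box_level h c) (box_level h c + int h)"

definition steers_right :: "nat \<Rightarrow> nat \<Rightarrow> cell \<Rightarrow> (vertex \<Rightarrow> arrows) \<Rightarrow> vertex \<Rightarrow> bool" where
  "steers_right w h c X = steers (box_center w c - 4 * int w) (box_center w c + 4 * int w - 1)
     (box_center w c + 2 * int w - 1) (box_center w c + 4 * int w - 1) X h"

definition steers_left :: "nat \<Rightarrow> nat \<Rightarrow> cell \<Rightarrow> (vertex \<Rightarrow> arrows) \<Rightarrow> vertex \<Rightarrow> bool" where
  "steers_left w h c X = steers (box_center w c - 4 * int w) (box_center w c + 4 * int w - 1)
     (box_center w c - 4 * int w) (box_center w c - 2 * int w) X h"

text \<open>Seen from the center of the next box, the target of a move to the left is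
  \<open>[0, 2 * w]\<close> and that of a move to the right is \<open>[- 2 * w - 1, - 1]\<close>.
  The difference stems from the excluded right edge of the box, and the margin
  \<open>2 * w + 1\<close> covers both.\<close>

definition entries :: "nat \<Rightarrow> nat \<Rightarrow> cell \<Rightarrow> vertex set" where
  "entries w h c = {v \<in> vertices. \<bar>fst v - box_center w c\<bar> \<le> 2 * int w + 1 \<and> snd v = box_level h c}"

definition good_cell :: "nat \<Rightarrow> nat \<Rightarrow> (vertex \<Rightarrow> arrows) \<Rightarrow> cell \<Rightarrow> bool" where
  "good_cell w h X c \<longleftrightarrow> (\<forall>v\<in>entries w h c. steers_right w h c X v \<and> steers_left w h c X v)"

lemma center_right: "box_center w (c + (0, 1)) = box_center w c + 4 * int w"
  and center_left: "box_center w (c + (1, 0)) = box_center w c - 4 * int w"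
  and level_right: "box_level h (c + (0, 1)) = box_level h c + int h"
  and level_left: "box_level h (c + (1, 0)) = box_level h c + int h"
  by (simp_all add: box_center_def box_level_def algebra_simps)

text \<open>From every entry point a good cell offers both moves, so the path can follow whichever
  successor continues the crossing.\<close>

lemma crosses_path:
  assumes "crosses (good_cell w h X) N c" "v \<in> entries w h c"
  shows "path_of_length X (N * h) v"
  using assms
proof (induction N arbitrary: c v)
  case (Suc N)
  have v: "v \<in> vertices" "snd v = box_level h c"
    using Suc.prems by (auto simp: entries_def)
  have good: "steers_right w h c X v" "steers_left w h c X v"
    using Suc.prems by (auto simp: good_cell_def)
  have "crosses (good_cell w h X) N (c + (1, 0)) \<or> crosses (good_cell w h X) N (c + (0, 1))"
    using Suc.prems by simp
  then show ?case
  proof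
    assume cr: "crosses (good_cell w h X) N (c + (1, 0))"
    obtain u where u: "u \<in> vertices" "box_center w c - 4 * int w \<le> fst u" "fst u \<le> box_center w c - 2 * int w"
      "snd u = snd v + int h" "\<And>m. path_of_length X m u \<Longrightarrow> path_of_length X (h + m) v"
      using steers_path[OF good(2)[unfolded steers_left_def] v(1)] by blast
    then have "u \<in> entries w h (c + (1, 0))"
      using v by (auto simp: entries_def center_left level_left)
    then show ?case
      using u(5)[OF Suc.IH[OF cr]] by simp
  next
    assume cr: "crosses (good_cell w h X) N (c + (0, 1))"
    obtain u where u: "u \<in> vertices" "box_center w c + 2 * int w - 1 \<le> fst u" "fst u \<le> box_center w c + 4 * int w - 1"
      "snd u = snd v + int h" "\<And>m. path_of_length X m u \<Longrightarrow> path_of_length X (h + m) v"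
      using steers_path[OF good(1)[unfolded steers_right_def] v(1)] by blast
    then have "u \<in> entries w h (c + (0, 1))"
      using v by (auto simp: entries_def center_right level_right)
    then show ?case
      using u(5)[OF Suc.IH[OF cr]] by simp
  qed
qed simp

text \<open>On one level of the coarse lattice the difference of coordinates has fixed parity, so
  centers of distinct cells are at least \<open>8 * w\<close> apart, the width of a box.\<close>

lemma disjoint_cell_boxes:
  assumes "0 < w" "0 < h"
  shows "disjoint_family (cell_box w h)"
  unfolding disjoint_family_on_def
proof (intro ballI impI)
  fix c d :: cell assume ne: "c \<noteq> d"
  show "cell_box w h c \<inter> cell_box w h d = {}"
  proof (rule ccontr)
    assume "cell_box w h c \<inter> cell_box w h d \<noteq> {}"
    then obtain v where v: "v \<in> cell_box w h c" "v \<in> cell_box w h d"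
      by blast
    have lev: "fst c + snd c \<le> fst d + snd d" if "v \<in> cell_box w h c" "v \<in> cell_box w h d" for c d
    proof (rule ccontr)
      assume "\<not> ?thesis"
      then have "(fst d + snd d + 1) * int h \<le> (fst c + snd c) * int h"
        by (intro mult_right_mono) auto
      then show False
        using that by (auto simp: cell_box_def strip_def box_level_def distrib_right)
    qed
    have m: "fst c + snd c = fst d + snd d"
      using lev v by (meson antisym)
    have cen: "snd c - fst c < snd d - fst d + 2" if "v \<in> cell_box w h c" "v \<in> cell_box w h d" for c d
    proof (rule ccontr)
      assume "\<not> ?thesis"
      then have "(snd d - fst d + 2) * (4 * int w) \<le> (snd c - fst c) * (4 * int w)"
        by (intro mult_right_mono) auto
      then show False
        using that by (auto simp: cell_box_def strip_def box_center_def distrib_right)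
    qed
    have "\<bar>(snd c - fst c) - (snd d - fst d)\<bar> < 2"
      using cen[OF v] cen[OF v(2,1)] by linarith
    moreover have "(snd c - fst c) - (snd d - fst d) = 2 * (snd c - snd d)"
      using m by simp
    ultimately have "\<bar>2 * (snd c - snd d)\<bar> < 2"
      by simp
    then have "snd c = snd d"
      by (simp add: abs_if split: if_splits)
    then show False
      using m ne by (simp add: prod_eq_iff)
  qed
qed

lemma entries_cell_box_cong:
  assumes "\<And>u. u \<in> cell_box w h c \<Longrightarrow> X u = X' u"
  shows "good_cell w h X c = good_cell w h X' c"
proof -
  have "steers_right w h c X v = steers_right w h c X' v \<and> steers_left w h c X v = steers_left w h c X' v"
    if "v \<in> entries w h c" for v
    unfolding steers_right_def steers_left_def
    by (intro conjI; rule steers_cong[OF assms[unfolded cell_box_def]])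
      (use that in \<open>auto simp: entries_def\<close>)
  then show ?thesis
    unfolding good_cell_def by blast
qed

definition exit_bound :: "real \<Rightarrow> real \<Rightarrow> nat \<Rightarrow> nat \<Rightarrow> real" where
  "exit_bound \<delta> \<kappa> w h = (4 + 4 * real h * (1 + \<delta>)) / (1 + \<delta>) ^ w + real h * \<kappa>"

text \<open>The start and the near wall are on opposite sides of the target center, so the potential
  for that wall is 1. The far wall is at least \<open>7 * w - 1 - (5 * w + 1) = 2 * w - 2\<close>
  beyond the start, and this is at least \<open>w\<close>. The condition on \<open>h\<close> lets
  the contraction outweigh any initial displacement, which is at most \<open>6 * w\<close>.\<close>

lemma steer_bound_le_exit_bound:
  assumes \<delta>: "0 < \<delta>" "\<delta> \<le> 1" and w: "2 \<le> w" and h: "(1 - \<delta>\<^sup>2 / 2) ^ h * (1 + \<delta>) ^ (6 * w) \<le> 1"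
    and y: "(W\<^sub>1 = 7 * w - 1 \<and> W\<^sub>2 = w \<and> y \<le> 0 \<and> - 5 * int w \<le> y) \<or>
      (W\<^sub>1 = w \<and> W\<^sub>2 = 7 * w - 1 \<and> 0 \<le> y \<and> y \<le> 5 * int w + 1)"
  shows "steer_bound \<delta> \<kappa> W\<^sub>1 W\<^sub>2 w h y \<le> exit_bound \<delta> \<kappa> w h"
proof -
  define z where "z = 1 + \<delta>"
  have z: "1 \<le> z" "0 < z" using \<delta> by (simp_all add: z_def)
  have side: "(z ^ m + h * z) / z ^ W \<le> (1 + h * z) / z ^ w"
    if "(m = 0 \<and> W = w) \<or> (W = 7 * w - 1 \<and> m \<le> 5 * w + 1)" for m W
    using that
  proof
    assume *: "W = 7 * w - 1 \<and> m \<le> 5 * w + 1"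
    have "z ^ m * z ^ w \<le> 1 * z ^ W"
      unfolding power_add[symmetric] mult_1 using * w z by (intro power_increasing) auto
    moreover have "h * z * z ^ w \<le> h * z * z ^ W"
      using * w z by (intro mult_left_mono power_increasing) auto
    ultimately have "(z ^ m + h * z) * z ^ w \<le> (1 + h * z) * z ^ W"
      by (simp add: distrib_right)
    then show ?thesis
      by (simp only: pos_divide_le_eq[OF zero_less_power[OF z(2)]] times_divide_eq_left
          pos_le_divide_eq[OF zero_less_power[OF z(2)]])
  qed simp
  have e: "(1 - \<delta>\<^sup>2 / 2) ^ h * z ^ m \<le> 1" if "m \<le> 6 * w" for m
  proof -
    have "(1 - \<delta>\<^sup>2 / 2) ^ h * z ^ m \<le> (1 - \<delta>\<^sup>2 / 2) ^ h * z ^ (6 * w)"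
      using that z rate_bounds(3)[of \<delta> h] \<delta> by (intro mult_left_mono power_increasing) auto
    then show ?thesis using h by (simp add: z_def)
  qed
  have "nat y \<le> 6 * w" "nat (- y) \<le> 6 * w"
    using y w by auto
  then have "(1 - \<delta>\<^sup>2 / 2) ^ h * (z ^ nat y + z ^ nat (- y)) + 2 * real h * z \<le> 2 + 2 * real h * z"
    using e[of "nat y"] e[of "nat (- y)"] by (simp add: distrib_left)
  then have "((1 - \<delta>\<^sup>2 / 2) ^ h * (z ^ nat y + z ^ nat (- y)) + 2 * real h * z) / z ^ w \<le> (2 + 2 * real h * z) / z ^ w"
    using z by (intro divide_right_mono) auto
  moreover have "(z ^ nat y + h * z) / z ^ W\<^sub>2 \<le> (1 + h * z) / z ^ w"
    by (rule side) (use y in auto)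
  moreover have "(z ^ nat (- y) + h * z) / z ^ W\<^sub>1 \<le> (1 + h * z) / z ^ w"
    by (rule side) (use y in auto)
  moreover have "(1 + h * z) / z ^ w + (1 + h * z) / z ^ w + (2 + 2 * real h * z) / z ^ w = (4 + 4 * real h * z) / z ^ w"
    by (simp add: add_divide_distrib[symmetric])
  ultimately have "(z ^ nat y + h * z) / z ^ W\<^sub>2 + (z ^ nat (- y) + h * z) / z ^ W\<^sub>1
      + ((1 - \<delta>\<^sup>2 / 2) ^ h * (z ^ nat y + z ^ nat (- y)) + 2 * real h * z) / z ^ w \<le> (4 + 4 * real h * z) / z ^ w"
    by (metis add_mono)
  then show ?thesis
    unfolding steer_bound_def exit_bound_def z_def[symmetric] by (rule add_right_mono)
qed

lemma bad_cell:
  assumes \<delta>: "0 < \<delta>" "\<delta> \<le> 1" "0 \<le> \<epsilon>" "\<epsilon> \<le> 1" and \<Lambda>: "finite \<Lambda>" "cell_box w h c \<subseteq> \<Lambda>"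
    and w: "2 \<le> w" and h: "(1 - \<delta>\<^sup>2 / 2) ^ h * (1 + \<delta>) ^ (6 * w) \<le> 1"
  shows "aex \<Lambda> \<delta> \<epsilon> (\<lambda>X. of_bool (\<not> good_cell w h X c)) \<le> real (4 * w + 3) * (2 * exit_bound \<delta> (\<delta> * \<epsilon>) w h)"
proof -
  have nn: "0 \<le> arrow_weight \<delta> \<epsilon> a" for a
    using \<delta> by (intro arrow_weight_nonneg) auto
  define m where "m = box_center w c"
  have sub: "entries w h c \<subseteq> {m - (2 * int w + 1)..m + (2 * int w + 1)} \<times> {box_level h c}"
    by (auto simp: entries_def m_def)
  have fin: "finite (entries w h c)"
    by (rule finite_subset[OF sub]) simp
  have "card (entries w h c) \<le> card ({m - (2 * int w + 1)..m + (2 * int w + 1)} \<times> {box_level h c})"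
    by (rule card_mono[OF _ sub]) simp
  also have "\<dots> = 4 * w + 3"
    by (simp add: card_cartesian_product)
  finally have card: "card (entries w h c) \<le> 4 * w + 3" .
  have fail: "aex \<Lambda> \<delta> \<epsilon> (\<lambda>X. of_bool (\<not> steers_right w h c X v)) \<le> exit_bound \<delta> (\<delta> * \<epsilon>) w h"
    "aex \<Lambda> \<delta> \<epsilon> (\<lambda>X. of_bool (\<not> steers_left w h c X v)) \<le> exit_bound \<delta> (\<delta> * \<epsilon>) w h"
    if v: "v \<in> entries w h c" for v
  proof -
    have v': "v \<in> vertices" "snd v = box_level h c" "\<bar>fst v - m\<bar> \<le> 2 * int w + 1"
      using v by (auto simp: entries_def m_def)
    have W: "int (7 * w - 1) = 7 * int w - 1"
      using w by auto
    \<comment> \<open>The targets have half-width \<open>w\<close> and end at a side wall: the right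
      one is centered at \<open>m + 3 * w - 1\<close>, the left one below at
      \<open>m - 3 * w\<close>.\<close>
    have "aex \<Lambda> \<delta> \<epsilon> (\<lambda>X. of_bool (\<not> steers (m + 3 * int w - 1 - int (7 * w - 1)) (m + 3 * int w - 1 + int w)
          (m + 3 * int w - 1 - int w) (m + 3 * int w - 1 + int w) X h v))
        \<le> steer_bound \<delta> (\<delta> * \<epsilon>) (7 * w - 1) w w h (fst v - (m + 3 * int w - 1))"
    proof (rule steers_fail[OF \<delta> \<Lambda>(1) v'(1)])
      have "strip (m + 3 * int w - 1 - int (7 * w - 1)) (m + 3 * int w - 1 + int w) (snd v) (snd v + int h) = cell_box w h c"
        unfolding cell_box_def m_def W v'(2) by (simp add: algebra_simps)
      then show "strip (m + 3 * int w - 1 - int (7 * w - 1)) (m + 3 * int w - 1 + int w) (snd v) (snd v + int h) \<subseteq> \<Lambda>"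
        using \<Lambda>(2) by simp
    qed
    also have "\<dots> \<le> exit_bound \<delta> (\<delta> * \<epsilon>) w h"
      using v' w by (intro steer_bound_le_exit_bound \<delta> w h) auto
    finally show "aex \<Lambda> \<delta> \<epsilon> (\<lambda>X. of_bool (\<not> steers_right w h c X v)) \<le> exit_bound \<delta> (\<delta> * \<epsilon>) w h"
      unfolding steers_right_def m_def[symmetric] W by (simp add: algebra_simps)
    have "aex \<Lambda> \<delta> \<epsilon> (\<lambda>X. of_bool (\<not> steers (m - 3 * int w - int w) (m - 3 * int w + int (7 * w - 1))
          (m - 3 * int w - int w) (m - 3 * int w + int w) X h v))
        \<le> steer_bound \<delta> (\<delta> * \<epsilon>) w (7 * w - 1) w h (fst v - (m - 3 * int w))"
    proof (rule steers_fail[OF \<delta> \<Lambda>(1) v'(1)])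
      have "strip (m - 3 * int w - int w) (m - 3 * int w + int (7 * w - 1)) (snd v) (snd v + int h) = cell_box w h c"
        unfolding cell_box_def m_def W v'(2) by (simp add: algebra_simps)
      then show "strip (m - 3 * int w - int w) (m - 3 * int w + int (7 * w - 1)) (snd v) (snd v + int h) \<subseteq> \<Lambda>"
        using \<Lambda>(2) by simp
    qed
    also have "\<dots> \<le> exit_bound \<delta> (\<delta> * \<epsilon>) w h"
      using v' w by (intro steer_bound_le_exit_bound \<delta> w h) auto
    finally show "aex \<Lambda> \<delta> \<epsilon> (\<lambda>X. of_bool (\<not> steers_left w h c X v)) \<le> exit_bound \<delta> (\<delta> * \<epsilon>) w h"
      unfolding steers_left_def m_def[symmetric] W by (simp add: algebra_simps)
  qed
  have "aex \<Lambda> \<delta> \<epsilon> (\<lambda>X. of_bool (\<not> good_cell w h X c)) \<le>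
      aex \<Lambda> \<delta> \<epsilon> (\<lambda>X. \<Sum>v\<in>entries w h c. of_bool (\<not> steers_right w h c X v) + of_bool (\<not> steers_left w h c X v))"
  proof (rule ex_mono[OF nn])
    fix X :: "vertex \<Rightarrow> arrows"
    let ?g = "\<lambda>v. of_bool (\<not> steers_right w h c X v) + of_bool (\<not> steers_left w h c X v) :: real"
    show "of_bool (\<not> good_cell w h X c) \<le> (\<Sum>v\<in>entries w h c. ?g v)"
    proof (cases "good_cell w h X c")
      case True
      then show ?thesis by (auto intro!: sum_nonneg)
    next
      case False
      then obtain v where v: "v \<in> entries w h c" "\<not> steers_right w h c X v \<or> \<not> steers_left w h c X v"
        by (auto simp: good_cell_def)
      then have "1 \<le> ?g v" by auto
      also have "\<dots> \<le> (\<Sum>v\<in>entries w h c. ?g v)"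
        by (rule member_le_sum[OF v(1) _ fin]) auto
      finally show ?thesis using False by simp
    qed
  qed
  also have "\<dots> = (\<Sum>v\<in>entries w h c. aex \<Lambda> \<delta> \<epsilon> (\<lambda>X. of_bool (\<not> steers_right w h c X v))
      + aex \<Lambda> \<delta> \<epsilon> (\<lambda>X. of_bool (\<not> steers_left w h c X v)))"
    by (simp only: ex_add ex_sum)
  also have "\<dots> \<le> (\<Sum>v\<in>entries w h c. 2 * exit_bound \<delta> (\<delta> * \<epsilon>) w h)"
    using fail by (intro sum_mono) fastforce
  also have "\<dots> \<le> real (4 * w + 3) * (2 * exit_bound \<delta> (\<delta> * \<epsilon>) w h)"
    using card \<delta> by (auto intro!: mult_right_mono simp: exit_bound_def simp del: of_nat_add of_nat_mult)
  finally show ?thesis .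
qed

text \<open>The order of choice matters. The height is a fixed multiple of \<open>w\<close>, large
  enough for the contraction. Then \<open>w\<close> is taken so large that exits through the walls
  and missed targets are rare even after multiplying by the number of entries. Last comes
  \<open>\<epsilon>\<^sub>0\<close>, chosen against the now fixed \<open>w\<close> and
  \<open>h\<close>, so that deaths inside a box are rare as well.\<close>

lemma good_parameters:
  fixes \<delta> :: real
  assumes "0 < \<delta>" "\<delta> \<le> 1"
  shows "\<exists>w h \<epsilon>\<^sub>0. 2 \<le> w \<and> 0 < h \<and> even h \<and> 0 < \<epsilon>\<^sub>0 \<and> \<epsilon>\<^sub>0 \<le> 1 \<and> (1 - \<delta>\<^sup>2 / 2) ^ h * (1 + \<delta>) ^ (6 * w) \<le> 1 \<and>
    (\<forall>\<epsilon>\<in>{0..\<epsilon>\<^sub>0}. real (4 * w + 3) * (2 * exit_bound \<delta> (\<delta> * \<epsilon>) w h) \<le> (1 / 16) ^ 4)"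
proof -
  define z where "z = 1 + \<delta>"
  define \<rho> where "\<rho> = 1 - \<delta>\<^sup>2 / 2"
  have z: "1 < z" using assms by (simp add: z_def)
  have \<rho>: "0 \<le> \<rho>" "\<rho> < 1" using rate_bounds[of \<delta>] assms by (auto simp: \<rho>_def)
  have "(\<lambda>n. \<rho> ^ n) \<longlonglongrightarrow> 0"
    using \<rho> by (intro LIMSEQ_power_zero) auto
  then have "\<forall>\<^sub>F n in sequentially. \<rho> ^ n < 1 / z ^ 6"
    using z by (intro order_tendstoD) auto
  then have "\<forall>\<^sub>F n in sequentially. \<rho> ^ n < 1 / z ^ 6 \<and> 0 < n"
    using eventually_gt_at_top[of 0] by (rule eventually_conj)
  from eventually_happens'[OF sequentially_bot this]
  obtain g where g: "g > 0" "\<rho> ^ g < 1 / z ^ 6"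
    by blast
  define H where "H w = 2 * g * w" for w :: nat
  have H: "\<rho> ^ H w * z ^ (6 * w) \<le> 1" for w
  proof -
    have "\<rho> ^ H w \<le> \<rho> ^ (g * w)"
      using \<rho> by (intro power_decreasing) (auto simp: H_def)
    then have "\<rho> ^ H w * z ^ (6 * w) \<le> \<rho> ^ (g * w) * z ^ (6 * w)"
      using z by (intro mult_right_mono) auto
    also have "\<dots> = (\<rho> ^ g * z ^ 6) ^ w"
      by (simp add: power_mult power_mult_distrib)
    also have "\<dots> \<le> 1"
      using g z \<rho> by (intro power_le_one) (auto simp: less_divide_eq)
    finally show ?thesis .
  qed
  \<comment> \<open>From \<open>2 * (4 * w + 3) \<le> 14 * w\<close> and
    \<open>h = 2 * g * w\<close>.\<close>
  define C where "C = 14 * (4 + 8 * g * z)"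
  \<comment> \<open>The square root splits \<open>w * w / z ^ w\<close> into two equal factors
    \<open>w * y ^ w\<close>, each tending to 0.\<close>
  define y where "y = sqrt (1 / z)"
  have y: "0 < y" "y < 1" "y * y = 1 / z"
    using z by (auto simp: y_def real_sqrt_lt_1_iff)
  have "(\<lambda>n. of_nat n * y ^ n) \<longlonglongrightarrow> 0"
    using y by (intro powser_times_n_limit_0) auto
  then have "(\<lambda>n. C * ((of_nat n * y ^ n) * (of_nat n * y ^ n))) \<longlonglongrightarrow> C * (0 * 0)"
    by (intro tendsto_intros)
  then have "\<forall>\<^sub>F n in sequentially. C * ((of_nat n * y ^ n) * (of_nat n * y ^ n)) < (1 / 16) ^ 4 / 2"
    by (intro order_tendstoD) auto
  then have "\<forall>\<^sub>F n in sequentially. C * ((of_nat n * y ^ n) * (of_nat n * y ^ n)) < (1 / 16) ^ 4 / 2 \<and> 2 \<le> n"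
    using eventually_ge_at_top[of 2] by (rule eventually_conj)
  from eventually_happens'[OF sequentially_bot this]
  obtain w where w: "C * ((of_nat w * y ^ w) * (of_nat w * y ^ w)) < (1 / 16) ^ 4 / 2" "2 \<le> w"
    by blast
  define h where "h = H w"
  have h: "0 < h" "even h" using g w by (auto simp: h_def H_def)
  have yw: "(of_nat w * y ^ w) * (of_nat w * y ^ w) = real w * real w / z ^ w"
  proof -
    have "y ^ w * y ^ w = 1 / z ^ w"
      using y by (simp add: power_mult_distrib[symmetric] power_divide)
    then show ?thesis by (simp add: mult.assoc mult.left_commute)
  qed
  have "real (4 * w + 3) * (2 * (4 + 4 * real h * z)) \<le> C * (real w * real w)"
  proof -
    have "real (4 * w + 3) * 2 \<le> 14 * real w"
      using w by simp
    moreover have "4 + 4 * real h * z \<le> (4 + 8 * g * z) * real w"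
    proof -
      have "4 * real h * z = 8 * g * z * real w"
        by (simp add: h_def H_def)
      moreover have "(4 + 8 * g * z) * real w = 4 * real w + 8 * g * z * real w"
        by (rule distrib_right)
      moreover have "2 \<le> real w"
        using w by simp
      ultimately show ?thesis
        by linarith
    qed
    ultimately have "real (4 * w + 3) * 2 * (4 + 4 * real h * z) \<le> 14 * real w * ((4 + 8 * g * z) * real w)"
      by (rule mult_mono) (use z in auto)
    then show ?thesis
      by (simp only: C_def mult_ac)
  qed
  then have *: "real (4 * w + 3) * (2 * (4 + 4 * real h * z)) / z ^ w \<le> C * (real w * real w) / z ^ w"
    using z by (intro divide_right_mono) auto
  then have main: "real (4 * w + 3) * (2 * ((4 + 4 * real h * z) / z ^ w)) \<le> (1 / 16) ^ 4 / 2"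
  proof -
    have "C * (real w * real w) / z ^ w < (1 / 16) ^ 4 / 2"
      using w(1) unfolding yw by simp
    moreover have "real (4 * w + 3) * (2 * ((4 + 4 * real h * z) / z ^ w))
        = real (4 * w + 3) * (2 * (4 + 4 * real h * z)) / z ^ w"
      by simp
    ultimately show ?thesis
      using * by linarith
  qed
  define D where "D = real (4 * w + 3) * (2 * real h)"
  have D: "0 < D" using h by (simp add: D_def)
  define \<epsilon>\<^sub>0 where "\<epsilon>\<^sub>0 = min 1 ((1 / 16) ^ 4 / 2 / D)"
  have \<epsilon>\<^sub>0: "0 < \<epsilon>\<^sub>0" "\<epsilon>\<^sub>0 \<le> 1"
    using D by (auto simp: \<epsilon>\<^sub>0_def)
  have small: "real (4 * w + 3) * (2 * (real h * (\<delta> * \<epsilon>))) \<le> (1 / 16) ^ 4 / 2" if "\<epsilon> \<in> {0..\<epsilon>\<^sub>0}" for \<epsilon>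
  proof -
    have "\<epsilon> \<le> (1 / 16) ^ 4 / 2 / D"
      using that by (simp add: \<epsilon>\<^sub>0_def)
    then have "D * \<epsilon> \<le> (1 / 16) ^ 4 / 2"
      using D by (simp only: le_divide_eq) (simp add: mult.commute)
    moreover have "\<delta> * (D * \<epsilon>) \<le> 1 * (D * \<epsilon>)"
      using assms that D by (intro mult_right_mono) auto
    ultimately have "\<delta> * (D * \<epsilon>) \<le> (1 / 16) ^ 4 / 2"
      by linarith
    then show ?thesis
      by (simp only: D_def mult_ac)
  qed
  have "real (4 * w + 3) * (2 * exit_bound \<delta> (\<delta> * \<epsilon>) w h) \<le> (1 / 16) ^ 4" if "\<epsilon> \<in> {0..\<epsilon>\<^sub>0}" for \<epsilon>
  proof -
    have "real (4 * w + 3) * (2 * exit_bound \<delta> (\<delta> * \<epsilon>) w h)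
      = real (4 * w + 3) * (2 * ((4 + 4 * real h * z) / z ^ w)) + real (4 * w + 3) * (2 * (real h * (\<delta> * \<epsilon>)))"
      unfolding exit_bound_def z_def[symmetric] by (simp only: distrib_left)
    then show ?thesis
      using main small[OF that] by linarith
  qed
  then show ?thesis
    using w h \<epsilon>\<^sub>0 H[of w] unfolding h_def[symmetric] z_def \<rho>_def by blast
qed

text \<open>\<open>\<Lambda>\<^sub>0\<close> is the union of the boxes of the triangle. The bound is
  stated for all larger finite sets so that the cone of the path event can be added later.\<close>

lemma survival_prob_bound:
  fixes \<delta> :: real
  assumes "0 < \<delta>" "\<delta> \<le> 1"
  shows "\<exists>\<epsilon>\<^sub>0>0. \<exists>h>0. \<epsilon>\<^sub>0 \<le> 1 \<and> (\<forall>\<epsilon>\<in>{0..\<epsilon>\<^sub>0}. \<forall>N. \<exists>\<Lambda>\<^sub>0. finite \<Lambda>\<^sub>0 \<and> \<Lambda>\<^sub>0 \<subseteq> vertices \<and>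
    (\<forall>\<Lambda>. finite \<Lambda> \<longrightarrow> \<Lambda>\<^sub>0 \<subseteq> \<Lambda> \<longrightarrow> aex \<Lambda> \<delta> \<epsilon> (\<lambda>X. of_bool (\<not> path_of_length X (N * h) (0, 0))) \<le> 1 / 2))"
proof -
  obtain w h \<epsilon>\<^sub>0 where p: "2 \<le> w" "0 < h" "0 < \<epsilon>\<^sub>0" "\<epsilon>\<^sub>0 \<le> 1" "(1 - \<delta>\<^sup>2 / 2) ^ h * (1 + \<delta>) ^ (6 * w) \<le> 1"
    "\<And>\<epsilon>. \<epsilon> \<in> {0..\<epsilon>\<^sub>0} \<Longrightarrow> real (4 * w + 3) * (2 * exit_bound \<delta> (\<delta> * \<epsilon>) w h) \<le> (1 / 16) ^ 4"
    using good_parameters[OF assms] by blast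
  have "aex \<Lambda> \<delta> \<epsilon> (\<lambda>X. of_bool (\<not> path_of_length X (N * h) (0, 0))) \<le> 1 / 2"
    if "\<epsilon> \<in> {0..\<epsilon>\<^sub>0}" "finite \<Lambda>" "(\<Union>c\<in>coarse_triangle N. cell_box w h c) \<subseteq> \<Lambda>" for \<epsilon> N \<Lambda>
  proof -
    have nn: "0 \<le> arrow_weight \<delta> \<epsilon> a" for a
      using assms that p by (intro arrow_weight_nonneg) auto
    have "(0, 0) \<in> entries w h (0, 0)"
      by (simp add: entries_def box_center_def box_level_def vertices_def)
    then have "aex \<Lambda> \<delta> \<epsilon> (\<lambda>X. of_bool (\<not> path_of_length X (N * h) (0, 0)))
        \<le> aex \<Lambda> \<delta> \<epsilon> (\<lambda>X. of_bool (\<not> crosses (good_cell w h X) N (0, 0)))"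
      using crosses_path by (intro ex_mono[OF nn]) (auto simp: of_bool_def)
    also have "\<dots> \<le> 1 / 2"
    proof (rule peierls[where B = "cell_box w h"])
      show "cell_box w h c \<subseteq> \<Lambda>" if "c \<in> coarse_triangle N" for c
        using that \<open>(\<Union>c\<in>coarse_triangle N. cell_box w h c) \<subseteq> \<Lambda>\<close> by blast
      show "disjoint_family_on (cell_box w h) (coarse_triangle N)"
        by (rule disjoint_family_on_mono[OF subset_UNIV disjoint_cell_boxes]) (use p in auto)
      show "good_cell w h f c = good_cell w h g c" if "\<And>i. i \<in> cell_box w h c \<Longrightarrow> f i = g i" for c f g
        using that by (rule entries_cell_box_cong)
      show "aex \<Lambda> \<delta> \<epsilon> (\<lambda>f. of_bool (\<not> good_cell w h f c)) \<le> (1 / 16) ^ 4" if "c \<in> coarse_triangle N" for c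
        using that \<open>\<epsilon> \<in> {0..\<epsilon>\<^sub>0}\<close> \<open>finite \<Lambda>\<close> \<open>(\<Union>c\<in>coarse_triangle N. cell_box w h c) \<subseteq> \<Lambda>\<close> assms p
        by (intro order_trans[OF bad_cell p(6)]) auto
    qed (use nn that sum_arrow_weight in auto)
    finally show ?thesis .
  qed
  moreover have "finite (\<Union>c\<in>coarse_triangle N. cell_box w h c)" "(\<Union>c\<in>coarse_triangle N. cell_box w h c) \<subseteq> vertices" for N
    by (auto simp: cell_box_def finite_strip) (auto simp: strip_def)
  ultimately have "\<exists>\<Lambda>\<^sub>0. finite \<Lambda>\<^sub>0 \<and> \<Lambda>\<^sub>0 \<subseteq> vertices \<and>
      (\<forall>\<Lambda>. finite \<Lambda> \<longrightarrow> \<Lambda>\<^sub>0 \<subseteq> \<Lambda> \<longrightarrow> aex \<Lambda> \<delta> \<epsilon> (\<lambda>X. of_bool (\<not> path_of_length X (N * h) (0, 0))) \<le> 1 / 2)"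
    if "\<epsilon> \<in> {0..\<epsilon>\<^sub>0}" for \<epsilon> N
    using that by (intro exI[of _ "\<Union>c\<in>coarse_triangle N. cell_box w h c"]) simp
  then show ?thesis
    using p(2-4) by blast
qed

section \<open>Finite-dimensional events\<close>

lemma prob_space_arrow_measure: "prob_space (arrow_measure \<delta> \<epsilon>)"
  unfolding arrow_measure_def by (intro prob_space_PiM prob_space_measure_pmf)

lemma prob_space_color_measure: "q \<ge> 1 \<Longrightarrow> prob_space (color_measure q)"
  unfolding color_measure_def by (intro prob_space_PiM prob_space_uniform_count_measure) auto

lemma emeasure_cylinder:
  assumes "prob_space N" "\<Lambda> \<subseteq> I" "finite \<Lambda>" "\<And>i. i \<in> \<Lambda> \<Longrightarrow> {g i} \<in> sets N"
  shows "{f \<in> space (\<Pi>\<^sub>M i\<in>I. N). \<forall>i\<in>\<Lambda>. f i = g i} \<in> sets (\<Pi>\<^sub>M i\<in>I. N)"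
    and "emeasure (\<Pi>\<^sub>M i\<in>I. N) {f \<in> space (\<Pi>\<^sub>M i\<in>I. N). \<forall>i\<in>\<Lambda>. f i = g i} = (\<Prod>i\<in>\<Lambda>. emeasure N {g i})"
proof -
  have eq: "{f \<in> space (\<Pi>\<^sub>M i\<in>I. N). \<forall>i\<in>\<Lambda>. f i = g i} = prod_emb I (\<lambda>_. N) \<Lambda> (PiE \<Lambda> (\<lambda>i. {g i}))"
    by (auto simp: prod_emb_def space_PiM PiE_iff extensional_def)
  show "{f \<in> space (\<Pi>\<^sub>M i\<in>I. N). \<forall>i\<in>\<Lambda>. f i = g i} \<in> sets (\<Pi>\<^sub>M i\<in>I. N)"
    unfolding eq using assms by (intro sets_PiM_I) auto
  show "emeasure (\<Pi>\<^sub>M i\<in>I. N) {f \<in> space (\<Pi>\<^sub>M i\<in>I. N). \<forall>i\<in>\<Lambda>. f i = g i} = (\<Prod>i\<in>\<Lambda>. emeasure N {g i})"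
    unfolding eq using assms by (intro emeasure_PiM_emb) auto
qed

definition arrow_cylinder :: "real \<Rightarrow> real \<Rightarrow> vertex set \<Rightarrow> (vertex \<Rightarrow> arrows) \<Rightarrow> (vertex \<Rightarrow> arrows) set" where
  "arrow_cylinder \<delta> \<epsilon> \<Lambda> g = {f \<in> space (arrow_measure \<delta> \<epsilon>). \<forall>i\<in>\<Lambda>. f i = g i}"

definition color_cylinder :: "nat \<Rightarrow> vertex set \<Rightarrow> (vertex \<Rightarrow> nat) \<Rightarrow> (vertex \<Rightarrow> nat) set" where
  "color_cylinder q \<Lambda> g = {f \<in> space (color_measure q). \<forall>i\<in>\<Lambda>. f i = g i}"

lemma arrow_cylinder:
  assumes "\<delta> \<in> {0..1}" "\<epsilon> \<in> {0..1}" "\<Lambda> \<subseteq> vertices" "finite \<Lambda>"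
  shows "arrow_cylinder \<delta> \<epsilon> \<Lambda> g \<in> sets (arrow_measure \<delta> \<epsilon>)"
    and "emeasure (arrow_measure \<delta> \<epsilon>) (arrow_cylinder \<delta> \<epsilon> \<Lambda> g) = ennreal (\<Prod>i\<in>\<Lambda>. arrow_weight \<delta> \<epsilon> (g i))"
proof -
  have pmf: "pmf (arrows_pmf \<delta> \<epsilon>) a = arrow_weight \<delta> \<epsilon> a" for a
    using pmf_arrows_pmf[OF assms(1,2)] by (cases a) (simp_all add: arrow_weight_def)
  note * = emeasure_cylinder[OF prob_space_measure_pmf[of "arrows_pmf \<delta> \<epsilon>"] assms(3,4), of g]
  show "arrow_cylinder \<delta> \<epsilon> \<Lambda> g \<in> sets (arrow_measure \<delta> \<epsilon>)"
    unfolding arrow_cylinder_def arrow_measure_def by (rule *(1)) simp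
  have "emeasure (arrow_measure \<delta> \<epsilon>) (arrow_cylinder \<delta> \<epsilon> \<Lambda> g) = (\<Prod>i\<in>\<Lambda>. emeasure (measure_pmf (arrows_pmf \<delta> \<epsilon>)) {g i})"
    unfolding arrow_cylinder_def arrow_measure_def by (rule *(2)) simp
  also have "\<dots> = (\<Prod>i\<in>\<Lambda>. ennreal (arrow_weight \<delta> \<epsilon> (g i)))"
    by (simp add: emeasure_pmf_single pmf)
  also have "\<dots> = ennreal (\<Prod>i\<in>\<Lambda>. arrow_weight \<delta> \<epsilon> (g i))"
    using assms by (intro prod_ennreal arrow_weight_nonneg) auto
  finally show "emeasure (arrow_measure \<delta> \<epsilon>) (arrow_cylinder \<delta> \<epsilon> \<Lambda> g) = ennreal (\<Prod>i\<in>\<Lambda>. arrow_weight \<delta> \<epsilon> (g i))" .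
qed

lemma color_cylinder:
  assumes "q \<ge> 1" "\<Lambda> \<subseteq> vertices" "finite \<Lambda>" "\<And>i. i \<in> \<Lambda> \<Longrightarrow> g i \<in> {1..q}"
  shows "color_cylinder q \<Lambda> g \<in> sets (color_measure q)"
    and "emeasure (color_measure q) (color_cylinder q \<Lambda> g) = ennreal (\<Prod>i\<in>\<Lambda>. 1 / real q)"
proof -
  have p: "prob_space (uniform_count_measure {1..q})"
    using assms by (intro prob_space_uniform_count_measure) auto
  note * = emeasure_cylinder[OF p assms(2,3), of g]
  show "color_cylinder q \<Lambda> g \<in> sets (color_measure q)"
    unfolding color_cylinder_def color_measure_def
    by (rule *(1)) (use assms in \<open>auto simp: sets_uniform_count_measure\<close>)
  have "emeasure (color_measure q) (color_cylinder q \<Lambda> g) = (\<Prod>i\<in>\<Lambda>. emeasure (uniform_count_measure {1..q}) {g i})"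
    unfolding color_cylinder_def color_measure_def
    by (rule *(2)) (use assms in \<open>auto simp: sets_uniform_count_measure\<close>)
  also have "\<dots> = (\<Prod>i\<in>\<Lambda>. ennreal (1 / real q))"
    using assms by (intro prod.cong refl, subst emeasure_uniform_count_measure) auto
  also have "\<dots> = ennreal (\<Prod>i\<in>\<Lambda>. 1 / real q)"
    by (rule prod_ennreal) auto
  finally show "emeasure (color_measure q) (color_cylinder q \<Lambda> g) = ennreal (\<Prod>i\<in>\<Lambda>. 1 / real q)" .
qed

abbreviation env :: "real \<Rightarrow> real \<Rightarrow> nat \<Rightarrow> ((vertex \<Rightarrow> arrows) \<times> (vertex \<Rightarrow> nat)) measure" where
  "env \<delta> \<epsilon> q \<equiv> arrow_measure \<delta> \<epsilon> \<Otimes>\<^sub>M color_measure q"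

lemma prob_space_env:
  assumes "q \<ge> 1" shows "prob_space (env \<delta> \<epsilon> q)"
proof -
  interpret A: prob_space "arrow_measure \<delta> \<epsilon>" by (rule prob_space_arrow_measure)
  interpret C: prob_space "color_measure q" by (rule prob_space_color_measure[OF assms])
  interpret pair_prob_space "arrow_measure \<delta> \<epsilon>" "color_measure q" ..
  show ?thesis by unfold_locales
qed

text \<open>The bridge from the product measures to finite expectations: the event is a disjoint
  union of finitely many cylinders, one for each admissible assignment on \<Lambda>.\<close>

lemma env_finite_dim:
  assumes \<delta>: "\<delta> \<in> {0..1}" "\<epsilon> \<in> {0..1}" and q: "q \<ge> 1" and \<Lambda>: "\<Lambda> \<subseteq> vertices" "finite \<Lambda>"
    and R: "\<And>X X' Y Y'. (\<And>v. v \<in> \<Lambda> \<Longrightarrow> X v = X' v \<and> Y v = Y' v) \<Longrightarrow> R X Y = R X' Y'"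
  shows "{\<omega> \<in> space (env \<delta> \<epsilon> q). R (fst \<omega>) (snd \<omega>)} \<in> sets (env \<delta> \<epsilon> q)" (is "?E \<in> _")
    and "measure (env \<delta> \<epsilon> q) {\<omega> \<in> space (env \<delta> \<epsilon> q). R (fst \<omega>) (snd \<omega>)}
      = ex UNIV \<Lambda> (arrow_weight \<delta> \<epsilon>) (\<lambda>X. ex {1..q} \<Lambda> (\<lambda>_. 1 / real q) (\<lambda>Y. of_bool (R X Y)))"
proof -
  interpret C: prob_space "color_measure q" by (rule prob_space_color_measure[OF q])
  interpret E: prob_space "env \<delta> \<epsilon> q" by (rule prob_space_env[OF q])
  let ?P = "PiE \<Lambda> (\<lambda>_. UNIV :: arrows set)" and ?C = "PiE \<Lambda> (\<lambda>_. {1..q})"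
  define G where "G = {(g, h) \<in> ?P \<times> ?C. R g h}"
  define cyl where "cyl = (\<lambda>(g, h). arrow_cylinder \<delta> \<epsilon> \<Lambda> g \<times> color_cylinder q \<Lambda> h)"
  have finPC: "finite ?P" "finite ?C"
    using \<Lambda>(2) by (simp_all add: finite_PiE)
  then have finG: "finite G"
    by (intro finite_subset[of G "?P \<times> ?C"]) (auto simp: G_def)
  have cyl: "cyl p \<in> sets (env \<delta> \<epsilon> q)" "measure (env \<delta> \<epsilon> q) (cyl p)
      = (\<Prod>i\<in>\<Lambda>. arrow_weight \<delta> \<epsilon> (fst p i)) * (\<Prod>i\<in>\<Lambda>. 1 / real q)" if "p \<in> G" for p
  proof -
    obtain g h where p: "p = (g, h)" by (cases p)
    have h: "h i \<in> {1..q}" if "i \<in> \<Lambda>" for i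
      using \<open>p \<in> G\<close> that unfolding p G_def by (auto simp: PiE_iff)
    note a = arrow_cylinder[OF \<delta> \<Lambda>, of g] and c = color_cylinder[OF q \<Lambda>, of h, OF h]
    show "cyl p \<in> sets (env \<delta> \<epsilon> q)"
      unfolding p cyl_def using a c by auto
    have "emeasure (env \<delta> \<epsilon> q) (cyl p) = ennreal ((\<Prod>i\<in>\<Lambda>. arrow_weight \<delta> \<epsilon> (g i)) * (\<Prod>i\<in>\<Lambda>. 1 / real q))"
    proof -
      have nn: "0 \<le> (\<Prod>i\<in>\<Lambda>. arrow_weight \<delta> \<epsilon> (g i))" "0 \<le> (\<Prod>i\<in>\<Lambda>. 1 / real q)"
        using \<delta> by (auto intro!: prod_nonneg arrow_weight_nonneg)
      have "cyl p = arrow_cylinder \<delta> \<epsilon> \<Lambda> g \<times> color_cylinder q \<Lambda> h"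
        by (simp add: p cyl_def)
      then have "emeasure (env \<delta> \<epsilon> q) (cyl p) = emeasure (arrow_measure \<delta> \<epsilon>) (arrow_cylinder \<delta> \<epsilon> \<Lambda> g)
          * emeasure (color_measure q) (color_cylinder q \<Lambda> h)"
        by (simp only: C.emeasure_pair_measure_Times[OF a(1) c(1)])
      also have "\<dots> = ennreal (\<Prod>i\<in>\<Lambda>. arrow_weight \<delta> \<epsilon> (g i)) * ennreal (\<Prod>i\<in>\<Lambda>. 1 / real q)"
        by (simp only: a(2) c(2))
      also have "\<dots> = ennreal ((\<Prod>i\<in>\<Lambda>. arrow_weight \<delta> \<epsilon> (g i)) * (\<Prod>i\<in>\<Lambda>. 1 / real q))"
        by (rule ennreal_mult[symmetric, OF nn])
      finally show ?thesis .
    qed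
    then show "measure (env \<delta> \<epsilon> q) (cyl p) = (\<Prod>i\<in>\<Lambda>. arrow_weight \<delta> \<epsilon> (fst p i)) * (\<Prod>i\<in>\<Lambda>. 1 / real q)"
      using \<delta> by (simp add: measure_def p prod_nonneg arrow_weight_nonneg)
  qed
  have disj: "disjoint_family_on cyl G"
    unfolding disjoint_family_on_def
  proof (intro ballI impI)
    fix p p' assume p: "p \<in> G" "p' \<in> G" "p \<noteq> p'"
    show "cyl p \<inter> cyl p' = {}"
    proof (rule ccontr)
      assume "cyl p \<inter> cyl p' \<noteq> {}"
      then obtain X Y where "(X, Y) \<in> cyl p" "(X, Y) \<in> cyl p'" by auto
      then have *: "fst p i = fst p' i \<and> snd p i = snd p' i" if "i \<in> \<Lambda>" for i
        using that by (auto simp: cyl_def arrow_cylinder_def color_cylinder_def split: prod.splits)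
      have "fst p = fst p'"
        by (rule PiE_ext[of _ \<Lambda> "\<lambda>_. UNIV"]) (use p * in \<open>auto simp: G_def\<close>)
      moreover have "snd p = snd p'"
        by (rule PiE_ext[of _ \<Lambda> "\<lambda>_. {1..q}"]) (use p * in \<open>auto simp: G_def\<close>)
      ultimately show False using p(3) by (simp add: prod_eq_iff)
    qed
  qed
  have eq: "?E = (\<Union>p\<in>G. cyl p)"
  proof (intro set_eqI iffI)
    fix \<omega> assume \<omega>: "\<omega> \<in> ?E"
    obtain X Y where XY: "\<omega> = (X, Y)" by (cases \<omega>)
    have sp: "X \<in> space (arrow_measure \<delta> \<epsilon>)" "Y \<in> space (color_measure q)" "R X Y"
      using \<omega> by (auto simp: XY space_pair_measure)
    have Yq: "Y v \<in> {1..q}" if "v \<in> \<Lambda>" for v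
    proof -
      have "v \<in> vertices" using that \<Lambda> by auto
      then show ?thesis
        using measurable_space[OF measurable_color_component sp(2), of v] by simp
    qed
    have "R (restrict X \<Lambda>) (restrict Y \<Lambda>) = R X Y"
      by (rule R) simp
    then have "(restrict X \<Lambda>, restrict Y \<Lambda>) \<in> G"
      using sp Yq by (auto simp: G_def)
    moreover have "\<omega> \<in> cyl (restrict X \<Lambda>, restrict Y \<Lambda>)"
      using sp by (auto simp: XY cyl_def arrow_cylinder_def color_cylinder_def)
    ultimately show "\<omega> \<in> (\<Union>p\<in>G. cyl p)" by blast
  next
    fix \<omega> assume "\<omega> \<in> (\<Union>p\<in>G. cyl p)"
    then obtain g h where gh: "(g, h) \<in> G" "\<omega> \<in> cyl (g, h)" by auto
    have "R (fst \<omega>) (snd \<omega>) = R g h"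
      by (rule R) (use gh in \<open>auto simp: cyl_def arrow_cylinder_def color_cylinder_def\<close>)
    then show "\<omega> \<in> ?E"
      using gh by (auto simp: G_def cyl_def arrow_cylinder_def color_cylinder_def space_pair_measure)
  qed
  show "?E \<in> sets (env \<delta> \<epsilon> q)"
    unfolding eq using cyl(1) finG by (intro sets.finite_UN) auto
  have "measure (env \<delta> \<epsilon> q) ?E = (\<Sum>p\<in>G. measure (env \<delta> \<epsilon> q) (cyl p))"
    unfolding eq using cyl(1) finG disj by (intro E.finite_measure_finite_Union) auto
  also have "\<dots> = (\<Sum>p\<in>G. (\<Prod>i\<in>\<Lambda>. arrow_weight \<delta> \<epsilon> (fst p i)) * (\<Prod>i\<in>\<Lambda>. 1 / real q))"
    by (rule sum.cong[OF refl cyl(2)])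
  also have "\<dots> = (\<Sum>p\<in>?P \<times> ?C. (\<Prod>i\<in>\<Lambda>. arrow_weight \<delta> \<epsilon> (fst p i)) * ((\<Prod>i\<in>\<Lambda>. 1 / real q) * of_bool (R (fst p) (snd p))))"
    by (rule sum.mono_neutral_cong_left) (use finPC in \<open>auto simp: G_def\<close>)
  also have "\<dots> = (\<Sum>g\<in>?P. (\<Prod>i\<in>\<Lambda>. arrow_weight \<delta> \<epsilon> (g i)) * (\<Sum>h\<in>?C. (\<Prod>i\<in>\<Lambda>. 1 / real q) * of_bool (R g h)))"
    unfolding sum_distrib_left by (subst sum.cartesian_product) (simp add: case_prod_unfold)
  finally show "measure (env \<delta> \<epsilon> q) ?E
      = ex UNIV \<Lambda> (arrow_weight \<delta> \<epsilon>) (\<lambda>X. ex {1..q} \<Lambda> (\<lambda>_. 1 / real q) (\<lambda>Y. of_bool (R X Y)))"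
    unfolding ex_def .
qed

text \<open>With a single color the color coordinate is deterministic, so the statement for arrows
  alone follows from the joint one.\<close>

lemma arrow_finite_dim:
  assumes \<delta>: "\<delta> \<in> {0..1}" "\<epsilon> \<in> {0..1}" and \<Lambda>: "\<Lambda> \<subseteq> vertices" "finite \<Lambda>"
    and R: "\<And>X X'. (\<And>v. v \<in> \<Lambda> \<Longrightarrow> X v = X' v) \<Longrightarrow> R X = R X'"
    and E: "{X \<in> space (arrow_measure \<delta> \<epsilon>). R X} \<in> sets (arrow_measure \<delta> \<epsilon>)"
  shows "measure (arrow_measure \<delta> \<epsilon>) {X \<in> space (arrow_measure \<delta> \<epsilon>). R X} = aex \<Lambda> \<delta> \<epsilon> (\<lambda>X. of_bool (R X))"
proof -
  interpret C: prob_space "color_measure 1" by (rule prob_space_color_measure) simp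
  have "emeasure (env \<delta> \<epsilon> 1) ({X \<in> space (arrow_measure \<delta> \<epsilon>). R X} \<times> space (color_measure 1))
      = emeasure (arrow_measure \<delta> \<epsilon>) {X \<in> space (arrow_measure \<delta> \<epsilon>). R X}"
    by (simp only: C.emeasure_pair_measure_Times[OF E sets.top] C.emeasure_space_1 mult_1_right)
  moreover have "{X \<in> space (arrow_measure \<delta> \<epsilon>). R X} \<times> space (color_measure 1)
      = {\<omega> \<in> space (env \<delta> \<epsilon> 1). R (fst \<omega>)}"
    by (auto simp: space_pair_measure)
  ultimately have "measure (arrow_measure \<delta> \<epsilon>) {X \<in> space (arrow_measure \<delta> \<epsilon>). R X}
      = measure (env \<delta> \<epsilon> 1) {\<omega> \<in> space (env \<delta> \<epsilon> 1). R (fst \<omega>)}"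
    by (simp add: measure_def)
  also have "\<dots> = aex \<Lambda> \<delta> \<epsilon> (\<lambda>X. ex {1..1::nat} \<Lambda> (\<lambda>_. 1 / real 1) (\<lambda>Y. of_bool (R X)))"
    by (rule env_finite_dim(2)[where R = "\<lambda>X Y. R X", OF \<delta> _ \<Lambda>]) (simp, rule R, blast)
  also have "\<dots> = aex \<Lambda> \<delta> \<epsilon> (\<lambda>X. of_bool (R X))"
    using \<Lambda>(2) by (simp add: ex_const)
  finally show ?thesis .
qed

section \<open>Path events and their cones\<close>

definition cone_at :: "vertex \<Rightarrow> nat \<Rightarrow> vertex set" where
  "cone_at v n = (\<lambda>u. v + u) ` light_cone n"

lemma in_cone_at: "u \<in> cone_at v n \<longleftrightarrow> u - v \<in> light_cone n"
  unfolding cone_at_def by (auto simp: image_iff intro!: bexI[of _ "u - v"])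

lemma finite_cone_at [simp]: "finite (cone_at v n)"
  by (simp add: cone_at_def)

lemma cone_at_vertices: "v \<in> vertices \<Longrightarrow> cone_at v n \<subseteq> vertices"
  by (cases v) (auto simp: cone_at_def light_cone_def vertices_def)

lemma cone_at_child: "cone_at (child b v) n \<subseteq> cone_at v (Suc n)"
  by (cases v) (auto simp: in_cone_at light_cone_def child_def left_up_def right_up_def)

lemma apex_in_cone_at: "v \<in> cone_at v n"
  by (simp add: in_cone_at light_cone_def zero_prod_def)

lemma path_of_length_Suc_child: "path_of_length X (Suc n) v \<longleftrightarrow> (\<exists>b. arrow X v (child b v) \<and> path_of_length X n (child b v))"
  by (metis arrow_child path_of_length.simps(2))

lemma cone_at_level: "u \<in> cone_at v n \<Longrightarrow> snd v \<le> snd u"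
  by (cases u; cases v) (auto simp: in_cone_at light_cone_def)

lemma path_of_length_cong:
  assumes "\<And>u. u \<in> cone_at v n \<Longrightarrow> snd u < snd v + int n \<Longrightarrow> X u = X' u"
  shows "path_of_length X n v = path_of_length X' n v"
  using assms
proof (induction n arbitrary: v)
  case (Suc n)
  have IH: "path_of_length X n (child b v) = path_of_length X' n (child b v)" for b
  proof (rule Suc.IH)
    show "X u = X' u" if "u \<in> cone_at (child b v) n" "snd u < snd (child b v) + int n" for u
    proof (rule Suc.prems)
      show "u \<in> cone_at v (Suc n)"
        using that(1) cone_at_child by blast
      show "snd u < snd v + int (Suc n)"
        using that(2) by simp
    qed
  qed
  have "X v = X' v"
    by (rule Suc.prems) (simp_all add: apex_in_cone_at)
  then have "arrow X v w = arrow X' v w" for w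
    by (rule arrow_cong)
  then show ?case
    unfolding path_of_length_Suc_child IH by simp
qed simp

lemma cone_at_origin: "cone_at (0, 0) n = light_cone n"
  by (simp add: cone_at_def plus_prod_def)

lemma path_of_length_light_cone_cong:
  assumes "\<And>u. u \<in> light_cone n \<Longrightarrow> X u = X' u"
  shows "path_of_length X n (0, 0) = path_of_length X' n (0, 0)"
  by (rule path_of_length_cong, rule assms) (simp only: cone_at_origin)

lemma sets_path_of_length:
  "{X \<in> space (arrow_measure \<delta> \<epsilon>). path_of_length X n (0, 0)} \<in> sets (arrow_measure \<delta> \<epsilon>)"
  using pred_path_of_length[where v = "(0, 0)" and \<delta> = \<delta> and \<epsilon> = \<epsilon> and n = n] by (simp add: vertices_def)

lemma measure_path_of_length:
  assumes "\<delta> \<in> {0..1}" "\<epsilon> \<in> {0..1}" "\<Lambda> \<subseteq> vertices" "finite \<Lambda>" "light_cone n \<subseteq> \<Lambda>"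
  shows "measure (arrow_measure \<delta> \<epsilon>) {X \<in> space (arrow_measure \<delta> \<epsilon>). path_of_length X n (0, 0)}
    = aex \<Lambda> \<delta> \<epsilon> (\<lambda>X. of_bool (path_of_length X n (0, 0)))"
proof (rule arrow_finite_dim[OF assms(1-4) _ sets_path_of_length])
  show "path_of_length X n (0, 0) = path_of_length X' n (0, 0)" if "\<And>v. v \<in> \<Lambda> \<Longrightarrow> X v = X' v" for X X'
    by (rule path_of_length_light_cone_cong) (use that assms(5) in blast)
qed

text \<open>Finite branching turns an infinite path into arbitrarily long finite ones, so
  percolation is a decreasing intersection of finite-dimensional events.\<close>

lemma measure_path_tendsto:
  "(\<lambda>n. measure (arrow_measure \<delta> \<epsilon>) {X \<in> space (arrow_measure \<delta> \<epsilon>). path_of_length X n (0, 0)})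
    \<longlonglongrightarrow> percolation_prob \<delta> \<epsilon>"
proof -
  interpret A: prob_space "arrow_measure \<delta> \<epsilon>" by (rule prob_space_arrow_measure)
  let ?E = "\<lambda>n. {X \<in> space (arrow_measure \<delta> \<epsilon>). path_of_length X n (0, 0)}"
  have "(\<Inter>n. ?E n) = {X \<in> space (arrow_measure \<delta> \<epsilon>). infinite_path_from X (0, 0)}"
    by (auto simp: infinite_path_from_iff)
  moreover have "(\<lambda>n. measure (arrow_measure \<delta> \<epsilon>) (?E n)) \<longlonglongrightarrow> measure (arrow_measure \<delta> \<epsilon>) (\<Inter>n. ?E n)"
  proof (rule A.finite_Lim_measure_decseq)
    show "range ?E \<subseteq> sets (arrow_measure \<delta> \<epsilon>)"
      using sets_path_of_length by blast
    show "decseq ?E"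
      by (rule decseq_SucI, rule Collect_mono) (blast dest: path_of_length_Suc_D)
  qed
  ultimately show ?thesis
    by (simp add: percolation_prob_def)
qed

section \<open>The percolation threshold lies strictly between 0 and 1\<close>

lemma percolation_threshold_pos:
  assumes "0 < \<delta>" "\<delta> \<le> 1"
  shows "\<exists>\<epsilon>\<^sub>0>0. \<forall>\<epsilon>\<in>{0..\<epsilon>\<^sub>0}. \<epsilon> \<le> 1 \<longrightarrow> percolation_prob \<delta> \<epsilon> \<noteq> 0"
proof -
  obtain \<epsilon>\<^sub>0 h where p: "0 < \<epsilon>\<^sub>0" "0 < h" "\<epsilon>\<^sub>0 \<le> 1" and L: "\<forall>\<epsilon>\<in>{0..\<epsilon>\<^sub>0}. \<forall>N. \<exists>\<Lambda>\<^sub>0. finite \<Lambda>\<^sub>0 \<and> \<Lambda>\<^sub>0 \<subseteq> vertices \<and>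
    (\<forall>\<Lambda>. finite \<Lambda> \<longrightarrow> \<Lambda>\<^sub>0 \<subseteq> \<Lambda> \<longrightarrow> aex \<Lambda> \<delta> \<epsilon> (\<lambda>X. of_bool (\<not> path_of_length X (N * h) (0, 0))) \<le> 1 / 2)"
    using survival_prob_bound[OF assms] by (elim exE conjE) (rule that)
  have "percolation_prob \<delta> \<epsilon> \<noteq> 0" if \<epsilon>: "\<epsilon> \<in> {0..\<epsilon>\<^sub>0}" for \<epsilon>
  proof -
    interpret A: prob_space "arrow_measure \<delta> \<epsilon>" by (rule prob_space_arrow_measure)
    let ?E = "\<lambda>n. {X \<in> space (arrow_measure \<delta> \<epsilon>). path_of_length X n (0, 0)}"
    have "1 / 2 \<le> measure (arrow_measure \<delta> \<epsilon>) (?E n)" for n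
    proof -
      obtain \<Lambda>\<^sub>0 where \<Lambda>\<^sub>0: "finite \<Lambda>\<^sub>0" "\<Lambda>\<^sub>0 \<subseteq> vertices"
        "\<forall>\<Lambda>. finite \<Lambda> \<longrightarrow> \<Lambda>\<^sub>0 \<subseteq> \<Lambda> \<longrightarrow> aex \<Lambda> \<delta> \<epsilon> (\<lambda>X. of_bool (\<not> path_of_length X (n * h) (0, 0))) \<le> 1 / 2"
        using L[THEN bspec, OF \<epsilon>, THEN spec, of n] by (elim exE conjE) (rule that)
      \<comment> \<open>Large enough both for the survival bound and for reading off the path
        event.\<close>
      define \<Lambda> where "\<Lambda> = \<Lambda>\<^sub>0 \<union> light_cone (n * h)"
      have \<Lambda>: "finite \<Lambda>" "\<Lambda> \<subseteq> vertices" "\<Lambda>\<^sub>0 \<subseteq> \<Lambda>" "light_cone (n * h) \<subseteq> \<Lambda>"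
        using \<Lambda>\<^sub>0 light_cone_subset_vertices by (auto simp: \<Lambda>_def)
      have "aex \<Lambda> \<delta> \<epsilon> (\<lambda>X. of_bool (path_of_length X (n * h) (0, 0)))
          = aex \<Lambda> \<delta> \<epsilon> (\<lambda>X. 1 - of_bool (\<not> path_of_length X (n * h) (0, 0)))"
        by (rule ex_cong) simp
      also have "\<dots> = 1 - aex \<Lambda> \<delta> \<epsilon> (\<lambda>X. of_bool (\<not> path_of_length X (n * h) (0, 0)))"
        unfolding ex_diff by (subst ex_const) (use \<Lambda> sum_arrow_weight in auto)
      finally have "1 / 2 \<le> aex \<Lambda> \<delta> \<epsilon> (\<lambda>X. of_bool (path_of_length X (n * h) (0, 0)))"
        using \<Lambda>\<^sub>0(3)[rule_format, OF \<Lambda>(1,3)] by linarith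
      also have "\<dots> = measure (arrow_measure \<delta> \<epsilon>) (?E (n * h))"
        using assms \<epsilon> p by (intro measure_path_of_length[OF _ _ \<Lambda>(2,1,4), symmetric]) auto
      also have "\<dots> \<le> measure (arrow_measure \<delta> \<epsilon>) (?E n)"
      proof (rule A.finite_measure_mono[OF _ sets_path_of_length], safe)
        show "path_of_length X n (0, 0)" if "path_of_length X (n * h) (0, 0)" for X
          using that path_of_length_antimono[of X "n * h" "(0, 0)" n] p(2) by simp
      qed
      finally show ?thesis .
    qed
    then have "1 / 2 \<le> percolation_prob \<delta> \<epsilon>"
      by (intro LIMSEQ_le_const[OF measure_path_tendsto]) blast
    then show ?thesis by auto
  qed
  then show ?thesis using p(1) by blast
qed

lemma arrow_child_iff:
  "arrow X v (child b v) \<longleftrightarrow> X v = Both_Arrows \<or> X v = (if b then Left_Arrow else Right_Arrow)"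
  by (cases v) (auto simp: arrow_def child_def left_up_def right_up_def)

text \<open>First moment bound: the mean number of arrows out of a vertex is
  \<open>(1 - \<delta>) + 2 * \<delta> * (1 - \<epsilon>)\<close>, and this equals the base of the
  power.\<close>

lemma path_union_bound:
  assumes \<delta>: "\<delta> \<in> {0..1}" "\<epsilon> \<in> {0..1}" and \<Lambda>: "finite \<Lambda>" and "cone_at v n \<subseteq> \<Lambda>"
  shows "aex \<Lambda> \<delta> \<epsilon> (\<lambda>X. of_bool (path_of_length X n v)) \<le> (1 - \<delta> * (2 * \<epsilon> - 1)) ^ n"
  using assms(4)
proof (induction n arbitrary: v)
  case 0
  then show ?case using \<Lambda> sum_arrow_weight by (simp add: ex_const)
next
  case (Suc n)
  have nn: "0 \<le> arrow_weight \<delta> \<epsilon> a" for a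
    using \<delta> by (intro arrow_weight_nonneg) auto
  have IH: "aex \<Lambda> \<delta> \<epsilon> (\<lambda>X. of_bool (path_of_length X n (child b v))) \<le> (1 - \<delta> * (2 * \<epsilon> - 1)) ^ n" for b
    by (rule Suc.IH) (use cone_at_child Suc.prems in blast)
  have v: "v \<in> \<Lambda>" using Suc.prems apex_in_cone_at by blast
  let ?p = "\<lambda>b X. of_bool (path_of_length X n (child b v)) :: real"
  define F where "F a = aex \<Lambda> \<delta> \<epsilon> (\<lambda>X. of_bool (path_of_length (X(v := a)) (Suc n) v))" for a
  have child: "path_of_length (X(v := a)) n (child b v) = path_of_length X n (child b v)" for X a b
    by (rule path_of_length_cong) (use cone_at_level[of v "child b v" n] in auto)
  have step: "path_of_length (X(v := a)) (Suc n) v \<longleftrightarrow>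
      (a \<in> {Left_Arrow, Both_Arrows} \<and> path_of_length X n (child True v)) \<or>
      (a \<in> {Right_Arrow, Both_Arrows} \<and> path_of_length X n (child False v))" for X a
    unfolding path_of_length_Suc_child child ex_bool_eq by (auto simp: arrow_child_iff)
  have F: "F Left_Arrow \<le> aex \<Lambda> \<delta> \<epsilon> (?p True)" "F Right_Arrow \<le> aex \<Lambda> \<delta> \<epsilon> (?p False)"
    "F Both_Arrows \<le> aex \<Lambda> \<delta> \<epsilon> (\<lambda>X. ?p True X + ?p False X)" "F No_Arrow \<le> aex \<Lambda> \<delta> \<epsilon> (\<lambda>_. 0)"
    unfolding F_def step by (intro ex_mono[OF nn]; simp)+
  have "aex \<Lambda> \<delta> \<epsilon> (\<lambda>X. of_bool (path_of_length X (Suc n) v)) = (\<Sum>a\<in>UNIV. arrow_weight \<delta> \<epsilon> a * F a)"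
    unfolding F_def by (rule ex_resample) (use \<Lambda> v sum_arrow_weight in auto)
  also have "\<dots> \<le> (1 - \<delta>) / 2 * (1 - \<delta> * (2 * \<epsilon> - 1)) ^ n + (1 - \<delta>) / 2 * (1 - \<delta> * (2 * \<epsilon> - 1)) ^ n
      + \<delta> * (1 - \<epsilon>) * (2 * (1 - \<delta> * (2 * \<epsilon> - 1)) ^ n) + \<delta> * \<epsilon> * 0"
  proof -
    have "(\<Sum>a\<in>UNIV. arrow_weight \<delta> \<epsilon> a * F a) = (1 - \<delta>) / 2 * F Left_Arrow + (1 - \<delta>) / 2 * F Right_Arrow
       + \<delta> * (1 - \<epsilon>) * F Both_Arrows + \<delta> * \<epsilon> * F No_Arrow"
      by (simp add: UNIV_arrows arrow_weight_def)
    also have "\<dots> \<le> (1 - \<delta>) / 2 * (1 - \<delta> * (2 * \<epsilon> - 1)) ^ n + (1 - \<delta>) / 2 * (1 - \<delta> * (2 * \<epsilon> - 1)) ^ n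
      + \<delta> * (1 - \<epsilon>) * (2 * (1 - \<delta> * (2 * \<epsilon> - 1)) ^ n) + \<delta> * \<epsilon> * 0"
    proof (intro add_mono mult_left_mono)
      show "F Both_Arrows \<le> 2 * (1 - \<delta> * (2 * \<epsilon> - 1)) ^ n"
        using F(3) IH[of True] IH[of False] unfolding ex_add by linarith
      show "F Left_Arrow \<le> (1 - \<delta> * (2 * \<epsilon> - 1)) ^ n" "F Right_Arrow \<le> (1 - \<delta> * (2 * \<epsilon> - 1)) ^ n"
        using order_trans[OF F(1) IH] order_trans[OF F(2) IH] by blast+
      show "F No_Arrow \<le> 0"
        using F(4) by simp
    qed (use \<delta> in auto)
    finally show ?thesis .
  qed
  also have "\<dots> = (1 - \<delta> * (2 * \<epsilon> - 1)) ^ Suc n"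
    by (simp add: field_simps)
  finally show ?case .
qed

lemma percolation_prob_zero:
  assumes "0 < \<delta>" "\<delta> \<le> 1" "1 / 2 < \<epsilon>" "\<epsilon> \<le> 1"
  shows "percolation_prob \<delta> \<epsilon> = 0"
proof -
  let ?r = "1 - \<delta> * (2 * \<epsilon> - 1)"
  have r: "0 \<le> ?r" "?r < 1"
    using assms mult_mono[of \<delta> 1 "2 * \<epsilon> - 1" 1] by auto
  let ?m = "\<lambda>n. measure (arrow_measure \<delta> \<epsilon>) {X \<in> space (arrow_measure \<delta> \<epsilon>). path_of_length X n (0, 0)}"
  have le: "?m n \<le> ?r ^ n" for n
  proof -
    have "aex (light_cone n) \<delta> \<epsilon> (\<lambda>X. of_bool (path_of_length X n (0, 0))) \<le> ?r ^ n"
      using assms by (intro path_union_bound) (auto simp: cone_at_origin)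
    then show ?thesis
      using assms light_cone_subset_vertices by (subst measure_path_of_length[where \<Lambda> = "light_cone n"]) auto
  qed
  have "?m \<longlonglongrightarrow> 0"
    by (rule tendsto_sandwich[OF _ _ tendsto_const LIMSEQ_power_zero[of ?r]]) (use le r in auto)
  then show ?thesis
    using LIMSEQ_unique measure_path_tendsto by blast
qed

text \<open>The threshold is an infimum, so extinction is taken at a point as close above it as
  desired, supplied by the third claim. The upper bound 1/2 later keeps
  \<open>1 - \<epsilon>\<close> bounded below.\<close>

lemma percolation_threshold_bounds:
  assumes "0 < \<delta>" "\<delta> \<le> 1"
  shows "0 < percolation_threshold \<delta>" "percolation_threshold \<delta> \<le> 1 / 2"
    and "percolation_threshold \<delta> < e \<Longrightarrow> \<exists>\<epsilon>\<in>{percolation_threshold \<delta>..<e}. \<epsilon> \<le> 1 \<and> percolation_prob \<delta> \<epsilon> = 0"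
proof -
  let ?S = "{\<epsilon> \<in> {0..1}. percolation_prob \<delta> \<epsilon> = 0}"
  have bdd: "bdd_below ?S" by (rule bdd_belowI[of _ 0]) auto
  have "1 \<in> ?S" using percolation_prob_zero[OF assms] by auto
  then have ne: "?S \<noteq> {}" by blast
  obtain \<epsilon>\<^sub>0 where \<epsilon>\<^sub>0: "\<epsilon>\<^sub>0 > 0" "\<forall>\<epsilon>\<in>{0..\<epsilon>\<^sub>0}. \<epsilon> \<le> 1 \<longrightarrow> percolation_prob \<delta> \<epsilon> \<noteq> 0"
    using percolation_threshold_pos[OF assms] by blast
  have "\<epsilon>\<^sub>0 \<le> Inf ?S"
    by (rule cInf_greatest[OF ne]) (use \<epsilon>\<^sub>0 in force)
  then show "0 < percolation_threshold \<delta>"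
    using \<epsilon>\<^sub>0 unfolding percolation_threshold_def by linarith
  show "percolation_threshold \<delta> \<le> 1 / 2"
  proof (rule field_le_epsilon)
    fix e :: real assume "0 < e"
    then have "min 1 (1 / 2 + e) \<in> ?S"
      using percolation_prob_zero[OF assms, of "min 1 (1 / 2 + e)"] by simp
    then have "Inf ?S \<le> min 1 (1 / 2 + e)"
      by (rule cInf_lower[OF _ bdd])
    then show "percolation_threshold \<delta> \<le> 1 / 2 + e"
      unfolding percolation_threshold_def by linarith
  qed
  show "\<exists>\<epsilon>\<in>{percolation_threshold \<delta>..<e}. \<epsilon> \<le> 1 \<and> percolation_prob \<delta> \<epsilon> = 0" if less: "percolation_threshold \<delta> < e"
  proof -
    obtain \<epsilon> where "\<epsilon> \<in> ?S" "\<epsilon> < e"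
      using cInf_lessD[OF ne less[unfolded percolation_threshold_def]] by blast
    moreover have "percolation_threshold \<delta> \<le> \<epsilon>"
      unfolding percolation_threshold_def by (rule cInf_lower[OF \<open>\<epsilon> \<in> ?S\<close> bdd])
    ultimately show ?thesis by auto
  qed
qed

section \<open>Colors determined by the arrows nearby\<close>

text \<open>\<open>T v\<close> is the coin that selects the child with which \<open>v\<close> is
  compared. Colors are determined for every choice of \<open>T\<close>; its randomness only makes
  the marks independent of the choice of side.\<close>

definition color_marks :: "(vertex \<Rightarrow> arrows) \<Rightarrow> (vertex \<Rightarrow> nat) \<Rightarrow> (vertex \<Rightarrow> bool) \<Rightarrow> marked" where
  "color_marks X Y T v = (X v, if Y v = Y (child (T v) v) then Some (T v) else None)"

lemma vertex_color_No_Arrow: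
  "X (x, - int (Suc n)) = No_Arrow \<Longrightarrow> vertex_color z X Y (Suc n) x = Y (x, - int (Suc n))"
  by simp

lemma child_row: "child b (x, - int (Suc n)) = (if b then x - 1 else x + 1, - int n)"
  by (simp add: child_def left_up_def right_up_def)

text \<open>Paths from row \<open>n + 1\<close> have length \<open>n\<close> and stop at row 1. In
  row 0 an arrow value \<open>No_Arrow\<close> would not mean that \<open>Y\<close> is used, as the
  colors there come from \<open>z\<close>, so marks in row 1 must not be consulted.\<close>

lemma color_determined:
  assumes "\<not> path_of_length (diminish (color_marks X Y T)) n (x, - int (Suc n))"
  shows "vertex_color z X Y (Suc n) x = vertex_color z' X Y (Suc n) x"
  using assms
proof (induction n arbitrary: x)
  case (Suc n)
  let ?v = "(x, - int (Suc (Suc n)))" and ?f = "color_marks X Y T"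
  let ?y = "\<lambda>b. if b then x - 1 else x + 1"
  have IH: "vertex_color z X Y (Suc n) (?y b) = vertex_color z' X Y (Suc n) (?y b)"
    if "arrow (diminish ?f) ?v (child b ?v)" for b
  proof (rule Suc.IH)
    have "\<not> path_of_length (diminish ?f) n (child b ?v)"
      using that Suc.prems unfolding path_of_length_Suc_child by blast
    then show "\<not> path_of_length (diminish ?f) n (?y b, - int (Suc n))"
      by (simp only: child_row simp_thms)
  qed
  have diminish: "diminish ?f ?v = X ?v \<or> X ?v = Both_Arrows \<and>
      (\<exists>b. Y ?v = Y (child b ?v) \<and> X (child b ?v) = No_Arrow)"
    by (auto simp: diminish_def color_marks_def)
  show ?case
  proof (cases "X ?v")
    case Left_Arrow
    then show ?thesis
      using diminish IH[of True] by (simp add: arrow_child_iff del: vertex_color.simps(2))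
        (simp add: vertex_color.simps(2)[of _ _ _ "Suc n"] del: vertex_color.simps(2))
  next
    case Right_Arrow
    then show ?thesis
      using diminish IH[of False] by (simp add: arrow_child_iff del: vertex_color.simps(2))
        (simp add: vertex_color.simps(2)[of _ _ _ "Suc n"] del: vertex_color.simps(2))
  next
    case Both_Arrows
    consider "diminish ?f ?v = Both_Arrows" | b where "Y ?v = Y (child b ?v)" "X (child b ?v) = No_Arrow"
      using diminish Both_Arrows by auto
    then show ?thesis
    proof cases
      case 1
      then have "vertex_color z X Y (Suc n) (?y b) = vertex_color z' X Y (Suc n) (?y b)" for b
        by (intro IH) (simp add: arrow_child_iff)
      from this[of True] this[of False] show ?thesis
        by (simp add: vertex_color.simps(2)[of _ _ _ "Suc n"] Let_def del: vertex_color.simps(2))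
    next
      case 2
      then have "vertex_color u X Y (Suc n) (?y b) = Y ?v" for u
        unfolding child_row by (simp add: vertex_color_No_Arrow del: vertex_color.simps(2) split: if_splits)
      from this[of z] this[of z'] show ?thesis
        using Both_Arrows by (cases b)
          (simp_all add: vertex_color.simps(2)[of _ _ _ "Suc n"] Let_def del: vertex_color.simps(2))
    qed
  next
    case No_Arrow
    then show ?thesis by (simp only: vertex_color_No_Arrow)
  qed
qed simp

lemma vertex_color_cong:
  assumes "\<And>u. u \<in> cone_at (x, - int n) n \<Longrightarrow> snd u \<le> - 1 \<Longrightarrow> X u = X' u \<and> Y u = Y' u"
  shows "vertex_color z X Y n x = vertex_color z X' Y' n x"
  using assms
proof (induction n arbitrary: x)
  case (Suc n)
  let ?v = "(x, - int (Suc n))"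
  have IH: "vertex_color z X Y n (if b then x - 1 else x + 1) = vertex_color z X' Y' n (if b then x - 1 else x + 1)" for b
  proof (rule Suc.IH)
    fix u assume "u \<in> cone_at (if b then x - 1 else x + 1, - int n) n" "snd u \<le> - 1"
    then show "X u = X' u \<and> Y u = Y' u"
      using Suc.prems[of u] cone_at_child[of b ?v n] unfolding child_row by blast
  qed
  have "X ?v = X' ?v \<and> Y ?v = Y' ?v"
    by (rule Suc.prems) (simp_all add: apex_in_cone_at)
  then show ?case
    using IH[of True] IH[of False] by (cases "X' ?v") (simp_all add: Let_def)
qed simp

section \<open>Independence of the marks\<close>

definition color_weight :: "nat \<Rightarrow> real \<Rightarrow> real \<Rightarrow> arrows \<times> nat \<times> bool \<Rightarrow> real" where
  "color_weight q \<delta> \<epsilon> = (\<lambda>(a, c, t). arrow_weight \<delta> \<epsilon> a * (1 / real q * (1 / 2)))"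

text \<open>A child outside \<open>A\<close> is given the color \<open>1\<close>, so that
  comparisons at the upper rim also succeed with probability \<open>1 / q\<close>.\<close>

definition marks_on :: "vertex set \<Rightarrow> (vertex \<Rightarrow> arrows \<times> nat \<times> bool) \<Rightarrow> marked" where
  "marks_on A g v = (if v \<in> A then let (a, c, t) = g v in
     (a, if c = (if child t v \<in> A then fst (snd (g (child t v))) else 1) then Some t else None) else undefined)"

text \<open>Each vertex is compared with a single vertex above it, so adding the vertices from top to bottom
  makes every comparison succeed with probability \<open>1 / q\<close> whatever happened before.\<close>

lemma ex_marks_on:
  assumes "q \<ge> 1" "finite A"
  shows "ex (UNIV \<times> {1..q} \<times> UNIV) A (color_weight q \<delta> \<epsilon>) (\<lambda>g. \<phi> (marks_on A g))
    = ex UNIV A (marked_weight \<delta> \<epsilon> (1 / real q)) \<phi>"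
  using assms(2)
proof (induction "card A" arbitrary: A \<phi>)
  case 0
  then have "A = {}" by simp
  moreover have "marks_on {} (\<lambda>_. undefined) = (\<lambda>_. undefined)"
    by (auto simp: marks_on_def)
  ultimately show ?case by simp
next
  case (Suc n)
  let ?S = "UNIV \<times> {1..q} \<times> UNIV :: (arrows \<times> nat \<times> bool) set"
  have ne: "A \<noteq> {}" using Suc by auto
  \<comment> \<open>A lowest vertex is nobody's child within \<open>A\<close>, so adding it leaves
    the marks of all others unchanged.\<close>
  define m where "m = Min (snd ` A)"
  have "m \<in> snd ` A" unfolding m_def using ne Suc.prems by (intro Min_in) auto
  then obtain v where v: "v \<in> A" "snd v = m" by auto
  have low: "snd v \<le> snd u" if "u \<in> A" for u
    unfolding v m_def using that Suc.prems by (intro Min_le) auto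
  define B where "B = A - {v}"
  have A: "A = insert v B" "v \<notin> B" "finite B" "card B = n"
    using v Suc by (auto simp: B_def)
  define k where "k g t = (if child t v \<in> B then fst (snd (g (child t v))) else 1)"
    for g :: "vertex \<Rightarrow> arrows \<times> nat \<times> bool" and t
  have marks: "marks_on A (g(v := (a, c, t))) = (marks_on B g)(v := (a, if c = k g t then Some t else None))" for g a c t
  proof
    fix u
    have "child t v \<noteq> v" for t
      using snd_child[of t v] by (metis add_cancel_right_right one_neq_zero)
    moreover have "child t u \<noteq> v" if "u \<in> B" for t
      using low[of u] that A snd_child[of t u] by (metis insertCI linorder_not_le zle_add1_eq_le order_refl)
    ultimately show "marks_on A (g(v := (a, c, t))) u = ((marks_on B g)(v := (a, if c = k g t then Some t else None))) u"
      using A by (auto simp: marks_on_def k_def case_prod_unfold Let_def)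
  qed
  have marks': "marks_on A (g(v := p)) =
      (marks_on B g)(v := (fst p, if fst (snd p) = k g (snd (snd p)) then Some (snd (snd p)) else None))" for g p
    using marks[of g "fst p" "fst (snd p)" "snd (snd p)"] by simp
  have kq: "k g t \<in> {1..q}" if "g \<in> PiE B (\<lambda>_. ?S)" for g t
    using PiE_mem[OF that, of "child t v"] assms(1) by (auto simp: k_def mem_Times_iff)
  have inner: "(\<Sum>p\<in>?S. color_weight q \<delta> \<epsilon> p * \<psi> (fst p, if fst (snd p) = k g (snd (snd p)) then Some (snd (snd p)) else None))
      = (\<Sum>y\<in>UNIV. marked_weight \<delta> \<epsilon> (1 / real q) y * \<psi> y)" if g: "g \<in> PiE B (\<lambda>_. ?S)"
    for g and \<psi> :: "arrows \<times> bool option \<Rightarrow> real"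
  proof -
    \<comment> \<open>Exactly one of the \<open>q\<close> colors equals the color of the chosen
      child.\<close>
    have c: "(\<Sum>c\<in>{1..q}. \<psi> (a, if c = k g t then Some t else None)) = \<psi> (a, Some t) + (real q - 1) * \<psi> (a, None)" for a t
    proof -
      have "(\<Sum>c\<in>{1..q}. \<psi> (a, if c = k g t then Some t else None))
          = \<psi> (a, Some t) + (\<Sum>c\<in>{1..q} - {k g t}. \<psi> (a, if c = k g t then Some t else None))"
        using sum.remove[OF _ kq[OF g, of t], of "\<lambda>c. \<psi> (a, if c = k g t then Some t else None)"] by simp
      also have "(\<Sum>c\<in>{1..q} - {k g t}. \<psi> (a, if c = k g t then Some t else None)) = (\<Sum>c\<in>{1..q} - {k g t}. \<psi> (a, None))"
        by (rule sum.cong) auto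
      also have "\<dots> = (real q - 1) * \<psi> (a, None)"
        using kq[OF g, of t] by (simp add: of_nat_diff)
      finally show ?thesis .
    qed
    have "(\<Sum>p\<in>?S. color_weight q \<delta> \<epsilon> p * \<psi> (fst p, if fst (snd p) = k g (snd (snd p)) then Some (snd (snd p)) else None))
        = (\<Sum>a\<in>UNIV. \<Sum>c\<in>{1..q}. \<Sum>t\<in>UNIV. arrow_weight \<delta> \<epsilon> a * (1 / real q * (1 / 2)) * \<psi> (a, if c = k g t then Some t else None))"
      unfolding sum.cartesian_product color_weight_def by (simp add: case_prod_unfold)
    also have "\<dots> = (\<Sum>a\<in>UNIV. \<Sum>t\<in>UNIV. arrow_weight \<delta> \<epsilon> a * (1 / real q * (1 / 2)) *
        (\<Sum>c\<in>{1..q}. \<psi> (a, if c = k g t then Some t else None)))"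
      unfolding sum_distrib_left by (intro sum.cong refl sum.swap)
    also have "\<dots> = (\<Sum>a\<in>UNIV. arrow_weight \<delta> \<epsilon> a * (\<Sum>j\<in>UNIV. mark_weight (1 / real q) j * \<psi> (a, j)))"
      unfolding c using assms(1)
      by (intro sum.cong refl) (simp add: UNIV_mark UNIV_bool mark_weight_def field_simps)
    also have "\<dots> = (\<Sum>y\<in>UNIV. marked_weight \<delta> \<epsilon> (1 / real q) y * \<psi> y)"
      by (rule sum_marked_weight_mult[symmetric])
    finally show ?thesis .
  qed
  have "ex ?S A (color_weight q \<delta> \<epsilon>) (\<lambda>g. \<phi> (marks_on A g))
      = (\<Sum>p\<in>?S. color_weight q \<delta> \<epsilon> p * ex ?S B (color_weight q \<delta> \<epsilon>) (\<lambda>g. \<phi> (marks_on A (g(v := p)))))"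
    unfolding A(1) by (rule ex_insert) (use A in auto)
  also have "\<dots> = (\<Sum>p\<in>?S. color_weight q \<delta> \<epsilon> p * ex ?S B (color_weight q \<delta> \<epsilon>)
      (\<lambda>g. \<phi> ((marks_on B g)(v := (fst p, if fst (snd p) = k g (snd (snd p)) then Some (snd (snd p)) else None)))))"
    by (simp only: marks')
  also have "\<dots> = ex ?S B (color_weight q \<delta> \<epsilon>) (\<lambda>g. \<Sum>p\<in>?S. color_weight q \<delta> \<epsilon> p *
      \<phi> ((marks_on B g)(v := (fst p, if fst (snd p) = k g (snd (snd p)) then Some (snd (snd p)) else None))))"
    by (simp only: ex_sum ex_mult)
  also have "\<dots> = ex ?S B (color_weight q \<delta> \<epsilon>) (\<lambda>g. \<Sum>y\<in>UNIV. marked_weight \<delta> \<epsilon> (1 / real q) y * \<phi> ((marks_on B g)(v := y)))"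
    by (rule ex_cong) (rule inner)
  also have "\<dots> = ex UNIV B (marked_weight \<delta> \<epsilon> (1 / real q)) (\<lambda>f. \<Sum>y\<in>UNIV. marked_weight \<delta> \<epsilon> (1 / real q) y * \<phi> (f(v := y)))"
    by (rule Suc.hyps(1)) (use A in auto)
  also have "\<dots> = (\<Sum>y\<in>UNIV. marked_weight \<delta> \<epsilon> (1 / real q) y * ex UNIV B (marked_weight \<delta> \<epsilon> (1 / real q)) (\<lambda>f. \<phi> (f(v := y))))"
    by (simp only: ex_sum ex_mult)
  also have "\<dots> = ex UNIV A (marked_weight \<delta> \<epsilon> (1 / real q)) \<phi>"
    unfolding A(1) by (rule ex_insert[symmetric]) (use A in auto)
  finally show ?case .
qed

definition zip_on :: "'i set \<Rightarrow> ('i \<Rightarrow> 'a) \<Rightarrow> ('i \<Rightarrow> 'b) \<Rightarrow> 'i \<Rightarrow> 'a \<times> 'b" where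
  "zip_on I f g i = (if i \<in> I then (f i, g i) else undefined)"

text \<open>Combines separate expectations over arrows, colors and coins into one over triples, to
  which the law of the marks applies.\<close>

lemma ex_zip:
  assumes "finite S" "finite T" "finite I"
  shows "ex (S \<times> T) I (\<lambda>(a, b). u a * w b) \<phi> = ex S I u (\<lambda>f. ex T I w (\<lambda>g. \<phi> (zip_on I f g)))"
  using assms(3)
proof (induction I arbitrary: \<phi> rule: finite_induct)
  case empty
  have "zip_on {} f g = (\<lambda>_. undefined)" for f :: "'c \<Rightarrow> 'a" and g :: "'c \<Rightarrow> 'b"
    by (auto simp: zip_on_def)
  then show ?case by simp
next
  case (insert v I)
  have zip: "zip_on (insert v I) (f(v := a)) (g(v := b)) = (zip_on I f g)(v := (a, b))" for f g a b
    using insert.hyps by (auto simp: zip_on_def fun_eq_iff)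
  have "ex (S \<times> T) (insert v I) (\<lambda>(a, b). u a * w b) \<phi>
      = (\<Sum>p\<in>S \<times> T. (case p of (a, b) \<Rightarrow> u a * w b) * ex S I u (\<lambda>f. ex T I w (\<lambda>g. \<phi> ((zip_on I f g)(v := p)))))"
    using assms insert.hyps by (simp add: ex_insert insert.IH)
  also have "\<dots> = (\<Sum>a\<in>S. u a * (\<Sum>b\<in>T. w b * ex S I u (\<lambda>f. ex T I w (\<lambda>g. \<phi> ((zip_on I f g)(v := (a, b)))))))"
    unfolding sum_distrib_left sum.cartesian_product by (simp add: case_prod_unfold mult.assoc)
  also have "\<dots> = (\<Sum>a\<in>S. u a * ex S I u (\<lambda>f. ex T (insert v I) w (\<lambda>g. \<phi> (zip_on (insert v I) (f(v := a)) g))))"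
    using assms insert.hyps by (simp add: ex_insert zip ex_sum ex_mult)
  also have "\<dots> = ex S (insert v I) u (\<lambda>f. ex T (insert v I) w (\<lambda>g. \<phi> (zip_on (insert v I) f g)))"
    using assms insert.hyps by (simp add: ex_insert)
  finally show ?case .
qed

section \<open>Probability that a color depends on the initial row\<close>

lemma diminish_translate: "diminish (\<lambda>j. f (j - v)) (v + u) = diminish f u"
proof -
  have "child b (v + u) - v = child b u" for b
    by (cases v; cases u) (auto simp: child_def left_up_def right_up_def)
  then show ?thesis by (simp add: diminish_def)
qed

lemma path_of_length_translate:
  "path_of_length X n (v + u) = path_of_length (\<lambda>w. X (v + w)) n u"
proof (induction n arbitrary: u)
  case (Suc n)
  have child: "child b (v + u) = v + child b u" for b
    by (cases v; cases u) (auto simp: child_def left_up_def right_up_def)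
  show ?case
    unfolding path_of_length_Suc_child arrow_child_iff unfolding child Suc.IH ..
qed simp

lemma ex_cone_at_reaches:
  "ex UNIV (cone_at v n) (marked_weight \<delta> \<epsilon> s) (\<lambda>f. of_bool (path_of_length (diminish f) n v)) = reach_prob n \<delta> \<epsilon> s"
proof -
  have bij: "bij_betw (\<lambda>u. v + u) (light_cone n) (cone_at v n)"
    unfolding cone_at_def by (rule bij_betw_imageI) (auto intro: inj_onI)
  let ?k = "\<lambda>f j. if j \<in> cone_at v n then f (the_inv_into (light_cone n) (\<lambda>u. v + u) j) else undefined"
  have k: "?k f = (\<lambda>j. f (j - v))" if "f \<in> PiE (light_cone n) (\<lambda>_. UNIV)" for f :: marked
  proof
    fix j
    show "?k f j = f (j - v)"
    proof (cases "j \<in> cone_at v n")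
      case True
      then have "the_inv_into (light_cone n) (\<lambda>u. v + u) j = j - v"
        using bij by (intro the_inv_into_f_eq) (auto simp: bij_betw_def in_cone_at)
      then show ?thesis using True by simp
    next
      case False
      then show ?thesis using PiE_arb[OF that, of "j - v"] by (simp add: in_cone_at)
    qed
  qed
  have "ex UNIV (cone_at v n) (marked_weight \<delta> \<epsilon> s) (\<lambda>f. of_bool (path_of_length (diminish f) n v))
      = mex n \<delta> \<epsilon> s (\<lambda>f. of_bool (path_of_length (diminish (?k f)) n v))"
    by (rule ex_reindex[OF bij])
  also have "\<dots> = mex n \<delta> \<epsilon> s (\<lambda>f. of_bool (reaches n f))"
  proof (rule ex_cong)
    fix f :: marked assume f: "f \<in> PiE (light_cone n) (\<lambda>_. UNIV)"
    have "path_of_length (diminish (\<lambda>j. f (j - v))) n (v + (0, 0)) = path_of_length (diminish f) n (0, 0)"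
      unfolding path_of_length_translate diminish_translate ..
    then show "of_bool (path_of_length (diminish (?k f)) n v) = (of_bool (reaches n f) :: real)"
      unfolding k[OF f] reaches_def by (simp add: zero_prod_def[symmetric])
  qed
  finally show ?thesis
    by (simp add: reach_prob_def)
qed

text \<open>Quantifying over all initial colorings gives an event of the environment alone, hence
  bounds that are uniform in the initial distribution.\<close>

definition undetermined :: "nat \<Rightarrow> int \<Rightarrow> (vertex \<Rightarrow> arrows) \<Rightarrow> (vertex \<Rightarrow> nat) \<Rightarrow> bool" where
  "undetermined n x X Y \<longleftrightarrow> (\<exists>z z'. vertex_color z X Y n x \<noteq> vertex_color z' X Y n x)"

lemma undetermined_cong:
  assumes "\<And>u. u \<in> cone_at (x, - int n) n \<Longrightarrow> snd u \<le> - 1 \<Longrightarrow> X u = X' u \<and> Y u = Y' u"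
  shows "undetermined n x X Y = undetermined n x X' Y'"
proof -
  have "vertex_color z X Y n x = vertex_color z X' Y' n x" for z
    by (rule vertex_color_cong) (rule assms)
  then show ?thesis
    by (simp add: undetermined_def)
qed

text \<open>An undetermined color forces a diminished path for every outcome of the coins. Averaging
  over arrows, colors and coins together replaces color comparisons by independent marks of density
  \<open>1 / q\<close>.\<close>

lemma measure_undetermined_le:
  assumes \<delta>: "\<delta> \<in> {0..1}" "\<epsilon> \<in> {0..1}" and q: "q \<ge> 1" and v: "(x, - int (Suc n)) \<in> vertices"
  shows "{\<omega> \<in> space (env \<delta> \<epsilon> q). undetermined (Suc n) x (fst \<omega>) (snd \<omega>)} \<in> sets (env \<delta> \<epsilon> q)"
    and "measure (env \<delta> \<epsilon> q) {\<omega> \<in> space (env \<delta> \<epsilon> q). undetermined (Suc n) x (fst \<omega>) (snd \<omega>)}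
      \<le> reach_prob n \<delta> \<epsilon> (1 / real q)"
proof -
  let ?v = "(x, - int (Suc n))"
  define \<Lambda> where "\<Lambda> = cone_at ?v n"
  have \<Lambda>: "\<Lambda> \<subseteq> vertices" "finite \<Lambda>"
    unfolding \<Lambda>_def using cone_at_vertices[OF v] by auto
  \<comment> \<open>The cone of height \<open>n + 1\<close> reaches row 0; without that row it is
    the cone of height \<open>n\<close>.\<close>
  have sub: "u \<in> \<Lambda>" if "u \<in> cone_at ?v (Suc n)" "snd u \<le> - 1" for u
    using that by (cases u) (auto simp: \<Lambda>_def in_cone_at light_cone_def)
  have R: "undetermined (Suc n) x X Y = undetermined (Suc n) x X' Y'"
    if "\<And>v. v \<in> \<Lambda> \<Longrightarrow> X v = X' v \<and> Y v = Y' v" for X X' Y Y'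
    by (rule undetermined_cong) (use that sub in blast)
  note fd = env_finite_dim[OF \<delta> q \<Lambda>, of "undetermined (Suc n) x", OF R]
  show "{\<omega> \<in> space (env \<delta> \<epsilon> q). undetermined (Suc n) x (fst \<omega>) (snd \<omega>)} \<in> sets (env \<delta> \<epsilon> q)"
    by (rule fd(1))
  have nn: "0 \<le> arrow_weight \<delta> \<epsilon> a" for a
    using \<delta> by (intro arrow_weight_nonneg) auto
  let ?path = "\<lambda>X Y T. of_bool (path_of_length (diminish (marks_on \<Lambda> (zip_on \<Lambda> X (zip_on \<Lambda> Y T)))) n ?v) :: real"
  have path: "of_bool (undetermined (Suc n) x X Y) \<le> ?path X Y T"
    for X :: "vertex \<Rightarrow> arrows" and Y :: "vertex \<Rightarrow> nat" and T :: "vertex \<Rightarrow> bool"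
  proof -
    have "path_of_length (diminish (color_marks X Y T)) n ?v
        = path_of_length (diminish (marks_on \<Lambda> (zip_on \<Lambda> X (zip_on \<Lambda> Y T)))) n ?v"
    proof (rule path_of_length_cong)
      fix u assume u: "u \<in> cone_at ?v n" "snd u < snd ?v + int n"
      have "child b u \<in> \<Lambda>" for b
        using u by (cases u) (auto simp: \<Lambda>_def in_cone_at light_cone_def child_def left_up_def right_up_def)
      moreover have "u \<in> \<Lambda>" using u by (simp add: \<Lambda>_def)
      ultimately show "diminish (color_marks X Y T) u = diminish (marks_on \<Lambda> (zip_on \<Lambda> X (zip_on \<Lambda> Y T))) u"
        by (simp add: diminish_def color_marks_def marks_on_def zip_on_def)
    qed
    then show ?thesis
      using color_determined[of X Y T n x] unfolding undetermined_def by auto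
  qed
  have "measure (env \<delta> \<epsilon> q) {\<omega> \<in> space (env \<delta> \<epsilon> q). undetermined (Suc n) x (fst \<omega>) (snd \<omega>)}
      = aex \<Lambda> \<delta> \<epsilon> (\<lambda>X. ex {1..q} \<Lambda> (\<lambda>_. 1 / real q) (\<lambda>Y. of_bool (undetermined (Suc n) x X Y)))"
    by (rule fd(2))
  \<comment> \<open>The coins are inserted as an average of a constant.\<close>
  also have "\<dots> = aex \<Lambda> \<delta> \<epsilon> (\<lambda>X. ex {1..q} \<Lambda> (\<lambda>_. 1 / real q) (\<lambda>Y. ex UNIV \<Lambda> (\<lambda>_. 1 / 2)
      (\<lambda>T :: vertex \<Rightarrow> bool. of_bool (undetermined (Suc n) x X Y))))"
    using \<Lambda>(2) by (simp add: ex_const UNIV_bool)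
  also have "\<dots> \<le> aex \<Lambda> \<delta> \<epsilon> (\<lambda>X. ex {1..q} \<Lambda> (\<lambda>_. 1 / real q) (\<lambda>Y. ex UNIV \<Lambda> (\<lambda>_. 1 / 2) (?path X Y)))"
    by (intro ex_mono nn path) auto
  also have "\<dots> = aex \<Lambda> \<delta> \<epsilon> (\<lambda>X. ex ({1..q} \<times> UNIV) \<Lambda> (\<lambda>(c, t). 1 / real q * (1 / 2))
      (\<lambda>g. of_bool (path_of_length (diminish (marks_on \<Lambda> (zip_on \<Lambda> X g))) n ?v)))"
    by (subst ex_zip) (use \<Lambda>(2) in auto)
  also have "\<dots> = ex (UNIV \<times> {1..q} \<times> UNIV) \<Lambda> (\<lambda>(a, b). arrow_weight \<delta> \<epsilon> a * (case b of (c, t) \<Rightarrow> 1 / real q * (1 / 2)))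
      (\<lambda>g. of_bool (path_of_length (diminish (marks_on \<Lambda> g)) n ?v))"
    by (subst ex_zip) (use \<Lambda>(2) in auto)
  also have "(\<lambda>(a, b). arrow_weight \<delta> \<epsilon> a * (case b of (c :: nat, t :: bool) \<Rightarrow> 1 / real q * (1 / 2))) = color_weight q \<delta> \<epsilon>"
    by (auto simp: color_weight_def fun_eq_iff)
  also have "ex (UNIV \<times> {1..q} \<times> UNIV) \<Lambda> (color_weight q \<delta> \<epsilon>) (\<lambda>g. of_bool (path_of_length (diminish (marks_on \<Lambda> g)) n ?v))
      = ex UNIV \<Lambda> (marked_weight \<delta> \<epsilon> (1 / real q)) (\<lambda>f. of_bool (path_of_length (diminish f) n ?v))"
    by (rule ex_marks_on[OF q \<Lambda>(2)])
  also have "\<dots> = reach_prob n \<delta> \<epsilon> (1 / real q)"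
    unfolding \<Lambda>_def by (rule ex_cone_at_reaches)
  finally show "measure (env \<delta> \<epsilon> q) {\<omega> \<in> space (env \<delta> \<epsilon> q). undetermined (Suc n) x (fst \<omega>) (snd \<omega>)}
      \<le> reach_prob n \<delta> \<epsilon> (1 / real q)" .
qed

text \<open>Diminishing removes arrows, so every diminished path is a path of original
  arrows.\<close>

lemma reach_prob_le_path:
  assumes "\<delta> \<in> {0..1}" "\<epsilon> \<in> {0..1}" "0 \<le> s" "s \<le> 1"
  shows "reach_prob n \<delta> \<epsilon> s \<le> measure (arrow_measure \<delta> \<epsilon>) {X \<in> space (arrow_measure \<delta> \<epsilon>). path_of_length X n (0, 0)}"
proof -
  have nn: "0 \<le> arrow_weight \<delta> \<epsilon> a" "0 \<le> mark_weight s k" for a k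
    using assms by (auto intro: arrow_weight_nonneg mark_weight_nonneg)
  have "reach_prob n \<delta> \<epsilon> s = ex (UNIV \<times> UNIV) (light_cone n) (\<lambda>(a, b). arrow_weight \<delta> \<epsilon> a * mark_weight s b) (\<lambda>f. of_bool (reaches n f))"
    by (simp add: reach_prob_def marked_weight_def)
  also have "\<dots> = aex (light_cone n) \<delta> \<epsilon> (\<lambda>X. ex UNIV (light_cone n) (mark_weight s) (\<lambda>K. of_bool (reaches n (zip_on (light_cone n) X K))))"
    by (subst ex_zip) auto
  also have "\<dots> \<le> aex (light_cone n) \<delta> \<epsilon> (\<lambda>X. ex UNIV (light_cone n) (mark_weight s) (\<lambda>K. of_bool (path_of_length X n (0, 0))))"
  proof (intro ex_mono nn)
    fix X :: "vertex \<Rightarrow> arrows" and K :: "vertex \<Rightarrow> bool option"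
    have "path_of_length X n (0, 0)" if "reaches n (zip_on (light_cone n) X K)"
    proof -
      have "path_of_length (\<lambda>v. fst (zip_on (light_cone n) X K v)) n (0, 0)"
        by (rule path_of_length_mono[OF that[unfolded reaches_def]]) (auto simp: arrow_def diminish_def split: if_splits)
      also have "path_of_length (\<lambda>v. fst (zip_on (light_cone n) X K v)) n (0, 0) = path_of_length X n (0, 0)"
        by (rule path_of_length_light_cone_cong) (simp add: zip_on_def)
      finally show ?thesis .
    qed
    then show "of_bool (reaches n (zip_on (light_cone n) X K)) \<le> (of_bool (path_of_length X n (0, 0)) :: real)"
      by auto
  qed
  also have "\<dots> = aex (light_cone n) \<delta> \<epsilon> (\<lambda>X. of_bool (path_of_length X n (0, 0)))"
    by (simp add: ex_const sum_mark_weight)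
  also have "\<dots> = measure (arrow_measure \<delta> \<epsilon>) {X \<in> space (arrow_measure \<delta> \<epsilon>). path_of_length X n (0, 0)}"
    using assms light_cone_subset_vertices by (intro measure_path_of_length[symmetric]) auto
  finally show ?thesis .
qed

text \<open>The parameter \<open>\<kappa>\<close> is the rate at which marks compensate for a lower death rate.\<close>

lemma reach_prob_tendsto_0_below_threshold:
  assumes \<delta>: "0 < \<delta>" "\<delta> \<le> 1" and s: "0 < s" "s \<le> 1"
  shows "\<exists>\<epsilon>'<percolation_threshold \<delta>. \<forall>\<epsilon>\<in>{0..1}. \<epsilon> > \<epsilon>' \<longrightarrow> (\<lambda>n. reach_prob n \<delta> \<epsilon> s) \<longlonglongrightarrow> 0"
proof -
  define c where "c = percolation_threshold \<delta>"
  have c: "0 < c" "c \<le> 1 / 2"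
    using percolation_threshold_bounds[OF \<delta>] by (auto simp: c_def)
  \<comment> \<open>Here \<open>32 = 4 * 2 * 4\<close>: the exchange rate needs the 4, and along the
    segment the death rate is at least \<open>c / 2\<close> and its complement at least 1/4.\<close>
  define \<kappa> where "\<kappa> = \<delta> * c / 32"
  have \<kappa>: "0 < \<kappa>" using \<delta> c by (simp add: \<kappa>_def)
  have "\<kappa> \<le> 1 * c / 32"
    unfolding \<kappa>_def using \<delta> c by (intro divide_right_mono mult_right_mono) auto
  moreover have "\<kappa> * s \<le> \<kappa> * 1"
    using s \<kappa> by (intro mult_left_mono) auto
  moreover have "0 < \<kappa> * s"
    using s \<kappa> by simp
  ultimately have \<kappa>s: "0 < \<kappa> * s" "\<kappa> * s \<le> c / 32"
    by auto
  \<comment> \<open>Marks of density \<open>s\<close> allow lowering the death rate by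
    \<open>\<kappa> * s\<close>. Starting less than half of that above \<open>c\<close>, the lowered
    rate lies below \<open>c - \<kappa> * s / 2\<close>.\<close>
  obtain \<epsilon>\<^sub>1 where \<epsilon>\<^sub>1: "c \<le> \<epsilon>\<^sub>1" "\<epsilon>\<^sub>1 < c + \<kappa> * s / 2" "\<epsilon>\<^sub>1 \<le> 1" "percolation_prob \<delta> \<epsilon>\<^sub>1 = 0"
    using percolation_threshold_bounds(3)[OF \<delta>, of "c + \<kappa> * s / 2"] \<kappa>s unfolding c_def by auto
  have "(\<lambda>n. reach_prob n \<delta> \<epsilon> s) \<longlonglongrightarrow> 0" if \<epsilon>: "\<epsilon> \<in> {0..1}" "\<epsilon> > c - \<kappa> * s / 2" for \<epsilon>
  proof (rule tendsto_sandwich[OF _ _ tendsto_const])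
    let ?m = "\<lambda>n. measure (arrow_measure \<delta> \<epsilon>\<^sub>1) {X \<in> space (arrow_measure \<delta> \<epsilon>\<^sub>1). path_of_length X n (0, 0)}"
    have pos: "c / 2 \<le> \<epsilon>\<^sub>1 - \<kappa> * s" "1 / 4 \<le> 1 - \<epsilon>\<^sub>1"
      using \<epsilon>\<^sub>1 \<kappa>s c by linarith+
    have "reach_prob n \<delta> \<epsilon> s \<le> ?m n" for n
    proof -
      have "reach_prob n \<delta> \<epsilon> s \<le> reach_prob n \<delta> (\<epsilon>\<^sub>1 - \<kappa> * s) s"
        using \<delta> s \<epsilon> \<epsilon>\<^sub>1 pos c by (intro reach_prob_antimono) auto
      also have "\<dots> \<le> reach_prob n \<delta> \<epsilon>\<^sub>1 0"
      proof (rule reach_prob_tradeoff)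
        have "4 * \<kappa> = \<delta> * (c / 2) * (1 / 4)"
          by (simp add: \<kappa>_def)
        also have "\<dots> \<le> \<delta> * (\<epsilon>\<^sub>1 - \<kappa> * s) * (1 - \<epsilon>\<^sub>1)"
          using pos \<delta> c by (intro mult_mono) auto
        finally show "4 * \<kappa> \<le> \<delta> * (\<epsilon>\<^sub>1 - \<kappa> * s) * (1 - \<epsilon>\<^sub>1)" .
        show "0 < \<epsilon>\<^sub>1 - \<kappa> * s" using pos c by linarith
      qed (use \<delta> s \<kappa> \<epsilon>\<^sub>1 in auto)
      also have "\<dots> \<le> ?m n"
        using \<delta> \<epsilon>\<^sub>1 c by (intro reach_prob_le_path) auto
      finally show ?thesis .
    qed
    then show "\<forall>\<^sub>F n in sequentially. reach_prob n \<delta> \<epsilon> s \<le> ?m n"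
      by simp
    show "\<forall>\<^sub>F n in sequentially. 0 \<le> reach_prob n \<delta> \<epsilon> s"
      using \<delta> s \<epsilon> unfolding reach_prob_def
      by (intro always_eventually allI ex_nonneg marked_weight_nonneg) auto
    show "?m \<longlonglongrightarrow> 0"
      using measure_path_tendsto[of \<delta> \<epsilon>\<^sub>1] \<epsilon>\<^sub>1(4) by simp
  qed
  then show ?thesis
    using \<kappa>s unfolding c_def by (intro exI[of _ "percolation_threshold \<delta> - \<kappa> * s / 2"]) auto
qed

section \<open>Convergence of configurations\<close>

lemma space_config: "space (config_space q) = PiE UNIV (\<lambda>_. {1..q})"
  by (simp add: config_space_def space_PiM)

lemma topspace_config: "topspace (config_topology q) = PiE UNIV (\<lambda>_. {1..q})"
  by (simp add: config_topology_def)

lemma measurable_config_component: "(\<lambda>z. z k) \<in> measurable (config_space q) (count_space {1..q})"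
  unfolding config_space_def by (rule measurable_component_singleton) simp

lemma continuous_config_tendsto:
  assumes f: "continuous_map (config_topology q) euclideanreal f"
    and g: "\<And>n. g n \<in> space (config_space q)" "l \<in> space (config_space q)"
    and ev: "\<And>k. \<forall>\<^sub>F n in sequentially. g n k = l k"
  shows "(\<lambda>n. f (g n)) \<longlonglongrightarrow> f l"
proof -
  have l: "l k \<in> {1..q}" for k
    using g(2) unfolding space_config by blast
  have "limitin (discrete_topology {1..q}) (\<lambda>n. g n k) (l k) sequentially" for k
    unfolding limitin_def using l[of k] ev[of k] by (auto elim: eventually_mono)
  then have "limitin (config_topology q) g l sequentially"
    unfolding config_topology_def limitin_componentwise
    using g by (auto simp: space_config intro!: always_eventually)
  then have "limitin euclideanreal (f \<circ> g) (f l) sequentially"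
    by (rule continuous_map_limit[OF f])
  then show ?thesis
    by (simp add: limitin_canonical_iff comp_def)
qed

text \<open>A continuous function is the limit of its values at configurations set to 1 outside a
  window. Each of these approximations depends on finitely many coordinates with finitely many
  values.\<close>

lemma continuous_config_measurable:
  assumes f: "continuous_map (config_topology q) euclideanreal f" and q: "q \<ge> 1"
  shows "f \<in> borel_measurable (config_space q)"
proof -
  define cut where "cut m g k = (if \<bar>k\<bar> \<le> int m then g k else 1)" for m and g :: "int \<Rightarrow> nat" and k
  have cut: "cut m g \<in> space (config_space q)" if "g \<in> space (config_space q)" for m g
    using that q unfolding space_config by (auto simp: cut_def PiE_iff)
  have "(\<lambda>z. f (cut m z)) \<in> borel_measurable (config_space q)" for m
  proof -
    let ?J = "{- int m..int m}"
    let ?P = "PiE ?J (\<lambda>_. {1..q})"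
    have eq: "f (cut m z) = (\<Sum>g\<in>?P. indicator {z. \<forall>k\<in>?J. z k = g k} z * f (cut m g))" if z: "z \<in> space (config_space q)" for z
    proof -
      have r: "restrict z ?J \<in> ?P" using z unfolding space_config by auto
      have "(\<Sum>g\<in>?P. indicator {z. \<forall>k\<in>?J. z k = g k} z * f (cut m g))
          = (\<Sum>g\<in>{restrict z ?J}. indicator {z. \<forall>k\<in>?J. z k = g k} z * f (cut m g))"
      proof (rule sum.mono_neutral_right)
        show "finite ?P" by (intro finite_PiE) auto
        show "\<forall>g\<in>?P - {restrict z ?J}. indicator {z. \<forall>k\<in>?J. z k = g k} z * f (cut m g) = 0"
        proof
          fix g assume g: "g \<in> ?P - {restrict z ?J}"
          have "\<not> (\<forall>k\<in>?J. z k = g k)"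
          proof
            assume "\<forall>k\<in>?J. z k = g k"
            then have "g = restrict z ?J"
              using g r by (intro PiE_ext[of g ?J "\<lambda>_. {1..q}"]) auto
            then show False using g by simp
          qed
          then show "indicator {z. \<forall>k\<in>?J. z k = g k} z * f (cut m g) = 0"
            by (simp add: indicator_def)
        qed
      qed (use r in auto)
      also have "\<dots> = f (cut m (restrict z ?J))"
        by simp
      also have "cut m (restrict z ?J) = cut m z"
        by (auto simp: cut_def fun_eq_iff)
      finally show ?thesis by simp
    qed
    have "(\<lambda>z. \<Sum>g\<in>?P. indicator {z. \<forall>k\<in>?J. z k = g k} z * f (cut m g)) \<in> borel_measurable (config_space q)"
    proof (intro borel_measurable_sum borel_measurable_times borel_measurable_const borel_measurable_indicator')
      fix g
      have "{z \<in> space (config_space q). z k = g k} \<in> sets (config_space q)" for k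
        using measurable_compose[OF measurable_config_component[of k q], of "\<lambda>c. c = g k"]
        by (simp add: pred_def)
      then have "{z \<in> space (config_space q). \<forall>k\<in>?J. z k = g k} \<in> sets (config_space q)"
        by (intro sets.sets_Collect_finite_All') auto
      then show "{x \<in> space (config_space q). x \<in> {z. \<forall>k\<in>?J. z k = g k}} \<in> sets (config_space q)"
        by simp
    qed
    then show ?thesis
      by (subst measurable_cong[OF eq])
  qed
  moreover have "(\<lambda>m. f (cut m z)) \<longlonglongrightarrow> f z" if z: "z \<in> space (config_space q)" for z
  proof (rule continuous_config_tendsto[OF f cut[OF z] z])
    show "\<forall>\<^sub>F m in sequentially. cut m z k = z k" for k
      using eventually_ge_at_top[of "nat \<bar>k\<bar>"] by eventually_elim (auto simp: cut_def)
  qed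
  ultimately show ?thesis
    by (rule borel_measurable_LIMSEQ_real[rotated])
qed

text \<open>Weak convergence from almost sure coordinatewise convergence on one space, by dominated
  convergence.\<close>

lemma integral_coupling_tendsto:
  assumes M: "prob_space M" and H: "\<And>n. H n \<in> measurable M (config_space q)" "H' \<in> measurable M (config_space q)"
    and ae: "AE x in M. \<forall>k. \<forall>\<^sub>F n in sequentially. H n x k = H' x k"
    and f: "continuous_map (config_topology q) euclideanreal f" "bounded (f ` topspace (config_topology q))"
    and q: "q \<ge> 1"
  shows "(\<lambda>n. integral\<^sup>L (distr M (config_space q) (H n)) f) \<longlonglongrightarrow> integral\<^sup>L (distr M (config_space q) H') f"
proof -
  interpret M: prob_space M by fact
  note fm = continuous_config_measurable[OF f(1) q]
  obtain B where B: "\<bar>f z\<bar> \<le> B" if "z \<in> space (config_space q)" for z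
  proof -
    obtain B where "\<forall>x\<in>f ` topspace (config_topology q). norm x \<le> B"
      using f(2) unfolding bounded_iff by blast
    then show ?thesis
      by (intro that[of B]) (simp add: topspace_config space_config)
  qed
  have "(\<lambda>n. integral\<^sup>L M (\<lambda>x. f (H n x))) \<longlonglongrightarrow> integral\<^sup>L M (\<lambda>x. f (H' x))"
  proof (rule integral_dominated_convergence[where w = "\<lambda>_. B"])
    show "AE x in M. (\<lambda>n. f (H n x)) \<longlonglongrightarrow> f (H' x)"
      using ae
    proof (rule AE_mp, intro AE_I2 impI)
      fix x assume "x \<in> space M" "\<forall>k. \<forall>\<^sub>F n in sequentially. H n x k = H' x k"
      then show "(\<lambda>n. f (H n x)) \<longlonglongrightarrow> f (H' x)"
        using measurable_space[OF H(1)] measurable_space[OF H(2)]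
        by (intro continuous_config_tendsto[OF f(1)]) auto
    qed
    show "AE x in M. norm (f (H n x)) \<le> B" for n
      using measurable_space[OF H(1)] B by (intro AE_I2) auto
  qed (use measurable_compose[OF H(1) fm] measurable_compose[OF H(2) fm] in auto)
  then show ?thesis
    using H fm by (simp add: integral_distr)
qed

lemma continuous_config_cylinder:
  assumes "finite J"
  shows "continuous_map (config_topology q) euclideanreal (\<lambda>z. \<Prod>k\<in>J. indicator (A k) (z k))"
proof (rule continuous_map_prod[OF assms])
  fix k
  have "continuous_map (config_topology q) (discrete_topology {1..q}) (\<lambda>z. z k)"
    unfolding config_topology_def by (rule continuous_map_product_projection) simp
  moreover have "continuous_map (discrete_topology {1..q}) euclideanreal (indicator (A k) :: nat \<Rightarrow> real)"
    by simp
  ultimately have "continuous_map (config_topology q) euclideanreal (indicator (A k) \<circ> (\<lambda>z. z k) :: _ \<Rightarrow> real)"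
    by (rule continuous_map_compose)
  then show "continuous_map (config_topology q) euclideanreal (\<lambda>z. indicator (A k) (z k) :: real)"
    by (simp only: comp_def)
qed

text \<open>Colors are discrete, so indicators of cylinders are continuous, and cylinders determine
  the measure.\<close>

lemma config_measure_eqI:
  assumes M: "initial_distribution q M" "initial_distribution q N"
    and eq: "\<And>f. continuous_map (config_topology q) euclideanreal f \<Longrightarrow> bounded (f ` topspace (config_topology q)) \<Longrightarrow>
      integral\<^sup>L M f = integral\<^sup>L N f"
  shows "M = N"
proof (rule measure_eqI_PiM_infinite[where I = UNIV and M = "\<lambda>_. count_space {1..q}"])
  interpret M: prob_space M using M by (simp add: initial_distribution_def)
  interpret N: prob_space N using M by (simp add: initial_distribution_def)
  show sets: "sets M = sets (\<Pi>\<^sub>M i\<in>UNIV. count_space {1..q})" "sets N = sets (\<Pi>\<^sub>M i\<in>UNIV. count_space {1..q})"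
    using M by (simp_all add: initial_distribution_def config_space_def)
  show "finite_measure M" by unfold_locales
  fix A :: "int \<Rightarrow> nat set" and J :: "int set"
  assume J: "finite J" "J \<subseteq> UNIV" "\<And>i. i \<in> J \<Longrightarrow> A i \<in> sets (count_space {1..q})"
  let ?E = "prod_emb UNIV (\<lambda>_. count_space {1..q}) J (PiE J A)"
  let ?f = "\<lambda>z. \<Prod>k\<in>J. indicator (A k) (z k) :: real"
  have E: "?E \<in> sets (\<Pi>\<^sub>M i\<in>UNIV. count_space {1..q})"
    using J by (intro sets_PiM_I) auto
  have f: "?f z = indicator ?E z" if "z \<in> space (config_space q)" for z
  proof (cases "\<forall>k\<in>J. z k \<in> A k")
    case True
    then show ?thesis
      using that by (auto simp: prod_emb_def space_config PiE_iff)
  next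
    case False
    then obtain k where "k \<in> J" "z k \<notin> A k" by auto
    then have "?f z = 0"
      using J(1) by (intro prod_zero bexI[of _ k]) auto
    then show ?thesis
      using False by (auto simp: prod_emb_def indicator_def)
  qed
  have spM: "space M = space (config_space q)" "space N = space (config_space q)"
    using sets by (auto simp: config_space_def dest: sets_eq_imp_space_eq)
  have "norm (?f z) \<le> 1" for z
    unfolding prod_norm[symmetric] by (rule prod_le_1) (simp add: indicator_def)
  then have "bounded (?f ` topspace (config_topology q))"
    by (intro boundedI[of _ 1]) blast
  then have "integral\<^sup>L M ?f = integral\<^sup>L N ?f"
    by (rule eq[OF continuous_config_cylinder[OF J(1)]])
  moreover have "integral\<^sup>L M ?f = integral\<^sup>L M (indicator ?E)" "integral\<^sup>L N ?f = integral\<^sup>L N (indicator ?E)"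
    by (rule Bochner_Integration.integral_cong[OF refl], rule f, simp only: spM)+
  moreover have "?E \<in> sets M" "?E \<in> sets N"
    using E sets by auto
  ultimately have "measure M ?E = measure N ?E"
    using sets.sets_into_space[of ?E M] sets.sets_into_space[of ?E N] by (simp add: Int_absorb1)
  then show "emeasure M ?E = emeasure N ?E"
    by (simp add: M.emeasure_eq_measure N.emeasure_eq_measure)
qed

section \<open>Shifting and merging environments\<close>

lemma distr_snd:
  assumes "prob_space M" "prob_space N"
  shows "distr (M \<Otimes>\<^sub>M N) N snd = N"
proof (rule measure_eqI)
  interpret M: prob_space M by fact
  interpret N: prob_space N by fact
  fix A assume "A \<in> sets (distr (M \<Otimes>\<^sub>M N) N snd)"
  then have A: "A \<in> sets N" by simp
  have "snd -` A \<inter> space (M \<Otimes>\<^sub>M N) = space M \<times> A"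
    using sets.sets_into_space[OF A] by (auto simp: space_pair_measure)
  then show "emeasure (distr (M \<Otimes>\<^sub>M N) N snd) A = emeasure N A"
    using A by (simp add: emeasure_distr N.emeasure_pair_measure_Times M.emeasure_space_1)
qed simp

lemma nn_integral_pair_prod:
  assumes "sigma_finite_measure N" and F: "F \<in> borel_measurable M" and G: "G \<in> borel_measurable N"
  shows "(\<integral>\<^sup>+p. F (fst p) * G (snd p) \<partial>(M \<Otimes>\<^sub>M N)) = (\<integral>\<^sup>+x. F x \<partial>M) * (\<integral>\<^sup>+y. G y \<partial>N)"
proof -
  interpret N: sigma_finite_measure N by fact
  note [measurable] = F G
  have "(\<integral>\<^sup>+p. F (fst p) * G (snd p) \<partial>(M \<Otimes>\<^sub>M N)) = (\<integral>\<^sup>+x. \<integral>\<^sup>+y. F x * G y \<partial>N \<partial>M)"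
    by (subst N.nn_integral_fst[symmetric]) simp_all
  then show ?thesis
    by (simp add: nn_integral_cmult nn_integral_multc)
qed

text \<open>Each coordinate is read from one of two independent i.i.d. fields, and injectivity of
  \<open>h\<close> ensures that no coordinate is read twice.\<close>

lemma distr_merge_PiM:
  assumes N: "prob_space N" and h: "inj_on h V" "h ` V \<subseteq> V"
  defines "P \<equiv> \<Pi>\<^sub>M i\<in>V. N"
  shows "(\<lambda>(f, g). \<lambda>v\<in>V. if v \<in> A then f v else g (h v)) \<in> measurable (P \<Otimes>\<^sub>M P) P"
    and "distr (P \<Otimes>\<^sub>M P) P (\<lambda>(f, g). \<lambda>v\<in>V. if v \<in> A then f v else g (h v)) = P"
proof -
  let ?m = "\<lambda>(f, g). \<lambda>v\<in>V. if v \<in> A then f v else g (h v)"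
  have hV: "h v \<in> V" if "v \<in> V" for v using h that by auto
  show m: "?m \<in> measurable (P \<Otimes>\<^sub>M P) P"
    unfolding P_def case_prod_unfold
  proof (rule measurable_restrict)
    fix v assume v: "v \<in> V"
    show "(\<lambda>x. if v \<in> A then fst x v else snd x (h v)) \<in> measurable (PiM V (\<lambda>_. N) \<Otimes>\<^sub>M PiM V (\<lambda>_. N)) N"
      using v hV[OF v] by (cases "v \<in> A") simp_all
  qed
  interpret P: prob_space P
    unfolding P_def by (intro prob_space_PiM N)
  show "distr (P \<Otimes>\<^sub>M P) P ?m = P"
  proof (rule measure_eqI_PiM_infinite[symmetric, where I = V and M = "\<lambda>_. N"])
    show "finite_measure P" by unfold_locales
    fix J E assume J: "finite J" "J \<subseteq> V" "\<And>i. i \<in> J \<Longrightarrow> E i \<in> sets N"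
    let ?emb = "\<lambda>J E. prod_emb V (\<lambda>_. N) J (PiE J E)"
    define J1 where "J1 = J \<inter> A"
    define J2 where "J2 = J - A"
    have inj: "inj_on h J2" using h J by (auto simp: J2_def intro: inj_on_subset)
    let ?E2 = "\<lambda>u. E (the_inv_into J2 h u)"
    have E2: "?E2 (h v) = E v" if "v \<in> J2" for v
      by (simp add: the_inv_into_f_f[OF inj that])
    have s: "?emb J1 E \<in> sets P" "?emb (h ` J2) ?E2 \<in> sets P" "?emb J E \<in> sets P"
      unfolding P_def using J h E2 by (auto intro!: sets_PiM_I simp: J1_def J2_def)
    have "?m -` ?emb J E \<inter> space (P \<Otimes>\<^sub>M P) = ?emb J1 E \<times> ?emb (h ` J2) ?E2"
    proof (intro set_eqI iffI)
      fix p assume p: "p \<in> ?m -` ?emb J E \<inter> space (P \<Otimes>\<^sub>M P)"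
      then have sp: "fst p \<in> space P" "snd p \<in> space P" by (auto simp: space_pair_measure)
      have "(if v \<in> A then fst p v else snd p (h v)) \<in> E v" if "v \<in> J" for v
        using p that J(2) by (auto simp: prod_emb_def PiE_iff case_prod_unfold split: if_splits)
      then have f1: "fst p v \<in> E v" if "v \<in> J1" for v
        using that by (force simp: J1_def)
      have f2: "snd p (h v) \<in> ?E2 (h v)" if "v \<in> J2" for v
        using p that J(2) unfolding E2[OF that] by (auto simp: J2_def prod_emb_def PiE_iff case_prod_unfold split: if_splits)
      have "fst p \<in> ?emb J1 E"
        using sp(1) f1 by (simp add: prod_emb_def P_def space_PiM PiE_iff)
      moreover have "snd p \<in> ?emb (h ` J2) ?E2"
        using sp(2) f2 by (simp add: prod_emb_def P_def space_PiM PiE_iff)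
      ultimately show "p \<in> ?emb J1 E \<times> ?emb (h ` J2) ?E2"
        by (simp add: mem_Times_iff)
    next
      fix p assume "p \<in> ?emb J1 E \<times> ?emb (h ` J2) ?E2"
      then have p: "fst p \<in> ?emb J1 E" "snd p \<in> ?emb (h ` J2) ?E2" by auto
      then have sp: "p \<in> space (P \<Otimes>\<^sub>M P)"
        by (auto simp: space_pair_measure mem_Times_iff P_def space_PiM prod_emb_def)
      have "(if v \<in> A then fst p v else snd p (h v)) \<in> E v" if "v \<in> J" for v
      proof (cases "v \<in> A")
        case True
        then show ?thesis using p(1) that by (auto simp: prod_emb_def J1_def PiE_iff)
      next
        case False
        then have "v \<in> J2" using that by (simp add: J2_def)
        then have "snd p (h v) \<in> ?E2 (h v)" using p(2) by (auto simp: prod_emb_def PiE_iff)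
        then show ?thesis using False E2[OF \<open>v \<in> J2\<close>] by simp
      qed
      moreover have "?m p \<in> space P" using measurable_space[OF m sp] .
      ultimately show "p \<in> ?m -` ?emb J E \<inter> space (P \<Otimes>\<^sub>M P)"
        using sp J(2) by (auto simp: prod_emb_def P_def space_PiM case_prod_unfold restrict_def PiE_iff extensional_def subset_eq)
    qed
    then have "emeasure (distr (P \<Otimes>\<^sub>M P) P ?m) (?emb J E) = emeasure P (?emb J1 E) * emeasure P (?emb (h ` J2) ?E2)"
      using s m by (simp add: emeasure_distr P.emeasure_pair_measure_Times)
    also have "emeasure P (?emb J1 E) = (\<Prod>i\<in>J1. emeasure N (E i))"
      unfolding P_def using J N by (intro emeasure_PiM_emb) (auto simp: J1_def)
    also have "emeasure P (?emb (h ` J2) ?E2) = (\<Prod>u\<in>h ` J2. emeasure N (?E2 u))"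
      unfolding P_def using J N h E2 by (intro emeasure_PiM_emb) (auto simp: J2_def)
    also have "\<dots> = (\<Prod>i\<in>J2. emeasure N (E i))"
      by (subst prod.reindex[OF inj]) (simp add: E2)
    also have "(\<Prod>i\<in>J1. emeasure N (E i)) * (\<Prod>i\<in>J2. emeasure N (E i)) = (\<Prod>i\<in>J. emeasure N (E i))"
      unfolding J1_def J2_def using prod.Int_Diff[OF J(1), of "\<lambda>i. emeasure N (E i)" A] by simp
    also have "\<dots> = emeasure P (?emb J E)"
      unfolding P_def using J N by (intro emeasure_PiM_emb[symmetric]) auto
    finally show "emeasure P (?emb J E) = emeasure (distr (P \<Otimes>\<^sub>M P) P ?m) (?emb J E)"
      by (rule sym)
  qed (simp_all add: P_def)
qed

text \<open>The shift is diagonal because the identification of rows with the integers uses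
  \<open>x + n\<close>: it changes the row number and keeps the index within the row.\<close>

definition shift :: "int \<Rightarrow> (vertex \<Rightarrow> 'a) \<Rightarrow> vertex \<Rightarrow> 'a" where
  "shift i f = (\<lambda>v\<in>vertices. f (v + (i, i)))"

text \<open>Rows up to \<open>n\<close> come from \<open>f\<close>, and row \<open>n + k\<close>
  below them is row \<open>k\<close> of \<open>g\<close>. It makes the last step of the process use
  fresh randomness.\<close>

definition merge_rows :: "nat \<Rightarrow> (vertex \<Rightarrow> 'a) \<Rightarrow> (vertex \<Rightarrow> 'a) \<Rightarrow> vertex \<Rightarrow> 'a" where
  "merge_rows n f g = (\<lambda>v\<in>vertices. if - int n \<le> snd v then f v else g (v + (int n, int n)))"

lemma diagonal_vertices [simp]: "v + (i, i) \<in> vertices \<longleftrightarrow> v \<in> vertices"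
  by (cases v) (auto simp: vertices_def)

lemma shift_shift: "shift i (shift j f) = shift (i + j) f"
  by (auto simp: shift_def fun_eq_iff add_ac)

lemma inj_diagonal: "inj_on (\<lambda>v. v + (i, i)) A" for A :: "vertex set"
  by (rule inj_onI) simp

lemma shift_PiM:
  assumes "prob_space N"
  shows "shift i \<in> measurable (\<Pi>\<^sub>M v\<in>vertices. N) (\<Pi>\<^sub>M v\<in>vertices. N)"
    and "distr (\<Pi>\<^sub>M v\<in>vertices. N) (\<Pi>\<^sub>M v\<in>vertices. N) (shift i) = (\<Pi>\<^sub>M v\<in>vertices. N)"
proof -
  show "shift i \<in> measurable (\<Pi>\<^sub>M v\<in>vertices. N) (\<Pi>\<^sub>M v\<in>vertices. N)"
    unfolding shift_def[abs_def] by (intro measurable_restrict measurable_component_singleton) simp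
  show "distr (\<Pi>\<^sub>M v\<in>vertices. N) (\<Pi>\<^sub>M v\<in>vertices. N) (shift i) = (\<Pi>\<^sub>M v\<in>vertices. N)"
    unfolding shift_def[abs_def]
    by (rule distr_PiM_reindex[of vertices "\<lambda>_. N"]) (use assms inj_diagonal in auto)
qed

lemma merge_rows_PiM:
  assumes "prob_space N"
  defines "P \<equiv> \<Pi>\<^sub>M v\<in>vertices. N"
  shows "(\<lambda>(f, g). merge_rows n f g) \<in> measurable (P \<Otimes>\<^sub>M P) P"
    and "distr (P \<Otimes>\<^sub>M P) P (\<lambda>(f, g). merge_rows n f g) = P"
proof -
  have h: "inj_on (\<lambda>v. v + (int n, int n)) vertices" "(\<lambda>v. v + (int n, int n)) ` vertices \<subseteq> vertices"
    by (rule inj_diagonal) (rule image_subsetI, simp only: diagonal_vertices)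
  note * = distr_merge_PiM[OF assms(1) h, of "{v. - int n \<le> snd v}"]
  show "(\<lambda>(f, g). merge_rows n f g) \<in> measurable (P \<Otimes>\<^sub>M P) P"
    using *(1) by (simp add: merge_rows_def P_def)
  show "distr (P \<Otimes>\<^sub>M P) P (\<lambda>(f, g). merge_rows n f g) = P"
    using *(2) by (simp add: merge_rows_def P_def)
qed

lemma distr_fst:
  assumes "prob_space M" "prob_space N"
  shows "distr (M \<Otimes>\<^sub>M N) M fst = M"
proof (rule measure_eqI)
  interpret M: prob_space M by fact
  interpret N: prob_space N by fact
  fix A assume "A \<in> sets (distr (M \<Otimes>\<^sub>M N) M fst)"
  then have A: "A \<in> sets M" by simp
  have "fst -` A \<inter> space (M \<Otimes>\<^sub>M N) = A \<times> space N"
    using sets.sets_into_space[OF A] by (auto simp: space_pair_measure)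
  then show "emeasure (distr (M \<Otimes>\<^sub>M N) M fst) A = emeasure M A"
    using A by (simp add: emeasure_distr N.emeasure_pair_measure_Times N.emeasure_space_1)
qed simp

definition env_shift :: "int \<Rightarrow> (vertex \<Rightarrow> arrows) \<times> (vertex \<Rightarrow> nat) \<Rightarrow> (vertex \<Rightarrow> arrows) \<times> (vertex \<Rightarrow> nat)" where
  "env_shift i = (\<lambda>(X, Y). (shift i X, shift i Y))"

definition env_merge :: "nat \<Rightarrow> (vertex \<Rightarrow> arrows) \<times> (vertex \<Rightarrow> nat) \<Rightarrow> (vertex \<Rightarrow> arrows) \<times> (vertex \<Rightarrow> nat)
    \<Rightarrow> (vertex \<Rightarrow> arrows) \<times> (vertex \<Rightarrow> nat)" where
  "env_merge n \<omega> \<omega>' = (merge_rows n (fst \<omega>) (fst \<omega>'), merge_rows n (snd \<omega>) (snd \<omega>'))"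

lemma env_shift:
  assumes q: "q \<ge> 1"
  shows "env_shift i \<in> measurable (env \<delta> \<epsilon> q) (env \<delta> \<epsilon> q)"
    and "distr (env \<delta> \<epsilon> q) (env \<delta> \<epsilon> q) (env_shift i) = env \<delta> \<epsilon> q"
proof -
  have U: "prob_space (uniform_count_measure {1..q})"
    using q by (intro prob_space_uniform_count_measure) auto
  note a = shift_PiM[OF prob_space_measure_pmf[of "arrows_pmf \<delta> \<epsilon>"], of i, folded arrow_measure_def]
  note c = shift_PiM[OF U, of i, folded color_measure_def]
  interpret C: prob_space "color_measure q" by (rule prob_space_color_measure[OF q])
  show m: "env_shift i \<in> measurable (env \<delta> \<epsilon> q) (env \<delta> \<epsilon> q)"
    unfolding env_shift_def case_prod_unfold
    by (rule measurable_Pair[OF measurable_compose[OF measurable_fst a(1)] measurable_compose[OF measurable_snd c(1)]])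
  have "env \<delta> \<epsilon> q = distr (arrow_measure \<delta> \<epsilon>) (arrow_measure \<delta> \<epsilon>) (shift i) \<Otimes>\<^sub>M distr (color_measure q) (color_measure q) (shift i)"
    unfolding a(2) c(2) ..
  also have "\<dots> = distr (env \<delta> \<epsilon> q) (env \<delta> \<epsilon> q) (\<lambda>(X, Y). (shift i X, shift i Y))"
    by (rule pair_measure_distr[OF a(1) c(1)]) (unfold c(2), unfold_locales)
  finally show "distr (env \<delta> \<epsilon> q) (env \<delta> \<epsilon> q) (env_shift i) = env \<delta> \<epsilon> q"
    by (simp add: env_shift_def)
qed

text \<open>Arrows are merged with arrows and colors with colors, so the two copies of the
  environment have to be regrouped. This is done on rectangles by Fubini.\<close>

lemma env_merge:
  assumes q: "q \<ge> 1"
  shows "(\<lambda>p. env_merge n (fst p) (snd p)) \<in> measurable (env \<delta> \<epsilon> q \<Otimes>\<^sub>M env \<delta> \<epsilon> q) (env \<delta> \<epsilon> q)"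
    and "distr (env \<delta> \<epsilon> q \<Otimes>\<^sub>M env \<delta> \<epsilon> q) (env \<delta> \<epsilon> q) (\<lambda>p. env_merge n (fst p) (snd p)) = env \<delta> \<epsilon> q"
proof -
  let ?A = "arrow_measure \<delta> \<epsilon>" and ?C = "color_measure q" and ?Q = "env \<delta> \<epsilon> q"
  have U: "prob_space (uniform_count_measure {1..q})"
    using q by (intro prob_space_uniform_count_measure) auto
  note a = merge_rows_PiM[OF prob_space_measure_pmf[of "arrows_pmf \<delta> \<epsilon>"], of n, folded arrow_measure_def]
  note c = merge_rows_PiM[OF U, of n, folded color_measure_def]
  interpret A: prob_space ?A by (rule prob_space_arrow_measure)
  interpret C: prob_space ?C by (rule prob_space_color_measure[OF q])
  interpret Q: prob_space ?Q by (rule prob_space_env[OF q])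
  have ma: "(\<lambda>p. merge_rows n (fst (fst p)) (fst (snd p))) \<in> measurable (?Q \<Otimes>\<^sub>M ?Q) ?A"
    using measurable_compose[OF _ a(1), of "\<lambda>p. (fst (fst p), fst (snd p))" "?Q \<Otimes>\<^sub>M ?Q"] by simp
  have mc: "(\<lambda>p. merge_rows n (snd (fst p)) (snd (snd p))) \<in> measurable (?Q \<Otimes>\<^sub>M ?Q) ?C"
    using measurable_compose[OF _ c(1), of "\<lambda>p. (snd (fst p), snd (snd p))" "?Q \<Otimes>\<^sub>M ?Q"] by simp
  show m: "(\<lambda>p. env_merge n (fst p) (snd p)) \<in> measurable (?Q \<Otimes>\<^sub>M ?Q) ?Q"
    unfolding env_merge_def by (rule measurable_Pair[OF ma mc])
  have "?Q = distr (?Q \<Otimes>\<^sub>M ?Q) ?Q (\<lambda>p. env_merge n (fst p) (snd p))"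
  proof (rule pair_measure_eqI)
    show "sigma_finite_measure ?A" "sigma_finite_measure ?C" by unfold_locales
    fix E F assume EF: "E \<in> sets ?A" "F \<in> sets ?C"
    let ?e = "\<lambda>X X'. indicator E (merge_rows n X X') :: ennreal"
    let ?f = "\<lambda>Y Y'. indicator F (merge_rows n Y Y') :: ennreal"
    have me: "(\<lambda>(X, X'). ?e X X') \<in> borel_measurable (?A \<Otimes>\<^sub>M ?A)"
      using measurable_compose[OF a(1) borel_measurable_indicator[OF EF(1)]] by (simp add: case_prod_unfold)
    have mf: "(\<lambda>(Y, Y'). ?f Y Y') \<in> borel_measurable (?C \<Otimes>\<^sub>M ?C)"
      using measurable_compose[OF c(1) borel_measurable_indicator[OF EF(2)]] by (simp add: case_prod_unfold)
    define \<alpha> where "\<alpha> X = (\<integral>\<^sup>+X'. ?e X X' \<partial>?A)" for X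
    define \<gamma> where "\<gamma> Y = (\<integral>\<^sup>+Y'. ?f Y Y' \<partial>?C)" for Y
    have m\<alpha>: "\<alpha> \<in> borel_measurable ?A"
      unfolding \<alpha>_def[abs_def] by (rule A.borel_measurable_nn_integral[OF me])
    have m\<gamma>: "\<gamma> \<in> borel_measurable ?C"
      unfolding \<gamma>_def[abs_def] by (rule C.borel_measurable_nn_integral[OF mf])
    have "emeasure (distr (?Q \<Otimes>\<^sub>M ?Q) ?Q (\<lambda>p. env_merge n (fst p) (snd p))) (E \<times> F)
        = (\<integral>\<^sup>+\<omega>. indicator (E \<times> F) \<omega> \<partial>distr (?Q \<Otimes>\<^sub>M ?Q) ?Q (\<lambda>p. env_merge n (fst p) (snd p)))"
      using EF by (intro nn_integral_indicator[symmetric]) simp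
    also have "\<dots> = (\<integral>\<^sup>+p. indicator (E \<times> F) (env_merge n (fst p) (snd p)) \<partial>(?Q \<Otimes>\<^sub>M ?Q))"
      using EF by (intro nn_integral_distr[OF m]) simp
    also have "\<dots> = (\<integral>\<^sup>+\<omega>. \<integral>\<^sup>+\<omega>'. indicator (E \<times> F) (env_merge n \<omega> \<omega>') \<partial>?Q \<partial>?Q)"
      using measurable_compose[OF m borel_measurable_indicator[of "E \<times> F" ?Q]] EF
      by (subst Q.nn_integral_fst[symmetric]) simp_all
    also have "\<dots> = (\<integral>\<^sup>+\<omega>. \<alpha> (fst \<omega>) * \<gamma> (snd \<omega>) \<partial>?Q)"
    proof (rule nn_integral_cong)
      fix \<omega> assume \<omega>: "\<omega> \<in> space ?Q"
      have X: "fst \<omega> \<in> space ?A" and Y: "snd \<omega> \<in> space ?C"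
        using \<omega> by (auto simp: space_pair_measure)
      have "(\<integral>\<^sup>+\<omega>'. indicator (E \<times> F) (env_merge n \<omega> \<omega>') \<partial>?Q) = (\<integral>\<^sup>+\<omega>'. ?e (fst \<omega>) (fst \<omega>') * ?f (snd \<omega>) (snd \<omega>') \<partial>?Q)"
        by (intro nn_integral_cong) (auto simp: env_merge_def indicator_def)
      also have "\<dots> = \<alpha> (fst \<omega>) * \<gamma> (snd \<omega>)"
        unfolding \<alpha>_def \<gamma>_def
      proof (rule nn_integral_pair_prod)
        show "sigma_finite_measure ?C" by unfold_locales
        show "?e (fst \<omega>) \<in> borel_measurable ?A"
          using measurable_Pair2[OF me X] by simp
        show "?f (snd \<omega>) \<in> borel_measurable ?C"
          using measurable_Pair2[OF mf Y] by simp
      qed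
      finally show "(\<integral>\<^sup>+\<omega>'. indicator (E \<times> F) (env_merge n \<omega> \<omega>') \<partial>?Q) = \<alpha> (fst \<omega>) * \<gamma> (snd \<omega>)" .
    qed
    also have "\<dots> = (\<integral>\<^sup>+X. \<alpha> X \<partial>?A) * (\<integral>\<^sup>+Y. \<gamma> Y \<partial>?C)"
      by (rule nn_integral_pair_prod[OF _ m\<alpha> m\<gamma>]) unfold_locales
    also have "(\<integral>\<^sup>+X. \<alpha> X \<partial>?A) = emeasure ?A E"
    proof -
      have "(\<integral>\<^sup>+X. \<alpha> X \<partial>?A) = (\<integral>\<^sup>+p. indicator E (case p of (f, g) \<Rightarrow> merge_rows n f g) \<partial>(?A \<Otimes>\<^sub>M ?A))"
        unfolding \<alpha>_def using A.nn_integral_fst[OF me] by (simp add: case_prod_unfold)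
      also have "\<dots> = (\<integral>\<^sup>+X. indicator E X \<partial>distr (?A \<Otimes>\<^sub>M ?A) ?A (\<lambda>(f, g). merge_rows n f g))"
        using EF by (intro nn_integral_distr[OF a(1), symmetric]) simp
      finally show ?thesis using EF unfolding a(2) by simp
    qed
    also have "(\<integral>\<^sup>+Y. \<gamma> Y \<partial>?C) = emeasure ?C F"
    proof -
      have "(\<integral>\<^sup>+Y. \<gamma> Y \<partial>?C) = (\<integral>\<^sup>+p. indicator F (case p of (f, g) \<Rightarrow> merge_rows n f g) \<partial>(?C \<Otimes>\<^sub>M ?C))"
        unfolding \<gamma>_def using C.nn_integral_fst[OF mf] by (simp add: case_prod_unfold)
      also have "\<dots> = (\<integral>\<^sup>+Y. indicator F Y \<partial>distr (?C \<Otimes>\<^sub>M ?C) ?C (\<lambda>(f, g). merge_rows n f g))"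
        using EF by (intro nn_integral_distr[OF c(1), symmetric]) simp
      finally show ?thesis using EF unfolding c(2) by simp
    qed
    finally show "emeasure ?A E * emeasure ?C F
        = emeasure (distr (?Q \<Otimes>\<^sub>M ?Q) ?Q (\<lambda>p. env_merge n (fst p) (snd p))) (E \<times> F)" by simp
  qed simp
  then show "distr (?Q \<Otimes>\<^sub>M ?Q) ?Q (\<lambda>p. env_merge n (fst p) (snd p)) = ?Q" by simp
qed

lemma env_merge_initial:
  assumes q: "q \<ge> 1" and M: "prob_space M"
  shows "(\<lambda>p. (fst (fst p), env_merge n (snd (fst p)) (snd p))) \<in> measurable ((M \<Otimes>\<^sub>M env \<delta> \<epsilon> q) \<Otimes>\<^sub>M env \<delta> \<epsilon> q) (M \<Otimes>\<^sub>M env \<delta> \<epsilon> q)"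
    and "distr ((M \<Otimes>\<^sub>M env \<delta> \<epsilon> q) \<Otimes>\<^sub>M env \<delta> \<epsilon> q) (M \<Otimes>\<^sub>M env \<delta> \<epsilon> q) (\<lambda>p. (fst (fst p), env_merge n (snd (fst p)) (snd p)))
      = M \<Otimes>\<^sub>M env \<delta> \<epsilon> q"
proof -
  let ?Q = "env \<delta> \<epsilon> q"
  interpret M: prob_space M by fact
  interpret Q: prob_space ?Q by (rule prob_space_env[OF q])
  note e = env_merge[OF q, where n = n and \<delta> = \<delta> and \<epsilon> = \<epsilon>]
  have "(\<lambda>p. env_merge n (snd (fst p)) (snd p)) \<in> measurable ((M \<Otimes>\<^sub>M ?Q) \<Otimes>\<^sub>M ?Q) ?Q"
    using measurable_compose[OF _ e(1), of "\<lambda>p. (snd (fst p), snd p)" "(M \<Otimes>\<^sub>M ?Q) \<Otimes>\<^sub>M ?Q"] by simp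
  then show m: "(\<lambda>p. (fst (fst p), env_merge n (snd (fst p)) (snd p))) \<in> measurable ((M \<Otimes>\<^sub>M ?Q) \<Otimes>\<^sub>M ?Q) (M \<Otimes>\<^sub>M ?Q)"
    by (intro measurable_Pair) simp_all
  have "M \<Otimes>\<^sub>M ?Q = distr ((M \<Otimes>\<^sub>M ?Q) \<Otimes>\<^sub>M ?Q) (M \<Otimes>\<^sub>M ?Q) (\<lambda>p. (fst (fst p), env_merge n (snd (fst p)) (snd p)))"
  proof (rule pair_measure_eqI)
    show "sigma_finite_measure M" "sigma_finite_measure ?Q" by unfold_locales
    fix E F assume EF: "E \<in> sets M" "F \<in> sets ?Q"
    let ?f = "\<lambda>\<omega> \<omega>'. indicator F (env_merge n \<omega> \<omega>') :: ennreal"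
    have mf: "(\<lambda>(\<omega>, \<omega>'). ?f \<omega> \<omega>') \<in> borel_measurable (?Q \<Otimes>\<^sub>M ?Q)"
      using measurable_compose[OF e(1) borel_measurable_indicator[OF EF(2)]] by (simp add: case_prod_unfold)
    define \<gamma> where "\<gamma> \<omega> = (\<integral>\<^sup>+\<omega>'. ?f \<omega> \<omega>' \<partial>?Q)" for \<omega>
    have m\<gamma>: "\<gamma> \<in> borel_measurable ?Q"
      unfolding \<gamma>_def[abs_def] by (rule Q.borel_measurable_nn_integral[OF mf])
    have "emeasure (distr ((M \<Otimes>\<^sub>M ?Q) \<Otimes>\<^sub>M ?Q) (M \<Otimes>\<^sub>M ?Q) (\<lambda>p. (fst (fst p), env_merge n (snd (fst p)) (snd p)))) (E \<times> F)
        = (\<integral>\<^sup>+x. indicator (E \<times> F) x \<partial>distr ((M \<Otimes>\<^sub>M ?Q) \<Otimes>\<^sub>M ?Q) (M \<Otimes>\<^sub>M ?Q) (\<lambda>p. (fst (fst p), env_merge n (snd (fst p)) (snd p))))"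
      using EF by (intro nn_integral_indicator[symmetric]) simp
    also have "\<dots> = (\<integral>\<^sup>+p. indicator (E \<times> F) (fst (fst p), env_merge n (snd (fst p)) (snd p)) \<partial>((M \<Otimes>\<^sub>M ?Q) \<Otimes>\<^sub>M ?Q))"
      using EF by (intro nn_integral_distr[OF m]) simp
    also have "\<dots> = (\<integral>\<^sup>+p. \<integral>\<^sup>+\<omega>'. indicator (E \<times> F) (fst p, env_merge n (snd p) \<omega>') \<partial>?Q \<partial>(M \<Otimes>\<^sub>M ?Q))"
      using measurable_compose[OF m borel_measurable_indicator[of "E \<times> F" "M \<Otimes>\<^sub>M ?Q"]] EF
      by (subst Q.nn_integral_fst[symmetric]) simp_all
    also have "\<dots> = (\<integral>\<^sup>+p. indicator E (fst p) * \<gamma> (snd p) \<partial>(M \<Otimes>\<^sub>M ?Q))"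
    proof (rule nn_integral_cong)
      fix p assume p: "p \<in> space (M \<Otimes>\<^sub>M ?Q)"
      have "(\<integral>\<^sup>+\<omega>'. indicator (E \<times> F) (fst p, env_merge n (snd p) \<omega>') \<partial>?Q) = (\<integral>\<^sup>+\<omega>'. indicator E (fst p) * ?f (snd p) \<omega>' \<partial>?Q)"
        by (intro nn_integral_cong) (auto simp: indicator_def)
      also have "\<dots> = indicator E (fst p) * \<gamma> (snd p)"
        unfolding \<gamma>_def using p measurable_Pair2[OF mf, of "snd p"]
        by (intro nn_integral_cmult) (auto simp: space_pair_measure)
      finally show "(\<integral>\<^sup>+\<omega>'. indicator (E \<times> F) (fst p, env_merge n (snd p) \<omega>') \<partial>?Q) = indicator E (fst p) * \<gamma> (snd p)" .
    qed
    also have "\<dots> = (\<integral>\<^sup>+x. indicator E x \<partial>M) * (\<integral>\<^sup>+\<omega>. \<gamma> \<omega> \<partial>?Q)"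
      by (rule nn_integral_pair_prod[OF _ borel_measurable_indicator[OF EF(1)] m\<gamma>]) unfold_locales
    also have "(\<integral>\<^sup>+x. indicator E x \<partial>M) = emeasure M E"
      using EF by simp
    also have "(\<integral>\<^sup>+\<omega>. \<gamma> \<omega> \<partial>?Q) = emeasure ?Q F"
    proof -
      have "(\<integral>\<^sup>+\<omega>. \<gamma> \<omega> \<partial>?Q) = (\<integral>\<^sup>+p. indicator F (env_merge n (fst p) (snd p)) \<partial>(?Q \<Otimes>\<^sub>M ?Q))"
        unfolding \<gamma>_def using Q.nn_integral_fst[OF mf] by (simp add: case_prod_unfold)
      also have "\<dots> = (\<integral>\<^sup>+\<omega>. indicator F \<omega> \<partial>distr (?Q \<Otimes>\<^sub>M ?Q) ?Q (\<lambda>p. env_merge n (fst p) (snd p)))"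
        using EF by (intro nn_integral_distr[OF e(1), symmetric]) simp
      finally show ?thesis using EF unfolding e(2) by simp
    qed
    finally show "emeasure M E * emeasure ?Q F = emeasure (distr ((M \<Otimes>\<^sub>M ?Q) \<Otimes>\<^sub>M ?Q) (M \<Otimes>\<^sub>M ?Q)
        (\<lambda>p. (fst (fst p), env_merge n (snd (fst p)) (snd p)))) (E \<times> F)" by simp
  qed simp
  then show "distr ((M \<Otimes>\<^sub>M ?Q) \<Otimes>\<^sub>M ?Q) (M \<Otimes>\<^sub>M ?Q) (\<lambda>p. (fst (fst p), env_merge n (snd (fst p)) (snd p))) = M \<Otimes>\<^sub>M ?Q"
    by simp
qed

section \<open>The flow of the color process\<close>

definition row :: "nat \<Rightarrow> (int \<Rightarrow> nat) \<Rightarrow> (vertex \<Rightarrow> arrows) \<times> (vertex \<Rightarrow> nat) \<Rightarrow> int \<Rightarrow> nat" where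
  "row n z \<omega> = row_config z (fst \<omega>) (snd \<omega>) n"

text \<open>Parity is used in the base case, where \<open>x div 2\<close> has to undo the doubling
  of the index in \<open>row_config\<close>.\<close>

lemma vertex_color_cocycle:
  assumes "even (x + int n)"
  shows "vertex_color z X Y (m + n) (x - int m)
    = vertex_color (row_config z X Y m) (shift (- int m) X) (shift (- int m) Y) n x"
  using assms
proof (induction n arbitrary: x)
  case 0
  then show ?case by (auto simp: row_config_def)
next
  case (Suc n)
  let ?v = "(x, - int (Suc n))"
  have IH: "vertex_color z X Y (m + n) (x - int m - 1)
      = vertex_color (row_config z X Y m) (shift (- int m) X) (shift (- int m) Y) n (x - 1)"
    "vertex_color z X Y (m + n) (x - int m + 1)
      = vertex_color (row_config z X Y m) (shift (- int m) X) (shift (- int m) Y) n (x + 1)"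
    using Suc.IH[of "x - 1"] Suc.IH[of "x + 1"] Suc.prems by (simp_all add: algebra_simps)
  have "?v \<in> vertices"
    using Suc.prems by (simp add: vertices_def)
  then have sh: "shift (- int m) f ?v = f (x - int m, - int (Suc (m + n)))" for f :: "vertex \<Rightarrow> 'a"
    by (simp add: shift_def algebra_simps)
  show ?case
    unfolding add_Suc_right vertex_color.simps(2) IH by (simp only: Let_def sh)
qed

lemma row_add: "row (m + n) z \<omega> = row n (row m z \<omega>) (env_shift (- int m) \<omega>)"
proof
  fix k
  show "row (m + n) z \<omega> k = row n (row m z \<omega>) (env_shift (- int m) \<omega>) k"
    using vertex_color_cocycle[of "2 * k - int n" n z "fst \<omega>" "snd \<omega>" m]
    by (simp add: row_def row_config_def env_shift_def case_prod_unfold algebra_simps)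
qed

lemma row_vertex: "(2 * k - int n, - int n) \<in> vertices"
  by (simp add: vertices_def)

lemma row_cong:
  assumes "\<And>u. u \<in> vertices \<Longrightarrow> - int n \<le> snd u \<Longrightarrow> snd u \<le> - 1 \<Longrightarrow> fst \<omega> u = fst \<omega>' u \<and> snd \<omega> u = snd \<omega>' u"
  shows "row n z \<omega> = row n z \<omega>'"
  unfolding row_def row_config_def
proof (rule ext, rule vertex_color_cong)
  fix k u assume u: "u \<in> cone_at (2 * k - int n, - int n) n" "snd u \<le> - 1"
  show "fst \<omega> u = fst \<omega>' u \<and> snd \<omega> u = snd \<omega>' u"
    using assms[of u] u cone_at_level[OF u(1)] cone_at_vertices[OF row_vertex, of k n n] by auto
qed

text \<open>Pathwise form of the Markov property: the first \<open>n\<close> steps read only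
  \<omega>, the last one only \<open>\<omega>'\<close>.\<close>

lemma row_Suc_merge: "row (Suc n) z (env_merge n \<omega> \<omega>') = row 1 (row n z \<omega>) \<omega>'"
proof -
  have "row (Suc n) z (env_merge n \<omega> \<omega>') = row 1 (row n z (env_merge n \<omega> \<omega>')) (env_shift (- int n) (env_merge n \<omega> \<omega>'))"
    using row_add[of n 1 z "env_merge n \<omega> \<omega>'"] by simp
  also have "row n z (env_merge n \<omega> \<omega>') = row n z \<omega>"
    by (rule row_cong) (simp add: env_merge_def merge_rows_def)
  also have "row 1 (row n z \<omega>) (env_shift (- int n) (env_merge n \<omega> \<omega>')) = row 1 (row n z \<omega>) \<omega>'"
  proof (rule row_cong)
    fix u :: vertex assume u: "u \<in> vertices" "- int 1 \<le> snd u" "snd u \<le> - 1"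
    then have w: "u + (- int n, - int n) \<in> vertices" "\<not> - int n \<le> snd (u + (- int n, - int n))"
      by (simp_all only: diagonal_vertices) (cases u; simp)
    have "u + (- int n, - int n) + (int n, int n) = u"
      by (cases u) simp
    then show "fst (env_shift (- int n) (env_merge n \<omega> \<omega>')) u = fst \<omega>' u \<and> snd (env_shift (- int n) (env_merge n \<omega> \<omega>')) u = snd \<omega>' u"
      using u w by (simp only: env_shift_def env_merge_def merge_rows_def shift_def case_prod_conv
          fst_conv snd_conv restrict_apply if_True if_False simp_thms)
  qed
  finally show ?thesis .
qed

text \<open>This locality lets coordinatewise convergence pass through one step of the
  process.\<close>

lemma row_one_cong: "z (k - 1) = z' (k - 1) \<Longrightarrow> z k = z' k \<Longrightarrow> row 1 z \<omega> k = row 1 z' \<omega> k"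
  by (cases "fst \<omega> (2 * k - 1, - 1)") (simp_all add: row_def row_config_def Let_def)

text \<open>\<open>past n z\<close> colors row 0 by the process started with \<open>z\<close> in the row at height \<open>n\<close>.\<close>

definition past :: "nat \<Rightarrow> (int \<Rightarrow> nat) \<Rightarrow> (vertex \<Rightarrow> arrows) \<times> (vertex \<Rightarrow> nat) \<Rightarrow> int \<Rightarrow> nat" where
  "past n z \<omega> = row n z (env_shift (int n) \<omega>)"

lemma past_add: "past (m + n) z \<omega> = past n (row m z (env_shift (int (m + n)) \<omega>)) \<omega>"
  unfolding past_def row_add by (simp add: env_shift_def case_prod_unfold shift_shift)

text \<open>A start higher up only changes the coloring of the row at height \<open>n\<close>, on
  which an already determined color does not depend.\<close>

lemma past_determined:
  assumes "\<not> undetermined n (2 * k - int n) (fst (env_shift (int n) \<omega>)) (snd (env_shift (int n) \<omega>))" "n \<le> m"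
  shows "past m z \<omega> k = past n z' \<omega> k"
proof -
  have "past n u \<omega> k = past n z' \<omega> k" for u
    using assms(1) unfolding undetermined_def past_def row_def row_config_def by blast
  moreover have "past m z \<omega> = past n (row (m - n) z (env_shift (int m) \<omega>)) \<omega>"
    using past_add[of "m - n" n z \<omega>] assms(2) by simp
  ultimately show ?thesis by simp
qed

section \<open>Coupling from the past\<close>

locale color_process =
  fixes q :: nat and \<delta> \<epsilon> :: real
  assumes q: "q \<ge> 1" and \<delta>: "\<delta> \<in> {0..1}" and \<epsilon>: "\<epsilon> \<in> {0..1}"
    and reach: "(\<lambda>n. reach_prob n \<delta> \<epsilon> (1 / real q)) \<longlonglongrightarrow> 0"
begin

abbreviation Q where "Q \<equiv> env \<delta> \<epsilon> q"
abbreviation S where "S \<equiv> config_space q"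

sublocale Q: prob_space Q
  by (rule prob_space_env[OF q])

lemma measurable_row [measurable]: "sets \<mu> = sets S \<Longrightarrow> (\<lambda>p. row n (fst p) (snd p)) \<in> measurable (\<mu> \<Otimes>\<^sub>M Q) S"
  using measurable_row_config[of \<mu> q n \<delta> \<epsilon>] by (simp add: row_def case_prod_unfold)

lemma measurable_past: "sets \<mu> = sets S \<Longrightarrow> (\<lambda>p. past n (fst p) (snd p)) \<in> measurable (\<mu> \<Otimes>\<^sub>M Q) S"
proof -
  assume \<mu>: "sets \<mu> = sets S"
  have "(\<lambda>p. (fst p, env_shift (int n) (snd p))) \<in> measurable (\<mu> \<Otimes>\<^sub>M Q) (\<mu> \<Otimes>\<^sub>M Q)"
    by (intro measurable_Pair measurable_fst measurable_compose[OF measurable_snd env_shift(1)[OF q]])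
  from measurable_compose[OF this measurable_row[OF \<mu>]] show ?thesis
    by (simp add: past_def)
qed

lemma row_law_row: "row_law q \<delta> \<epsilon> \<mu> n = distr (\<mu> \<Otimes>\<^sub>M Q) S (\<lambda>p. row n (fst p) (snd p))"
  by (simp add: row_law_def row_def case_prod_unfold)

lemma initial:
  assumes "initial_distribution q \<mu>"
  shows "prob_space \<mu>" "sets \<mu> = sets S"
  using assms by (simp_all add: initial_distribution_def)

lemma prob_space_pair: "prob_space M \<Longrightarrow> prob_space (M \<Otimes>\<^sub>M Q)"
  using prob_space_pair[of M Q] Q.prob_space_axioms by blast

text \<open>For each fixed \<open>n\<close> this is shift invariance of the environment. The gain is
  that \<open>past\<close> settles down along a fixed environment as \<open>n\<close> grows.\<close>

lemma row_law_past:
  assumes "initial_distribution q \<mu>"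
  shows "row_law q \<delta> \<epsilon> \<mu> n = distr (\<mu> \<Otimes>\<^sub>M Q) S (\<lambda>p. past n (fst p) (snd p))"
proof -
  note \<mu> = initial[OF assms]
  interpret \<mu>: prob_space \<mu> by (rule \<mu>(1))
  note e = env_shift[OF q, where i = "int n" and \<delta> = \<delta> and \<epsilon> = \<epsilon>]
  have "\<mu> \<Otimes>\<^sub>M Q = distr \<mu> \<mu> (\<lambda>x. x) \<Otimes>\<^sub>M distr Q Q (env_shift (int n))"
    unfolding e(2) by (simp add: distr_id2)
  also have "\<dots> = distr (\<mu> \<Otimes>\<^sub>M Q) (\<mu> \<Otimes>\<^sub>M Q) (\<lambda>(x, y). (x, env_shift (int n) y))"
    by (rule pair_measure_distr[OF _ e(1)]) (simp_all add: e(2) Q.sigma_finite_measure_axioms)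
  finally have eq: "\<mu> \<Otimes>\<^sub>M Q = distr (\<mu> \<Otimes>\<^sub>M Q) (\<mu> \<Otimes>\<^sub>M Q) (\<lambda>p. (fst p, env_shift (int n) (snd p)))"
    by (simp add: case_prod_unfold)
  have m: "(\<lambda>p. (fst p, env_shift (int n) (snd p))) \<in> measurable (\<mu> \<Otimes>\<^sub>M Q) (\<mu> \<Otimes>\<^sub>M Q)"
    by (intro measurable_Pair measurable_fst measurable_compose[OF measurable_snd e(1)])
  show ?thesis
    unfolding row_law_row by (subst eq, subst distr_distr[OF measurable_row[OF \<mu>(2)] m]) (simp add: comp_def past_def)
qed

lemma row_law_distr_one:
  assumes M: "prob_space M" and H: "H \<in> measurable M S"
  shows "row_law q \<delta> \<epsilon> (distr M S H) 1 = distr (M \<Otimes>\<^sub>M Q) S (\<lambda>p. row 1 (H (fst p)) (snd p))"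
proof -
  have "distr M S H \<Otimes>\<^sub>M Q = distr M S H \<Otimes>\<^sub>M distr Q Q (\<lambda>x. x)"
    by (simp add: distr_id2)
  also have "\<dots> = distr (M \<Otimes>\<^sub>M Q) (S \<Otimes>\<^sub>M Q) (\<lambda>(x, y). (H x, y))"
    by (rule pair_measure_distr[OF H]) (simp_all add: distr_id2 Q.sigma_finite_measure_axioms)
  finally have eq: "distr M S H \<Otimes>\<^sub>M Q = distr (M \<Otimes>\<^sub>M Q) (S \<Otimes>\<^sub>M Q) (\<lambda>p. (H (fst p), snd p))"
    by (simp add: case_prod_unfold)
  have m: "(\<lambda>p. (H (fst p), snd p)) \<in> measurable (M \<Otimes>\<^sub>M Q) (S \<Otimes>\<^sub>M Q)"
    by (intro measurable_Pair measurable_snd measurable_compose[OF measurable_fst H])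
  show ?thesis
    unfolding row_law_row eq by (subst distr_distr[OF measurable_row[OF refl] m]) (simp add: comp_def)
qed

text \<open>The last step can be driven by a second, independent environment, since merging
  preserves the law.\<close>

lemma row_law_Suc:
  assumes "initial_distribution q \<mu>"
  shows "row_law q \<delta> \<epsilon> \<mu> (Suc n) = row_law q \<delta> \<epsilon> (row_law q \<delta> \<epsilon> \<mu> n) 1"
proof -
  note \<mu> = initial[OF assms]
  note e = env_merge_initial[OF q \<mu>(1), where n = n and \<delta> = \<delta> and \<epsilon> = \<epsilon>]
  have "row_law q \<delta> \<epsilon> \<mu> (Suc n) = distr (distr ((\<mu> \<Otimes>\<^sub>M Q) \<Otimes>\<^sub>M Q) (\<mu> \<Otimes>\<^sub>M Q)
      (\<lambda>p. (fst (fst p), env_merge n (snd (fst p)) (snd p)))) S (\<lambda>p. row (Suc n) (fst p) (snd p))"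
    unfolding row_law_row e(2) ..
  also have "\<dots> = distr ((\<mu> \<Otimes>\<^sub>M Q) \<Otimes>\<^sub>M Q) S (\<lambda>p. row 1 (row n (fst (fst p)) (snd (fst p))) (snd p))"
    by (subst distr_distr[OF measurable_row[OF \<mu>(2)] e(1)]) (simp only: comp_def fst_conv snd_conv row_Suc_merge)
  also have "\<dots> = row_law q \<delta> \<epsilon> (row_law q \<delta> \<epsilon> \<mu> n) 1"
    unfolding row_law_row[of \<mu> n] by (rule row_law_distr_one[OF prob_space_pair[OF \<mu>(1)] measurable_row[OF \<mu>(2)], symmetric])
  finally show ?thesis .
qed

lemma AE_determined:
  "AE \<omega> in Q. \<forall>k. \<exists>n. \<not> undetermined n (2 * k - int n) (fst (env_shift (int n) \<omega>)) (snd (env_shift (int n) \<omega>))"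
  unfolding AE_all_countable
proof
  fix k
  let ?D = "\<lambda>n. {\<omega> \<in> space Q. undetermined n (2 * k - int n) (fst \<omega>) (snd \<omega>)}"
  let ?E = "\<lambda>n. {\<omega> \<in> space Q. undetermined n (2 * k - int n) (fst (env_shift (int n) \<omega>)) (snd (env_shift (int n) \<omega>))}"
  have E: "?E (Suc n) \<in> sets Q" "measure Q (?E (Suc n)) \<le> reach_prob n \<delta> \<epsilon> (1 / real q)" for n
  proof -
    note e = env_shift[OF q, where i = "int (Suc n)" and \<delta> = \<delta> and \<epsilon> = \<epsilon>]
    note D = measure_undetermined_le[OF \<delta> \<epsilon> q row_vertex[of k "Suc n"]]
    have eq: "?E (Suc n) = env_shift (int (Suc n)) -` ?D (Suc n) \<inter> space Q"
      using measurable_space[OF e(1)] by auto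
    show "?E (Suc n) \<in> sets Q"
      unfolding eq by (rule measurable_sets[OF e(1) D(1)])
    have "measure Q (?E (Suc n)) = measure (distr Q Q (env_shift (int (Suc n)))) (?D (Suc n))"
      unfolding eq by (rule measure_distr[OF e(1) D(1), symmetric])
    then show "measure Q (?E (Suc n)) \<le> reach_prob n \<delta> \<epsilon> (1 / real q)"
      unfolding e(2) using D(2) by simp
  qed
  \<comment> \<open>The environments in which index \<open>k\<close> is never determined lie in
    \<open>Z\<close>, whose measure is below every member of a null sequence.\<close>
  define Z where "Z = (\<Inter>n. ?E (Suc n))"
  have Z: "Z \<in> sets Q"
    unfolding Z_def by (rule sets.countable_INT) (use E in auto)
  have "measure Q Z \<le> reach_prob n \<delta> \<epsilon> (1 / real q)" for n
  proof -
    have "measure Q Z \<le> measure Q (?E (Suc n))"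
      by (rule Q.finite_measure_mono[OF _ E(1)]) (auto simp: Z_def)
    then show ?thesis using E(2)[of n] by linarith
  qed
  then have "measure Q Z \<le> 0"
    by (intro LIMSEQ_le_const[OF reach]) blast
  then have null: "emeasure Q Z = 0"
    using Q.emeasure_eq_measure[of Z] measure_nonneg[of Q Z] by (simp add: ennreal_eq_0_iff)
  show "AE \<omega> in Q. \<exists>n. \<not> undetermined n (2 * k - int n) (fst (env_shift (int n) \<omega>)) (snd (env_shift (int n) \<omega>))"
  proof (rule AE_I[OF _ null Z])
    show "{\<omega> \<in> space Q. \<not> (\<exists>n. \<not> undetermined n (2 * k - int n) (fst (env_shift (int n) \<omega>))
        (snd (env_shift (int n) \<omega>)))} \<subseteq> Z"
      unfolding Z_def by blast
  qed
qed

text \<open>The alternative \<open>c = q\<close> gives a value even where the sequence has no limit,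
  and keeps it in the color range. It does not interfere with an existing limit, which is at most
  \<open>q\<close>.\<close>

definition limit_row :: "(vertex \<Rightarrow> arrows) \<times> (vertex \<Rightarrow> nat) \<Rightarrow> int \<Rightarrow> nat" where
  "limit_row \<omega> k = (LEAST c. (\<forall>\<^sub>F n in sequentially. past n (\<lambda>_. 1) \<omega> k = c) \<or> c = q)"

lemma one_in_S: "(\<lambda>_. 1) \<in> space S"
  using q by (auto simp: space_config PiE_iff)

lemma measurable_past_one: "past n (\<lambda>_. 1) \<in> measurable Q S"
  using measurable_compose[OF measurable_Pair1'[OF one_in_S] measurable_past[OF refl, of n]] by simp

lemma past_one_range: "\<omega> \<in> space Q \<Longrightarrow> past n (\<lambda>_. 1) \<omega> k \<in> {1..q}"
  using measurable_space[OF measurable_past_one[of n], of \<omega>] unfolding space_config by blast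

lemma limit_row_range:
  assumes "\<omega> \<in> space Q"
  shows "limit_row \<omega> k \<in> {1..q}"
proof -
  let ?P = "\<lambda>c. (\<forall>\<^sub>F n in sequentially. past n (\<lambda>_. 1) \<omega> k = c) \<or> c = q"
  have "limit_row \<omega> k \<le> q"
    unfolding limit_row_def by (rule Least_le) simp
  moreover have "?P (limit_row \<omega> k)"
    unfolding limit_row_def by (rule LeastI[of _ q]) simp
  then have "limit_row \<omega> k \<ge> 1"
  proof
    assume "\<forall>\<^sub>F n in sequentially. past n (\<lambda>_. 1) \<omega> k = limit_row \<omega> k"
    from eventually_happens'[OF sequentially_bot this]
    obtain n where "past n (\<lambda>_. 1) \<omega> k = limit_row \<omega> k" by blast
    then show ?thesis using past_one_range[OF assms, of n k] by simp
  qed (use q in simp)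
  ultimately show ?thesis by simp
qed

lemma measurable_limit_row: "limit_row \<in> measurable Q S"
proof -
  have past: "Measurable.pred Q (\<lambda>\<omega>. past n (\<lambda>_. 1) \<omega> k = c)" for n k c
    using measurable_compose[OF measurable_compose[OF measurable_past_one[of n] measurable_config_component[of k q]], of "\<lambda>x. x = c"]
    by simp
  have "(\<lambda>\<omega>. limit_row \<omega> k) \<in> measurable Q (count_space UNIV)" for k
    unfolding limit_row_def eventually_sequentially
    by (intro measurable_Least pred_intros_logic pred_intros_countable past) simp_all
  then have "(\<lambda>\<omega>. limit_row \<omega> k) \<in> measurable Q (count_space {1..q})" for k
    using limit_row_range[of _ k] by (intro measurable_count_space_eq2_countable[THEN iffD2]) (auto intro: measurable_sets)
  then show ?thesis
    unfolding config_space_def using limit_row_range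
    by (intro measurable_PiM_single') (simp_all add: PiE_UNIV_domain Pi_def)
qed

text \<open>The exceptional null set is the same for all \<open>z\<close>, so the start may be
  random and may vary with \<open>n\<close>'s limit taken afterwards on a product space.\<close>

lemma past_tendsto: "AE \<omega> in Q. \<forall>z k. \<forall>\<^sub>F n in sequentially. past n z \<omega> k = limit_row \<omega> k"
  using AE_determined
proof (rule AE_mp, intro AE_I2 impI allI)
  fix \<omega> z k assume \<omega>: "\<omega> \<in> space Q"
    and "\<forall>k. \<exists>n. \<not> undetermined n (2 * k - int n) (fst (env_shift (int n) \<omega>)) (snd (env_shift (int n) \<omega>))"
  then obtain n where n: "\<not> undetermined n (2 * k - int n) (fst (env_shift (int n) \<omega>)) (snd (env_shift (int n) \<omega>))"
    by blast
  define c where "c = past n (\<lambda>_. 1) \<omega> k"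
  have ev: "\<forall>\<^sub>F m in sequentially. past m z \<omega> k = c" for z
    using eventually_ge_at_top[of n] by eventually_elim (simp add: c_def past_determined[OF n])
  have "limit_row \<omega> k = c"
    unfolding limit_row_def
  proof (rule Least_equality)
    show "(\<forall>\<^sub>F n in sequentially. past n (\<lambda>_. 1) \<omega> k = c) \<or> c = q"
      using ev by blast
    fix d assume "(\<forall>\<^sub>F n in sequentially. past n (\<lambda>_. 1) \<omega> k = d) \<or> d = q"
    then show "c \<le> d"
    proof
      assume "\<forall>\<^sub>F n in sequentially. past n (\<lambda>_. 1) \<omega> k = d"
      then have "\<forall>\<^sub>F n in sequentially. c = d"
        using ev[of "\<lambda>_. 1"] by eventually_elim simp
      then show ?thesis by simp
    next
      assume "d = q"
      then show ?thesis using past_one_range[OF \<omega>, of n k] by (simp add: c_def)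
    qed
  qed
  then show "\<forall>\<^sub>F m in sequentially. past m z \<omega> k = limit_row \<omega> k"
    using ev by simp
qed

definition limit_law :: "(int \<Rightarrow> nat) measure" where
  "limit_law = distr Q S limit_row"

lemma initial_limit_law: "initial_distribution q limit_law"
  unfolding initial_distribution_def limit_law_def
  by (simp add: Q.prob_space_distr[OF measurable_limit_row])

text \<open>Realizes the limit on the space that also carries the initial coloring, where it is
  coupled with \<open>past\<close>.\<close>

lemma limit_law_snd:
  assumes "prob_space M"
  shows "limit_law = distr (M \<Otimes>\<^sub>M Q) S (\<lambda>p. limit_row (snd p))"
proof -
  have "limit_law = distr (distr (M \<Otimes>\<^sub>M Q) Q snd) S limit_row"
    unfolding limit_law_def distr_snd[OF assms Q.prob_space_axioms] ..
  then show ?thesis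
    by (subst (asm) distr_distr[OF measurable_limit_row measurable_snd]) (simp add: comp_def)
qed

lemma past_tendsto_snd:
  assumes "prob_space M"
  shows "AE p in M \<Otimes>\<^sub>M Q. \<forall>z k. \<forall>\<^sub>F n in sequentially. past n z (snd p) k = limit_row (snd p) k"
proof (rule AE_distrD[of snd "M \<Otimes>\<^sub>M Q" Q])
  show "AE \<omega> in distr (M \<Otimes>\<^sub>M Q) Q snd. \<forall>z k. \<forall>\<^sub>F n in sequentially. past n z \<omega> k = limit_row \<omega> k"
    unfolding distr_snd[OF assms Q.prob_space_axioms] by (rule past_tendsto)
qed simp

lemma row_law_converges:
  assumes "initial_distribution q \<mu>"
  shows "weakly_converges (config_topology q) (row_law q \<delta> \<epsilon> \<mu>) limit_law"
  unfolding weakly_converges_def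
proof (intro allI impI, elim conjE)
  note \<mu> = initial[OF assms]
  fix f :: "(int \<Rightarrow> nat) \<Rightarrow> real"
  assume f: "continuous_map (config_topology q) euclideanreal f" "bounded (f ` topspace (config_topology q))"
  show "(\<lambda>n. integral\<^sup>L (row_law q \<delta> \<epsilon> \<mu> n) f) \<longlonglongrightarrow> integral\<^sup>L limit_law f"
    unfolding row_law_past[OF assms] limit_law_snd[OF \<mu>(1)]
  proof (rule integral_coupling_tendsto[OF prob_space_pair[OF \<mu>(1)] measurable_past[OF \<mu>(2)] _ _ f q])
    show "(\<lambda>p. limit_row (snd p)) \<in> measurable (\<mu> \<Otimes>\<^sub>M Q) S"
      by (rule measurable_compose[OF measurable_snd measurable_limit_row])
    show "AE p in \<mu> \<Otimes>\<^sub>M Q. \<forall>k. \<forall>\<^sub>F n in sequentially. past n (fst p) (snd p) k = limit_row (snd p) k"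
      using past_tendsto_snd[OF \<mu>(1)] by (rule AE_mp) (intro AE_I2 impI, blast)
  qed
qed

text \<open>Started from the limit law, the law after \<open>n + 1\<close> steps tends to the limit
  law. It is also one step applied to \<open>past n\<close>, and since a step is local it tends to
  one step applied to the limit. The two limits agree.\<close>

lemma limit_law_invariant: "row_law q \<delta> \<epsilon> limit_law 1 = limit_law"
proof (rule config_measure_eqI[of q])
  note \<mu> = initial[OF initial_limit_law]
  let ?\<mu> = limit_law and ?M = "limit_law \<Otimes>\<^sub>M Q"
  have M: "prob_space ?M" by (rule prob_space_pair[OF \<mu>(1)])
  have MQ: "prob_space (?M \<Otimes>\<^sub>M Q)" by (rule prob_space_pair[OF M])
  note past = measurable_past[OF \<mu>(2)]
  have lim: "(\<lambda>p. limit_row (snd p)) \<in> measurable ?M S"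
    by (rule measurable_compose[OF measurable_snd measurable_limit_row])
  have row1: "(\<lambda>p. row 1 (H (fst p)) (snd p)) \<in> measurable (?M \<Otimes>\<^sub>M Q) S" if "H \<in> measurable ?M S" for H
  proof -
    have "(\<lambda>p. (H (fst p), snd p)) \<in> measurable (?M \<Otimes>\<^sub>M Q) (S \<Otimes>\<^sub>M Q)"
      by (intro measurable_Pair measurable_snd measurable_compose[OF measurable_fst that])
    from measurable_compose[OF this measurable_row[OF refl]] show ?thesis
      by simp
  qed
  show "initial_distribution q (row_law q \<delta> \<epsilon> ?\<mu> 1)"
    by (rule initial_distribution_row_law[OF initial_limit_law q])
  show "initial_distribution q ?\<mu>" by (rule initial_limit_law)
  fix f :: "(int \<Rightarrow> nat) \<Rightarrow> real"
  assume f: "continuous_map (config_topology q) euclideanreal f" "bounded (f ` topspace (config_topology q))"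
  have a: "row_law q \<delta> \<epsilon> ?\<mu> (Suc n) = distr (?M \<Otimes>\<^sub>M Q) S (\<lambda>p. row 1 (past n (fst (fst p)) (snd (fst p))) (snd p))" for n
    by (subst row_law_Suc[OF initial_limit_law], subst row_law_past[OF initial_limit_law, of n])
      (rule row_law_distr_one[OF M past])
  have b: "row_law q \<delta> \<epsilon> ?\<mu> 1 = distr (?M \<Otimes>\<^sub>M Q) S (\<lambda>p. row 1 (limit_row (snd (fst p))) (snd p))"
    by (subst limit_law_snd[OF \<mu>(1)]) (rule row_law_distr_one[OF M lim])
  have "(\<lambda>n. integral\<^sup>L (row_law q \<delta> \<epsilon> ?\<mu> (Suc n)) f) \<longlonglongrightarrow> integral\<^sup>L (row_law q \<delta> \<epsilon> ?\<mu> 1) f"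
    unfolding a b
  proof (rule integral_coupling_tendsto[OF MQ row1[OF past] row1[OF lim] _ f q])
    have "AE p in ?M \<Otimes>\<^sub>M Q. \<forall>z k. \<forall>\<^sub>F n in sequentially. past n z (snd (fst p)) k = limit_row (snd (fst p)) k"
    proof (rule AE_distrD[of fst "?M \<Otimes>\<^sub>M Q" ?M])
      have d: "distr (?M \<Otimes>\<^sub>M Q) ?M fst = ?M"
        by (rule distr_fst[OF M Q.prob_space_axioms])
      show "AE p in distr (?M \<Otimes>\<^sub>M Q) ?M fst. \<forall>z k. \<forall>\<^sub>F n in sequentially. past n z (snd p) k = limit_row (snd p) k"
        by (subst d) (rule past_tendsto_snd[OF \<mu>(1)])
    qed simp
    then show "AE p in ?M \<Otimes>\<^sub>M Q. \<forall>k. \<forall>\<^sub>F n in sequentially.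
        row 1 (past n (fst (fst p)) (snd (fst p))) (snd p) k = row 1 (limit_row (snd (fst p))) (snd p) k"
    proof (rule AE_mp, intro AE_I2 impI allI)
      fix p :: "((int \<Rightarrow> nat) \<times> (int \<times> int \<Rightarrow> arrows) \<times> (int \<times> int \<Rightarrow> nat)) \<times> (int \<times> int \<Rightarrow> arrows) \<times> (int \<times> int \<Rightarrow> nat)" and k
      assume *: "\<forall>z k. \<forall>\<^sub>F n in sequentially. past n z (snd (fst p)) k = limit_row (snd (fst p)) k"
      have "\<forall>\<^sub>F n in sequentially. past n (fst (fst p)) (snd (fst p)) (k - 1) = limit_row (snd (fst p)) (k - 1)"
        "\<forall>\<^sub>F n in sequentially. past n (fst (fst p)) (snd (fst p)) k = limit_row (snd (fst p)) k"
        using * by blast+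
      then show "\<forall>\<^sub>F n in sequentially. row 1 (past n (fst (fst p)) (snd (fst p))) (snd p) k = row 1 (limit_row (snd (fst p))) (snd p) k"
        by eventually_elim (rule row_one_cong)
    qed
  qed
  moreover have "(\<lambda>n. integral\<^sup>L (row_law q \<delta> \<epsilon> ?\<mu> (Suc n)) f) \<longlonglongrightarrow> integral\<^sup>L ?\<mu> f"
    using row_law_converges[OF initial_limit_law] f unfolding weakly_converges_def by (intro LIMSEQ_Suc) blast
  ultimately show "integral\<^sup>L (row_law q \<delta> \<epsilon> ?\<mu> 1) f = integral\<^sup>L ?\<mu> f"
    by (rule LIMSEQ_unique)
qed

text \<open>Started from an invariant law the sequence of laws is constant, and it converges to
  \<open>limit_law\<close>.\<close>

lemma invariant_unique:
  assumes "invariant_distribution q \<delta> \<epsilon> \<nu>"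
  shows "\<nu> = limit_law"
proof (rule config_measure_eqI[of q])
  have \<nu>: "initial_distribution q \<nu>" "row_law q \<delta> \<epsilon> \<nu> 1 = \<nu>"
    using assms by (simp_all add: invariant_distribution_def)
  show "initial_distribution q \<nu>" "initial_distribution q limit_law"
    using \<nu> initial_limit_law by auto
  have \<nu>n: "row_law q \<delta> \<epsilon> \<nu> (Suc n) = \<nu>" for n
  proof (induction n)
    case 0
    show ?case using \<nu>(2) by simp
  next
    case (Suc n)
    then show ?case
      unfolding row_law_Suc[OF \<nu>(1), of "Suc n"] using \<nu>(2) by simp
  qed
  fix f :: "(int \<Rightarrow> nat) \<Rightarrow> real"
  assume f: "continuous_map (config_topology q) euclideanreal f" "bounded (f ` topspace (config_topology q))"
  then have "(\<lambda>n. integral\<^sup>L (row_law q \<delta> \<epsilon> \<nu> n) f) \<longlonglongrightarrow> integral\<^sup>L limit_law f"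
    using row_law_converges[OF \<nu>(1)] unfolding weakly_converges_def by blast
  from LIMSEQ_Suc[OF this] have "(\<lambda>n. integral\<^sup>L \<nu> f) \<longlonglongrightarrow> integral\<^sup>L limit_law f"
    unfolding \<nu>n .
  then show "integral\<^sup>L \<nu> f = integral\<^sup>L limit_law f"
    by (simp add: tendsto_const_iff LIMSEQ_const_iff)
qed

lemma ergodic: "color_process_ergodic q \<delta> \<epsilon>"
  unfolding color_process_ergodic_def
proof (intro exI[of _ limit_law] conjI allI impI)
  show "invariant_distribution q \<delta> \<epsilon> limit_law"
    unfolding invariant_distribution_def by (intro conjI initial_limit_law limit_law_invariant)
qed (rule invariant_unique row_law_converges; assumption)+

end

theorem theorem2:
  fixes \<delta> :: real and q :: nat
  assumes "0 < \<delta>" and "\<delta> \<le> 1" and "2 \<le> q"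
  shows "\<exists>\<epsilon>\<^sub>c'::real. \<epsilon>\<^sub>c' < percolation_threshold \<delta> \<and>
           (\<forall>\<epsilon>\<in>{0..1}. \<epsilon> > \<epsilon>\<^sub>c' \<longrightarrow> color_process_ergodic q \<delta> \<epsilon>)"
proof -
  have s: "0 < 1 / real q" "1 / real q \<le> 1"
    using assms(3) by simp_all
  obtain \<epsilon>' where \<epsilon>': "\<epsilon>' < percolation_threshold \<delta>"
    "\<And>\<epsilon>. \<epsilon> \<in> {0..1} \<Longrightarrow> \<epsilon> > \<epsilon>' \<Longrightarrow> (\<lambda>n. reach_prob n \<delta> \<epsilon> (1 / real q)) \<longlonglongrightarrow> 0"
    using reach_prob_tendsto_0_below_threshold[OF assms(1,2) s] by blast
  have "color_process_ergodic q \<delta> \<epsilon>" if "\<epsilon> \<in> {0..1}" "\<epsilon> > \<epsilon>'" for \<epsilon>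
  proof -
    interpret color_process q \<delta> \<epsilon>
      using assms that \<epsilon>' by unfold_locales auto
    show ?thesis by (rule ergodic)
  qed
  then show ?thesis
    using \<epsilon>'(1) by blast
qed

end
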